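(* Let $r>0$ be an integer and let $[r]=\{1,\dots,r\}=J_0\sqcup J_1$ be a partition into two (possibly empty) subsets, $J=(J_0,J_1)$. Let $Z^{J}_{\pm\mathrm{fund}}(\varepsilon,\boldsymbol a,\boldsymbol m,p)$ and $Z^{J}_{\pm\mathrm{adj}}(\varepsilon,\boldsymbol a,\theta,p)$ be the vortex partition functions defined (via torus localization) from the handsaw quiver varieties of type $A_1$. Write $|\boldsymbol k|=\sum_\beta k_\beta$ and $(x)_k=x(x+1)\cdots(x+k-1)$. The following identities of formal power series in $p$ hold. (a) $$Z^{J}_{+\mathrm{fund}}(\varepsilon,\boldsymbol a,\boldsymbol m,p)=\sum_{\boldsymbol k\in\mathbb Z_{\ge0}^{J_1}}p^{|\boldsymbol k|}(-1)^{r|\boldsymbol k|}\prod_{\beta\in J_1}\frac{\prod_{f=1}^{r}\big((a_\beta+m_f)/\varepsilon\big)_{k_\beta}}{\prod_{\alpha\in J_1}\big((a_\alpha-a_\beta)/\varepsilon-k_\beta\big)_{k_\alpha}\prod_{\alpha\in J_0}\big((a_\alpha-a_\beta)/\varepsilon-k_\beta\big)_{k_\beta}},$$ $$Z^{J}_{-\mathrm{fund}}(\varepsilon,\boldsymbol a,\boldsymbol m,p)=\sum_{\boldsymbol k\in\mathbb Z_{\ge0}^{J_0}}p^{|\boldsymbol k|}(-1)^{r|\boldsymbol k|}\prod_{\beta\in J_0}\frac{\prod_{f=1}^{r}\big((a_\beta+m_f)/\varepsilon-k_\beta\big)_{k_\beta}}{\prod_{\alpha\in J_0}\big((-a_\alpha+a_\beta)/\varepsilon-k_\beta\big)_{k_\alpha}\prod_{\alpha\in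 J_1}\big((-a_\alpha+a_\beta)/\varepsilon-k_\beta\big)_{k_\beta}}.$$ (b) $$Z^{J}_{+\mathrm{adj}}(\varepsilon,\boldsymbol a,\theta,p)=\sum_{\boldsymbol k\in\mathbb Z_{\ge0}^{J_1}}p^{|\boldsymbol k|}\prod_{\beta\in J_1,\ \alpha\in J_1}\frac{\big((a_\alpha-a_\beta-\theta)/\varepsilon-k_\beta\big)_{k_\alpha}}{\big((a_\alpha-a_\beta)/\varepsilon-k_\beta\big)_{k_\alpha}}\prod_{\beta\in J_1,\ \alpha\in J_0}\frac{\big((a_\alpha-a_\beta-\theta)/\varepsilon-k_\beta\big)_{k_\beta}}{\big((a_\alpha-a_\beta)/\varepsilon-k_\beta\big)_{k_\beta}},$$ $$Z^{J}_{-\mathrm{adj}}(\varepsilon,\boldsymbol a,\theta,p)=\sum_{\boldsymbol k\in\mathbb Z_{\ge0}^{J_0}}p^{|\boldsymbol k|}\prod_{\beta\in J_0,\ \alpha\in J_0}\frac{\big((a_\beta-a_\alpha-\theta)/\varepsilon-k_\beta\big)_{k_\alpha}}{\big((a_\beta-a_\alpha)/\varepsilon-k_\beta\big)_{k_\alpha}}\prod_{\beta\in J_0,\ \alpha\in J_1}\frac{\big((a_\beta-a_\alpha-\theta)/\varepsilon-k_\beta\big)_{k_\beta}}{\big((a_\beta-a_\alpha)/\varepsilon-k_\beta\big)_{k_\beta}}.$$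
   Context: Handsaw quiver variety of type $A_1$. Put $r_0=|J_0|$, $r_1=|J_1|$, $\vec r=(r_0,r_1)$, $W_0=\bigoplus_{\alpha\in J_0}\mathbb C w_\alpha$, $W_1=\bigoplus_{\alpha\in J_1}\mathbb C w_\alpha$, $V=\mathbb C^n$, and $$\mathbb M=\mathrm{End}_{\mathbb C}(V)\times\mathrm{Hom}_{\mathbb C}(W_0,V)\times\mathrm{Hom}_{\mathbb C}(V,W_1)\ni(B,z,w).$$ For $\zeta\in\mathbb R$, $(B,z,w)$ is $\zeta$-stable if every subspace $P\subset V$ with $B(P)\subset P$ satisfies: (1) if $P\subset\ker w$ and $P\ne0$ then $\zeta\dim P<0$; (2) if $\mathrm{im}\,z\subset P$ and $P\neq V$ then $\zeta\dim V/P>0$. Let $\mathbb M^{\pm}$ be the set of $\zeta$-stable points for any $\zeta$ with $\pm\zeta>0$, and $M_\pm(\vec r,n)=\mathbb M^\pm/\mathrm{GL}(V)$. The tautological bundle is $\mathcal V=(\mathbb M^\pm\times V)/\mathrm{GL}(V)$. Torus action. $\mathbb T=(\mathbb C^* )^{2r+2}$ with coordinates $(q,e_1,\dots,e_r,e^{m_1},\dots,e^{m_r},e^{\theta})$. For a character $m$, $\mathbb C_m$ denotes the one-dimensional representation of weight $m$. $\mathbb T$ acts on $M_\pm(\vec r,n)$ by letting $e_\alpha$ act on $w_\alpha$ with weight $e_\alpha$ and by viewing $\mathbb M=\mathrm{End}(V)\otimes\mathbb C_q\times\mathrm{Hom}(W_0,V)\times\mathrm{Hom}(V,W_1)\otimes\mathbb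 C_q$ (the coordinates $e^{m_f},e^\theta$ act trivially on $M_\pm(\vec r,n)$). At a fixed point the fibre of $\mathcal V$ carries the $\mathbb T$-representation structure for which $B:V\to V\otimes\mathbb C_q$, $z:W_0\to V$, $w:V\to W_1\otimes\mathbb C_q$ are equivariant. The fixed point sets $M_\pm(\vec r,n)^{\mathbb T}$ are finite. Euler classes. For a $\mathbb T$-representation (or virtual one), $\mathrm{Eu}$ is the multiplicative equivariant Euler class: a one-dimensional representation of weight $q^{i}\prod_\alpha e_\alpha^{j_\alpha}\prod_f (e^{m_f})^{l_f}(e^{\theta})^{s}$ has $\mathrm{Eu}=i\varepsilon+\sum_\alpha j_\alpha a_\alpha+\sum_f l_f m_f+s\theta$, where $\varepsilon,a_\alpha,m_f,\theta$ are independent variables. Put $\boldsymbol a=(a_1,\dots,a_r)$, $\boldsymbol m=(m_1,\dots,m_r)$. Integrals are defined by localization: $$\int_{M_\pm(\vec r,n)}\psi=\sum_{x\in M_\pm(\vec r,n)^{\mathbb T}}\frac{\psi|_x}{\mathrm{Eu}(T_xM_\pm(\vec r,n))}\in\mathbb Q(\varepsilon,\boldsymbol a,\boldsymbol m,\theta).$$ Partition functions. With $\psi_{\mathrm{fund}}=\mathrm{Eu}\big(\bigoplus_{f=1}^r\mathcal V\otimes\mathbb C_{q^{-1}e^{m_f}}\big)$ and $\psi_{\mathrm{adj}}=\mathrm{Eu}\big(TM_\pm(\vec r,n)\otimes\mathbb C_{e^\theta}\big)$, $$Z^{J}_{\pm\mathrm{fund}}(\varepsilon,\boldsymbol a,\boldsymbol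 m,p)=\sum_{n\ge0}p^n\int_{M_\pm(\vec r,n)}\psi_{\mathrm{fund}},\qquad Z^{J}_{\pm\mathrm{adj}}(\varepsilon,\boldsymbol a,\theta,p)=\sum_{n\ge0}p^n\int_{M_\pm(\vec r,n)}\psi_{\mathrm{adj}}.$$ *)

theory Defs
  imports
    "Jordan_Normal_Form.Matrix_Kernel"
    "Jordan_Normal_Form.VS_Connect"
    "HOL-Algebra.AbelCoset"
    "HOL-Library.Poly_Mapping"
    "HOL-Computational_Algebra.Fraction_Field"
    "HOL-Computational_Algebra.Formal_Power_Series"
begin

section \<open>The coefficient field\<close>

text \<open>
  Rational functions over the rationals in countably many independent variables \<open>x\<^sub>0, x\<^sub>1, \<dots>\<close>.
  For a given \<open>r\<close> only the variables with index below \<open>2 * r + 2\<close> occur.  They are numbered like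
  the coordinates \<open>(q, e\<^sub>1, \<dots>, e\<^sub>r, exp m\<^sub>1, \<dots>, exp m\<^sub>r, exp \<theta>)\<close> of the torus, so the variable
  with index \<open>i\<close> is the equivariant parameter of the \<open>i\<close>-th coordinate.
\<close>

type_synonym ratfun = "((nat \<Rightarrow>\<^sub>0 nat) \<Rightarrow>\<^sub>0 rat) fract"

definition X :: "nat \<Rightarrow> ratfun" where
  "X i = Fract (Poly_Mapping.single (Poly_Mapping.single i 1) 1) 1"

definition q_ix :: nat where "q_ix = 0"
definition e_ix :: "nat \<Rightarrow> nat" where "e_ix \<alpha> = \<alpha>"
definition m_ix :: "nat \<Rightarrow> nat \<Rightarrow> nat" where "m_ix r f = r + f"
definition th_ix :: "nat \<Rightarrow> nat" where "th_ix r = 2 * r + 1"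

definition eps :: ratfun where "eps = X q_ix"
definition avar :: "nat \<Rightarrow> ratfun" where "avar \<alpha> = X (e_ix \<alpha>)"
definition mvar :: "nat \<Rightarrow> nat \<Rightarrow> ratfun" where "mvar r f = X (m_ix r f)"
definition thvar :: "nat \<Rightarrow> ratfun" where "thvar r = X (th_ix r)"


section \<open>Linear algebra\<close>

abbreviation CC :: "complex ring" where "CC \<equiv> class_ring"

abbreviation vdim :: "(complex, 'v) module \<Rightarrow> nat" where
  "vdim U \<equiv> vectorspace.dim CC U"

text \<open>
  The quotient of a module by a submodule, on cosets.  The fields \<open>mult\<close> and \<open>one\<close>, which a
  module record inherits from rings, have no meaning.
\<close>

definition quot_module :: "('k, 'v) module \<Rightarrow> 'v set \<Rightarrow> ('k, 'v set) module" where
  "quot_module U K = \<lparr>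
     carrier = a_rcosets\<^bsub>U\<^esub> K,
     monoid.mult = undefined,
     one = undefined,
     zero = K,
     add = set_add U,
     smult = (\<lambda>c C. \<Union>u\<in>C. K +>\<^bsub>U\<^esub> (c \<odot>\<^bsub>U\<^esub> u))\<rparr>"

abbreviation Cn :: "nat \<Rightarrow> (complex, complex vec) module" where
  "Cn n \<equiv> module_vec TYPE(complex) n"

definition GL :: "nat \<Rightarrow> complex mat set" where
  "GL n = Units (ring_mat TYPE(complex) n ())"

definition GL_inv :: "nat \<Rightarrow> complex mat \<Rightarrow> complex mat" where
  "GL_inv n g = inv\<^bsub>ring_mat TYPE(complex) n ()\<^esub> g"


section \<open>Torus representations and Euler classes\<close>

definition torus :: "nat \<Rightarrow> (nat \<Rightarrow> complex) set" where
  "torus r = {..<2 * r + 2} \<rightarrow>\<^sub>E (UNIV - {0})"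

text \<open>Characters of the torus are given by their exponent vectors.\<close>

definition chars :: "nat \<Rightarrow> (nat \<Rightarrow> int) set" where
  "chars r = {..<2 * r + 2} \<rightarrow>\<^sub>E UNIV"

definition char_val :: "nat \<Rightarrow> (nat \<Rightarrow> int) \<Rightarrow> (nat \<Rightarrow> complex) \<Rightarrow> complex" where
  "char_val r \<chi> t = (\<Prod>i<2 * r + 2. t i powi \<chi> i)"

definition Eu_char :: "nat \<Rightarrow> (nat \<Rightarrow> int) \<Rightarrow> ratfun" where
  "Eu_char r \<chi> = (\<Sum>i<2 * r + 2. of_int (\<chi> i) * X i)"

text \<open>
  A representation is a complex vector space \<open>U\<close> together with the map \<open>act\<close> which assigns to
  a torus element the corresponding operator on \<open>U\<close>.
\<close>

definition weight_space ::
  "nat \<Rightarrow> (complex, 'v) module \<Rightarrow> ((nat \<Rightarrow> complex) \<Rightarrow> 'v \<Rightarrow> 'v) \<Rightarrow> (nat \<Rightarrow> int) \<Rightarrow> 'v set" where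
  "weight_space r U act \<chi> =
     {u \<in> carrier U. \<forall>t\<in>torus r. act t u = char_val r \<chi> t \<odot>\<^bsub>U\<^esub> u}"

definition weight_mult ::
  "nat \<Rightarrow> (complex, 'v) module \<Rightarrow> ((nat \<Rightarrow> complex) \<Rightarrow> 'v \<Rightarrow> 'v) \<Rightarrow> (nat \<Rightarrow> int) \<Rightarrow> nat" where
  "weight_mult r U act \<chi> = vdim (U\<lparr>carrier := weight_space r U act \<chi>\<rparr>)"

definition Eu ::
  "nat \<Rightarrow> (complex, 'v) module \<Rightarrow> ((nat \<Rightarrow> complex) \<Rightarrow> 'v \<Rightarrow> 'v) \<Rightarrow> ratfun" where
  "Eu r U act =
     (\<Prod>\<chi> | \<chi> \<in> chars r \<and> weight_mult r U act \<chi> \<noteq> 0. Eu_char r \<chi> ^ weight_mult r U act \<chi>)"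

text \<open>The action on the tensor product of \<open>U\<close> with the one-dimensional representation \<open>\<mu>\<close>.\<close>

definition twist ::
  "nat \<Rightarrow> (complex, 'v) module \<Rightarrow> (nat \<Rightarrow> int) \<Rightarrow> ((nat \<Rightarrow> complex) \<Rightarrow> 'v \<Rightarrow> 'v)
    \<Rightarrow> (nat \<Rightarrow> complex) \<Rightarrow> 'v \<Rightarrow> 'v" where
  "twist r U \<mu> act t u = char_val r \<mu> t \<odot>\<^bsub>U\<^esub> act t u"

text \<open>The character \<open>q\<^sup>-\<^sup>1 exp m\<^sub>f\<close> and the character \<open>exp \<theta>\<close>.\<close>

definition fund_char :: "nat \<Rightarrow> nat \<Rightarrow> nat \<Rightarrow> int" where
  "fund_char r f = restrict ((\<lambda>_. 0)(q_ix := -1, m_ix r f := 1)) {..<2 * r + 2}"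

definition adj_char :: "nat \<Rightarrow> nat \<Rightarrow> int" where
  "adj_char r = restrict ((\<lambda>_. 0)(th_ix r := 1)) {..<2 * r + 2}"


section \<open>Handsaw quiver varieties\<close>

text \<open>
  Points of \<open>End(V) \<times> Hom(W\<^sub>0, V) \<times> Hom(V, W\<^sub>1)\<close> are triples \<open>(B, z, w)\<close> of matrices with respect
  to the standard basis of \<open>V = \<complex>\<^sup>n\<close> and the bases \<open>w\<^sub>\<alpha>\<close> of \<open>W\<^sub>0\<close> and \<open>W\<^sub>1\<close>, both listed by
  increasing \<open>\<alpha>\<close>.
\<close>

type_synonym handsaw = "complex mat \<times> complex mat \<times> complex mat"

definition handsaw_space :: "nat \<Rightarrow> nat \<Rightarrow> nat \<Rightarrow> (complex, handsaw) module" where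
  "handsaw_space r0 r1 n =
     direct_sum (module_mat TYPE(complex) n n)
       (direct_sum (module_mat TYPE(complex) n r0) (module_mat TYPE(complex) r1 n))"

fun handsaw_stable :: "nat \<Rightarrow> nat \<Rightarrow> real \<Rightarrow> handsaw \<Rightarrow> bool" where
  "handsaw_stable r0 n \<zeta> (B, z, w) \<longleftrightarrow>
     (\<forall>P. VectorSpace.subspace CC P (Cn n) \<and> (\<lambda>v. B *\<^sub>v v) ` P \<subseteq> P \<longrightarrow>
        (P \<subseteq> mat_kernel w \<and> P \<noteq> {0\<^sub>v n} \<longrightarrow>
           \<zeta> * real (vdim ((Cn n)\<lparr>carrier := P\<rparr>)) < 0) \<and>
        ((\<lambda>u. z *\<^sub>v u) ` carrier_vec r0 \<subseteq> P \<and> P \<noteq> carrier_vec n \<longrightarrow>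
           \<zeta> * real (vdim (quot_module (Cn n) P)) > 0))"

definition stable_points :: "nat \<Rightarrow> nat \<Rightarrow> real \<Rightarrow> nat \<Rightarrow> handsaw set" where
  "stable_points r0 r1 \<zeta> n =
     {b \<in> carrier (handsaw_space r0 r1 n). handsaw_stable r0 n \<zeta> b}"

fun GL_act :: "nat \<Rightarrow> complex mat \<Rightarrow> handsaw \<Rightarrow> handsaw" where
  "GL_act n g (B, z, w) = (g * B * GL_inv n g, g * z, w * GL_inv n g)"

definition GL_orbit :: "nat \<Rightarrow> handsaw \<Rightarrow> handsaw set" where
  "GL_orbit n b = (\<lambda>g. GL_act n g b) ` GL n"

definition handsaw_variety :: "nat \<Rightarrow> nat \<Rightarrow> real \<Rightarrow> nat \<Rightarrow> handsaw set set" where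
  "handsaw_variety r0 r1 \<zeta> n = GL_orbit n ` stable_points r0 r1 \<zeta> n"


subsection \<open>Torus action\<close>

text \<open>The action of \<open>t\<close> on \<open>\<Oplus>\<^bsub>\<alpha> \<in> J\<^esub> \<complex> w\<^sub>\<alpha>\<close>.\<close>

definition flavour_mat :: "nat set \<Rightarrow> (nat \<Rightarrow> complex) \<Rightarrow> complex mat" where
  "flavour_mat J t = mat_diag (card J) (\<lambda>j. t (e_ix (sorted_list_of_set J ! j)))"

definition flavour_inv_mat :: "nat set \<Rightarrow> (nat \<Rightarrow> complex) \<Rightarrow> complex mat" where
  "flavour_inv_mat J t = mat_diag (card J) (\<lambda>j. inverse (t (e_ix (sorted_list_of_set J ! j))))"

fun torus_act :: "nat set \<Rightarrow> nat set \<Rightarrow> (nat \<Rightarrow> complex) \<Rightarrow> handsaw \<Rightarrow> handsaw" where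
  "torus_act J0 J1 t (B, z, w) =
     (t q_ix \<cdot>\<^sub>m B, z * flavour_inv_mat J0 t, t q_ix \<cdot>\<^sub>m (flavour_mat J1 t * w))"

definition fixed_points ::
  "nat \<Rightarrow> nat set \<Rightarrow> nat set \<Rightarrow> real \<Rightarrow> nat \<Rightarrow> handsaw set set" where
  "fixed_points r J0 J1 \<zeta> n =
     {x \<in> handsaw_variety (card J0) (card J1) \<zeta> n. \<forall>t\<in>torus r. torus_act J0 J1 t ` x = x}"

text \<open>
  The point of the orbit \<open>x\<close> that is used to identify the fibre of the tautological bundle at
  \<open>x\<close> with \<open>\<complex>\<^sup>n\<close>, and the tangent space at \<open>x\<close> with a quotient of the space of all triples.
\<close>

definition repr :: "handsaw set \<Rightarrow> handsaw" where
  "repr x = (SOME b. b \<in> x)"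

text \<open>
  For a representative \<open>b\<close> of a fixed point, \<open>fibre_mat\<close> gives the action of \<open>t\<close> on
  the fibre \<open>V\<close>.  The defining equation says that \<open>B : V \<rightarrow> V \<otimes> \<complex>\<^sub>q\<close>, \<open>z : W\<^sub>0 \<rightarrow> V\<close> and
  \<open>w : V \<rightarrow> W\<^sub>1 \<otimes> \<complex>\<^sub>q\<close> are equivariant.  The solution is unique because \<open>GL(V)\<close> acts freely on
  stable points.
\<close>

definition fibre_mat ::
  "nat set \<Rightarrow> nat set \<Rightarrow> nat \<Rightarrow> handsaw \<Rightarrow> (nat \<Rightarrow> complex) \<Rightarrow> complex mat" where
  "fibre_mat J0 J1 n b t = (THE g. g \<in> GL n \<and> GL_act n g (torus_act J0 J1 t b) = b)"

definition fibre_act ::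
  "nat set \<Rightarrow> nat set \<Rightarrow> nat \<Rightarrow> handsaw set \<Rightarrow> (nat \<Rightarrow> complex) \<Rightarrow> complex vec \<Rightarrow> complex vec" where
  "fibre_act J0 J1 n x t v = fibre_mat J0 J1 n (repr x) t *\<^sub>v v"

text \<open>The tangent space at \<open>b\<close> of the \<open>GL(V)\<close>-orbit of \<open>b\<close>: the image of the infinitesimal action.\<close>

fun gl_image :: "nat \<Rightarrow> handsaw \<Rightarrow> handsaw set" where
  "gl_image n (B, z, w) = {(\<xi> * B - B * \<xi>, \<xi> * z, - (w * \<xi>)) | \<xi>. \<xi> \<in> carrier_mat n n}"

definition tangent_space :: "nat \<Rightarrow> nat \<Rightarrow> nat \<Rightarrow> handsaw set \<Rightarrow> (complex, handsaw set) module" where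
  "tangent_space r0 r1 n x = quot_module (handsaw_space r0 r1 n) (gl_image n (repr x))"

text \<open>
  The derivative at \<open>x\<close> of the action of \<open>t\<close>.  The map \<open>b \<mapsto> g (t b)\<close> is linear and, for
  \<open>g = fibre_mat J0 J1 n b t\<close>, it fixes \<open>b = repr x\<close>; it acts on cosets by images.
\<close>

definition tangent_act ::
  "nat set \<Rightarrow> nat set \<Rightarrow> nat \<Rightarrow> handsaw set \<Rightarrow> (nat \<Rightarrow> complex) \<Rightarrow> handsaw set \<Rightarrow> handsaw set" where
  "tangent_act J0 J1 n x t C =
     (\<lambda>y. GL_act n (fibre_mat J0 J1 n (repr x) t) (torus_act J0 J1 t y)) ` C"


section \<open>Partition functions\<close>

definition loc_integral ::
  "nat \<Rightarrow> nat set \<Rightarrow> nat set \<Rightarrow> real \<Rightarrow> nat \<Rightarrow> (handsaw set \<Rightarrow> ratfun) \<Rightarrow> ratfun" where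
  "loc_integral r J0 J1 \<zeta> n \<psi> =
     (\<Sum>x\<in>fixed_points r J0 J1 \<zeta> n.
        \<psi> x / Eu r (tangent_space (card J0) (card J1) n x) (tangent_act J0 J1 n x))"

text \<open>The Euler class of the direct sum over \<open>f\<close> is the product of the Euler classes.\<close>

definition psi_fund :: "nat \<Rightarrow> nat set \<Rightarrow> nat set \<Rightarrow> nat \<Rightarrow> handsaw set \<Rightarrow> ratfun" where
  "psi_fund r J0 J1 n x =
     (\<Prod>f=1..r. Eu r (Cn n) (twist r (Cn n) (fund_char r f) (fibre_act J0 J1 n x)))"

definition psi_adj :: "nat \<Rightarrow> nat set \<Rightarrow> nat set \<Rightarrow> nat \<Rightarrow> handsaw set \<Rightarrow> ratfun" where
  "psi_adj r J0 J1 n x =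
     (let T = tangent_space (card J0) (card J1) n x
      in Eu r T (twist r T (adj_char r) (tangent_act J0 J1 n x)))"

text \<open>
  The partition functions for stability parameter \<open>\<zeta>\<close>, as power series in \<open>p\<close>.  Those with
  index \<open>+\<close> and \<open>-\<close> are the cases \<open>\<zeta> > 0\<close> and \<open>\<zeta> < 0\<close>.
\<close>

definition Z_fund :: "nat \<Rightarrow> nat set \<Rightarrow> nat set \<Rightarrow> real \<Rightarrow> ratfun fps" where
  "Z_fund r J0 J1 \<zeta> = Abs_fps (\<lambda>n. loc_integral r J0 J1 \<zeta> n (psi_fund r J0 J1 n))"

definition Z_adj :: "nat \<Rightarrow> nat set \<Rightarrow> nat set \<Rightarrow> real \<Rightarrow> ratfun fps" where
  "Z_adj r J0 J1 \<zeta> = Abs_fps (\<lambda>n. loc_integral r J0 J1 \<zeta> n (psi_adj r J0 J1 n))"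

text \<open>
  The power series \<open>\<Sum>\<^sub>k p\<^bsup>|k|\<^esup> c(k)\<close>, where \<open>k\<close> runs through the families of natural numbers
  indexed by the finite set \<open>J\<close>.
\<close>

definition multi_series :: "nat set \<Rightarrow> ((nat \<Rightarrow> nat) \<Rightarrow> ratfun) \<Rightarrow> ratfun fps" where
  "multi_series J c = Abs_fps (\<lambda>n. \<Sum>k | k \<in> J \<rightarrow>\<^sub>E UNIV \<and> sum k J = n. c k)"

end

theory Submission
  imports Defs
begin

text \<open>
  Stability means that the columns of \<open>z\<close> generate \<open>V\<close> under \<open>B\<close> (for \<open>\<zeta> < 0\<close>), or dually that the
  rows of \<open>w\<close> separate \<open>V\<close> under \<open>B\<close> (for \<open>\<zeta> > 0\<close>); transposing all matrices exchanges the two cases,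
  up to an automorphism of the torus.  At a fixed point with \<open>\<zeta> < 0\<close> the vectors \<open>B\<^sup>i z w\<^sub>\<alpha>\<close> are weight
  vectors with pairwise distinct characters, so the nonzero ones form a basis of \<open>V\<close>: the fixed points
  are given by the chain lengths \<open>k\<^sub>\<alpha>\<close>.  The tangent space is computed without virtual characters from
  an explicit complement of the image of the infinitesimal action, spanned by weight vectors: the
  entries of \<open>B\<close> in the last column of each chain (of \<open>z\<close>, for chains of length 0) and all entries of
  \<open>w\<close>.  The weights of this complement multiply up to Pochhammer symbols.
\<close>

section \<open>Euler classes in coordinates\<close>

text \<open>\<open>Eu\<close> is built from honest weight spaces, so the usual cancellation between
  End(V) and End(V) tensored with q in the tangent character has no direct meaning here; the slice
  takes its place. It has \<open>n\<close> coordinates for each of the \<open>r\<close> flavours.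
  Factoring \<open>- eps\<close> out of every weight turns arithmetic progressions into Pochhammer
  symbols and leaves \<open>(- eps) ^ (r * n)\<close>. In the adjoint case this power cancels, while
  the \<open>r * n\<close> fundamental weights leave \<open>eps ^ (r * n)\<close>: the quotient is
  the sign (-1)^(r|k|).

  The point \<open>repr x\<close> of an orbit is unspecified. All data at a fixed point are
  therefore transported from the standard form by an unknown invertible matrix \<open>h\<close>, and
  freeness of the action is needed to evaluate the definite description of the fibre action.
  Generation is expressed by annihilators of Krylov vectors instead of spans, which makes it
  self-evidently compatible with transposition.\<close>

lemma vdim_vec_iso:
  fixes W :: "(complex, 'v) module" and T :: "complex vec \<Rightarrow> 'v"
  assumes W: "vectorspace CC W"
    and add: "\<And>u v. u \<in> carrier_vec d \<Longrightarrow> v \<in> carrier_vec d \<Longrightarrow> T (u + v) = T u \<oplus>\<^bsub>W\<^esub> T v"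
    and smult: "\<And>c u. u \<in> carrier_vec d \<Longrightarrow> T (c \<cdot>\<^sub>v u) = c \<odot>\<^bsub>W\<^esub> T u"
    and im: "T ` carrier_vec d = carrier W"
    and ker: "\<And>u. u \<in> carrier_vec d \<Longrightarrow> T u = \<zero>\<^bsub>W\<^esub> \<Longrightarrow> u = 0\<^sub>v d"
  shows "vdim W = d"
proof -
  interpret W: vectorspace CC W by (rule W)
  interpret V: vec_space "TYPE(complex)" d .
  interpret lm: linear_map CC V.V W T
    by unfold_locales (use add smult im in \<open>auto simp: LinearCombinations.module_hom_def\<close>)
  have ker0: "lm.kerT = {0\<^sub>v d}"
    using ker lm.T0_is_0 unfolding lm.ker_def by (auto simp: module_vec_def)
  have "VectorSpace.subspace CC {0\<^sub>v d} V.V" using lm.kerT_is_subspace ker0 by simp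
  then interpret Z: vectorspace CC "V.V\<lparr>carrier := {0\<^sub>v d}\<rparr>" by (rule V.subspace_is_vs)
  have "Z.basis {}"
    unfolding Z.basis_def Z.lin_dep_def Z.span_def Z.lincomb_def
    by (auto simp: module_vec_def finsum_def finprod_def)
  then have dim0: "Z.dim = 0" using Z.dim_basis[of "{}"] by simp
  have "lm.imT = carrier W" unfolding lm.im_def using im by (simp add: module_vec_def)
  with lm.rank_nullity[OF V.fin_dim] show ?thesis
    by (simp add: ker0 dim0 V.dim_is_n W.carrier_vs_is_self)
qed

text \<open>The domain is the type of all functions, but only the values on \<open>I\<close> matter,
  so sums and multiples of coordinate families are plain lambda terms without extensionality
  conditions.\<close>

definition coord_iso :: "'i set \<Rightarrow> (complex, 'v) module \<Rightarrow> (('i \<Rightarrow> complex) \<Rightarrow> 'v) \<Rightarrow> bool" where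
  "coord_iso I U \<phi> \<longleftrightarrow>
     (\<forall>c. \<phi> c \<in> carrier U) \<and>
     (\<forall>c d. \<phi> (\<lambda>i. c i + d i) = \<phi> c \<oplus>\<^bsub>U\<^esub> \<phi> d) \<and>
     (\<forall>a c. \<phi> (\<lambda>i. a * c i) = a \<odot>\<^bsub>U\<^esub> \<phi> c) \<and>
     (\<forall>c. \<phi> c = \<zero>\<^bsub>U\<^esub> \<longleftrightarrow> (\<forall>i\<in>I. c i = 0)) \<and>
     carrier U \<subseteq> range \<phi>"

lemma coord_iso_eq_iff:
  assumes "vectorspace CC U" and "coord_iso I U \<phi>"
  shows "\<phi> c = \<phi> d \<longleftrightarrow> (\<forall>i\<in>I. c i = d i)"
proof -
  interpret U: vectorspace CC U by fact
  have car: "\<phi> c \<in> carrier U" for c using assms(2) by (simp add: coord_iso_def)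
  have "\<phi> (\<lambda>i. c i - d i) \<oplus>\<^bsub>U\<^esub> \<phi> d = \<phi> (\<lambda>i. (c i - d i) + d i)"
    using assms(2) unfolding coord_iso_def by metis
  then have "\<phi> (\<lambda>i. c i - d i) \<oplus>\<^bsub>U\<^esub> \<phi> d = \<phi> c" by simp
  then have "\<phi> c = \<phi> d \<longleftrightarrow> \<phi> (\<lambda>i. c i - d i) = \<zero>\<^bsub>U\<^esub>"
    using car by (metis U.l_zero U.add.r_cancel_one)
  also have "\<dots> \<longleftrightarrow> (\<forall>i\<in>I. c i = d i)" using assms(2) by (simp add: coord_iso_def)
  finally show ?thesis .
qed

lemma coord_iso_dim:
  assumes U: "vectorspace CC U" and "finite I" and \<phi>: "coord_iso I U \<phi>"
  shows "vdim U = card I"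
proof -
  obtain e where e: "bij_betw e I {..<card I}"
    using ex_bij_betw_finite_nat[OF \<open>finite I\<close>] by (auto simp: atLeast0LessThan)
  \<comment> \<open>Coordinates outside \<open>I\<close> are filled with 0; any other filling gives
    the same vector.\<close>
  define T where "T v = \<phi> (\<lambda>i. if i \<in> I then v $ e i else 0)" for v :: "complex vec"
  have lt: "e i < card I" if "i \<in> I" for i using e that by (auto simp: bij_betw_def)
  have add: "\<phi> (\<lambda>i. c i + d i) = \<phi> c \<oplus>\<^bsub>U\<^esub> \<phi> d" and sm: "\<phi> (\<lambda>i. a * c i) = a \<odot>\<^bsub>U\<^esub> \<phi> c"
    and car: "\<phi> c \<in> carrier U" and z: "\<phi> c = \<zero>\<^bsub>U\<^esub> \<longleftrightarrow> (\<forall>i\<in>I. c i = 0)"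
    and sur: "carrier U \<subseteq> range \<phi>" for a c d using \<phi> by (simp_all add: coord_iso_def)
  note eq = coord_iso_eq_iff[OF U \<phi>]
  show ?thesis
  proof (rule vdim_vec_iso[OF U, where T = T])
    fix u v :: "complex vec" assume "u \<in> carrier_vec (card I)" "v \<in> carrier_vec (card I)"
    then show "T (u + v) = T u \<oplus>\<^bsub>U\<^esub> T v"
      unfolding T_def add[symmetric] eq using lt by auto
  next
    fix c and u :: "complex vec" assume "u \<in> carrier_vec (card I)"
    then show "T (c \<cdot>\<^sub>v u) = c \<odot>\<^bsub>U\<^esub> T u"
      unfolding T_def sm[symmetric] eq using lt by auto
  next
    show "T ` carrier_vec (card I) = carrier U"
    proof (intro equalityI subsetI)
      fix x assume "x \<in> carrier U"
      then obtain c where c: "x = \<phi> c" using sur by auto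
      have "x = T (vec (card I) (\<lambda>j. c (inv_into I e j)))"
        unfolding c T_def eq using lt e by (auto simp: bij_betw_def)
      then show "x \<in> T ` carrier_vec (card I)" by auto
    qed (auto simp: T_def car)
  next
    fix u :: "complex vec" assume u: "u \<in> carrier_vec (card I)" and "T u = \<zero>\<^bsub>U\<^esub>"
    then have 0: "\<forall>i\<in>I. u $ e i = 0" by (simp add: T_def z)
    show "u = 0\<^sub>v (card I)"
    proof (rule eq_vecI)
      fix j assume "j < dim_vec (0\<^sub>v (card I) :: complex vec)"
      then obtain i where "i \<in> I" "j = e i" using e by (auto simp: bij_betw_def)
      with 0 lt show "u $ j = 0\<^sub>v (card I) $ j" by auto
    qed (use u in simp)
  qed
qed

text \<open>At the torus element with \<open>i\<close>-th coordinate 2 and all others 1, a character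
  takes the value 2 to the power of its \<open>i\<close>-th exponent, which determines that
  exponent.\<close>

lemma char_val_inj:
  assumes "\<chi> \<in> chars r" "\<chi>' \<in> chars r" "\<And>t. t \<in> torus r \<Longrightarrow> char_val r \<chi> t = char_val r \<chi>' t"
  shows "\<chi> = \<chi>'"
proof (rule ext)
  fix i
  show "\<chi> i = \<chi>' i"
  proof (cases "i < 2 * r + 2")
    case True
    define t :: "nat \<Rightarrow> complex" where "t = restrict ((\<lambda>_. 1)(i := 2)) {..<2 * r + 2}"
    have t: "t \<in> torus r" unfolding t_def torus_def by auto
    have cv: "char_val r \<psi> t = 2 powi \<psi> i" for \<psi>
    proof -
      have "char_val r \<psi> t = (\<Prod>j<2 * r + 2. if j = i then 2 powi \<psi> i else 1)"
        unfolding char_val_def t_def by (intro prod.cong) auto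
      then show ?thesis using True by simp
    qed
    have 2: "(2::complex) powi \<chi> i = 2 powi \<chi>' i" using assms(3)[OF t] by (simp add: cv)
    \<comment> \<open>Norms move the equation to the reals, where powers of 2 increase strictly with
      the exponent.\<close>
    have "(2::real) powi \<chi> i = 2 powi \<chi>' i"
      using arg_cong[OF 2, of norm] by (simp only: norm_power_int norm_numeral)
    then show ?thesis
      using power_int_strict_increasing[of "\<chi> i" "\<chi>' i" "2::real"]
        power_int_strict_increasing[of "\<chi>' i" "\<chi> i" "2::real"] by linarith
  next
    case False
    then show ?thesis using assms(1,2) by (auto simp: chars_def PiE_def extensional_def)
  qed
qed

section \<open>Weight spaces in diagonalising coordinates\<close>

context
  fixes r :: nat and U :: "(complex, 'v) module" and I :: "'i set" and \<phi> :: "('i \<Rightarrow> complex) \<Rightarrow> 'v"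
    and act :: "(nat \<Rightarrow> complex) \<Rightarrow> 'v \<Rightarrow> 'v" and \<chi>s :: "'i \<Rightarrow> nat \<Rightarrow> int"
  assumes U: "vectorspace CC U" and fin: "finite I" and \<phi>: "coord_iso I U \<phi>"
    and act: "\<And>t c. t \<in> torus r \<Longrightarrow> act t (\<phi> c) = \<phi> (\<lambda>i. char_val r (\<chi>s i) t * c i)"
    and \<chi>s: "\<And>i. i \<in> I \<Longrightarrow> \<chi>s i \<in> chars r"
begin

interpretation U: vectorspace CC U by (rule U)

text \<open>Comparing coordinates, the eigenvalue equation says that \<open>c i\<close> vanishes or
  that the two characters agree on the whole torus, and then they are equal.\<close>

lemma weight_space_coord:
  assumes "\<chi> \<in> chars r"
  shows "\<phi> c \<in> weight_space r U act \<chi> \<longleftrightarrow> (\<forall>i\<in>I. \<chi>s i \<noteq> \<chi> \<longrightarrow> c i = 0)"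
proof -
  have "\<phi> c \<in> weight_space r U act \<chi> \<longleftrightarrow>
      (\<forall>t\<in>torus r. \<phi> (\<lambda>i. char_val r (\<chi>s i) t * c i) = \<phi> (\<lambda>i. char_val r \<chi> t * c i))"
    using \<phi> act by (simp add: weight_space_def coord_iso_def)
  also have "\<dots> \<longleftrightarrow> (\<forall>i\<in>I. \<chi>s i \<noteq> \<chi> \<longrightarrow> c i = 0)"
    unfolding coord_iso_eq_iff[OF U \<phi>]
    using char_val_inj[OF \<chi>s assms] by (auto simp: mult_cancel_right)
  finally show ?thesis .
qed

lemma weight_mult_coord:
  assumes "\<chi> \<in> chars r"
  shows "weight_mult r U act \<chi> = card {i \<in> I. \<chi>s i = \<chi>}"
proof -
  let ?W = "weight_space r U act \<chi>" and ?I = "{i \<in> I. \<chi>s i = \<chi>}"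
  \<comment> \<open>Erasing the coordinates of all other weights parametrises the weight space by
    the indices of weight \<open>\<chi>\<close>.\<close>
  define \<psi> where "\<psi> c = \<phi> (\<lambda>i. if \<chi>s i = \<chi> then c i else 0)" for c
  have add: "\<phi> (\<lambda>i. c i + d i) = \<phi> c \<oplus>\<^bsub>U\<^esub> \<phi> d" and sm: "\<phi> (\<lambda>i. a * c i) = a \<odot>\<^bsub>U\<^esub> \<phi> c"
    and car: "\<phi> c \<in> carrier U" and z: "\<phi> c = \<zero>\<^bsub>U\<^esub> \<longleftrightarrow> (\<forall>i\<in>I. c i = 0)"
    and sur: "carrier U \<subseteq> range \<phi>" for a c d using \<phi> by (simp_all add: coord_iso_def)
  note eq = coord_iso_eq_iff[OF U \<phi>]
  have \<psi>W: "\<psi> c \<in> ?W" for c unfolding \<psi>_def weight_space_coord[OF assms] by simp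
  have Wsub: "?W \<subseteq> carrier U" by (auto simp: weight_space_def)
  have W\<psi>: "?W \<subseteq> range \<psi>"
  proof
    fix x assume x: "x \<in> ?W"
    then obtain c where c: "x = \<phi> c" using sur Wsub by auto
    then have "x = \<psi> c" using x weight_space_coord[OF assms, of c] unfolding \<psi>_def
      by (simp add: eq)
    then show "x \<in> range \<psi>" by auto
  qed
  have \<psi>add: "\<psi> (\<lambda>i. c i + d i) = \<psi> c \<oplus>\<^bsub>U\<^esub> \<psi> d" for c d
    unfolding \<psi>_def by (subst add[symmetric]) (simp add: eq)
  have \<psi>sm: "\<psi> (\<lambda>i. a * c i) = a \<odot>\<^bsub>U\<^esub> \<psi> c" for a c
    unfolding \<psi>_def by (subst sm[symmetric]) (simp add: eq)
  have \<psi>z: "\<psi> c = \<zero>\<^bsub>U\<^esub> \<longleftrightarrow> (\<forall>i\<in>?I. c i = 0)" for c unfolding \<psi>_def z by auto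
  have "LinearCombinations.submodule CC ?W U"
  proof (unfold LinearCombinations.submodule_def, intro conjI allI impI)
    show "\<zero>\<^bsub>U\<^esub> \<in> ?W" using \<psi>W[of "\<lambda>_. 0"] \<psi>z[of "\<lambda>_. 0"] by simp
    show "v \<oplus>\<^bsub>U\<^esub> w \<in> ?W" if "v \<in> ?W" "w \<in> ?W" for v w
    proof -
      obtain c d where "v = \<psi> c" "w = \<psi> d" using \<open>v \<in> ?W\<close> \<open>w \<in> ?W\<close> W\<psi> by blast
      then show ?thesis using \<psi>W[of "\<lambda>i. c i + d i"] by (simp add: \<psi>add)
    qed
    show "a \<odot>\<^bsub>U\<^esub> v \<in> ?W" if "v \<in> ?W" for a v
    proof -
      obtain c where "v = \<psi> c" using \<open>v \<in> ?W\<close> W\<psi> by blast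
      then show ?thesis using \<psi>W[of "\<lambda>i. a * c i"] by (simp add: \<psi>sm)
    qed
  qed (use Wsub U.module_axioms in auto)
  then have "VectorSpace.subspace CC ?W U"
    using U by (simp add: VectorSpace.subspace_def)
  then have vs: "vectorspace CC (U\<lparr>carrier := ?W\<rparr>)" by (rule U.subspace_is_vs)
  have "coord_iso ?I (U\<lparr>carrier := ?W\<rparr>) \<psi>"
    unfolding coord_iso_def using \<psi>W \<psi>add \<psi>sm \<psi>z W\<psi> by auto
  from coord_iso_dim[OF vs _ this] fin show ?thesis by (simp add: weight_mult_def)
qed

text \<open>The characters of nonzero multiplicity are the values of \<open>\<chi>s\<close> on
  \<open>I\<close>, and each multiplicity is the size of a fibre of \<open>\<chi>s\<close>; grouping
  the product over \<open>I\<close> by fibres gives the definition of \<open>Eu\<close>.\<close>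

lemma Eu_coord: "Eu r U act = (\<Prod>i\<in>I. Eu_char r (\<chi>s i))"
proof -
  have "{\<chi>. \<chi> \<in> chars r \<and> weight_mult r U act \<chi> \<noteq> 0} = \<chi>s ` I"
  proof (intro equalityI subsetI)
    fix \<chi> assume "\<chi> \<in> {\<chi>. \<chi> \<in> chars r \<and> weight_mult r U act \<chi> \<noteq> 0}"
    then have "card {i \<in> I. \<chi>s i = \<chi>} \<noteq> 0" using weight_mult_coord by auto
    then have "{i \<in> I. \<chi>s i = \<chi>} \<noteq> {}" by (metis card.empty)
    then show "\<chi> \<in> \<chi>s ` I" by auto
  next
    fix \<chi> assume "\<chi> \<in> \<chi>s ` I"
    then obtain i where i: "i \<in> I" "\<chi> = \<chi>s i" by auto
    then have "{i \<in> I. \<chi>s i = \<chi>} \<noteq> {}" by auto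
    then show "\<chi> \<in> {\<chi>. \<chi> \<in> chars r \<and> weight_mult r U act \<chi> \<noteq> 0}"
      using i \<chi>s fin weight_mult_coord by (simp add: card_gt_0_iff)
  qed
  then have "Eu r U act = (\<Prod>\<chi>\<in>\<chi>s ` I. Eu_char r \<chi> ^ card {i \<in> I. \<chi>s i = \<chi>})"
    unfolding Eu_def using weight_mult_coord \<chi>s by (intro prod.cong) auto
  also have "\<dots> = (\<Prod>\<chi>\<in>\<chi>s ` I. \<Prod>i\<in>{i \<in> I. \<chi>s i = \<chi>}. Eu_char r (\<chi>s i))"
    by (intro prod.cong) auto
  also have "\<dots> = (\<Prod>i\<in>I. Eu_char r (\<chi>s i))"
    using prod.image_gen[OF fin, of "\<lambda>i. Eu_char r (\<chi>s i)" \<chi>s] by simp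
  finally show ?thesis .
qed

end

section \<open>Twisting by a character\<close>

definition char_mult :: "nat \<Rightarrow> (nat \<Rightarrow> int) \<Rightarrow> (nat \<Rightarrow> int) \<Rightarrow> nat \<Rightarrow> int" where
  "char_mult r \<mu> \<chi> = restrict (\<lambda>i. \<mu> i + \<chi> i) {..<2 * r + 2}"

lemma char_mult_chars [simp]: "char_mult r \<mu> \<chi> \<in> chars r"
  by (simp add: char_mult_def chars_def)

lemma char_val_char_mult:
  assumes "t \<in> torus r"
  shows "char_val r (char_mult r \<mu> \<chi>) t = char_val r \<mu> t * char_val r \<chi> t"
  unfolding char_val_def prod.distrib[symmetric]
  using assms by (intro prod.cong refl) (auto simp: char_mult_def torus_def power_int_add PiE_def Pi_def)

lemma Eu_char_char_mult: "Eu_char r (char_mult r \<mu> \<chi>) = Eu_char r \<mu> + Eu_char r \<chi>"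
  unfolding Eu_char_def sum.distrib[symmetric]
  by (intro sum.cong refl) (auto simp: char_mult_def algebra_simps)

text \<open>The coordinates that diagonalise \<open>act\<close> also diagonalise its twist. Every
  weight is multiplied by \<open>\<mu>\<close>, which \<open>Eu_char\<close> turns into a
  summand.\<close>

lemma Eu_twist_coord:
  assumes U: "vectorspace CC U" and "finite I" and \<phi>: "coord_iso I U \<phi>"
    and act: "\<And>t c. t \<in> torus r \<Longrightarrow> act t (\<phi> c) = \<phi> (\<lambda>i. char_val r (\<chi>s i) t * c i)"
  shows "Eu r U (twist r U \<mu> act) = (\<Prod>i\<in>I. Eu_char r \<mu> + Eu_char r (\<chi>s i))"
proof -
  have sm: "\<phi> (\<lambda>i. a * c i) = a \<odot>\<^bsub>U\<^esub> \<phi> c" for a c using \<phi> by (simp add: coord_iso_def)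
  have "Eu r U (twist r U \<mu> act) = (\<Prod>i\<in>I. Eu_char r (char_mult r \<mu> (\<chi>s i)))"
    by (rule Eu_coord[OF U \<open>finite I\<close> \<phi>])
       (simp_all add: twist_def act sm[symmetric] char_val_char_mult mult.assoc)
  then show ?thesis by (simp add: Eu_char_char_mult)
qed


section \<open>Quotient modules\<close>

context
  fixes U :: "(complex, 'v) module" and K :: "'v set"
  assumes U: "vectorspace CC U" and K: "VectorSpace.subspace CC K U"
begin

interpretation U: vectorspace CC U by (rule U)

interpretation abelian_subgroup K U
proof (rule abelian_subgroupI3)
  have sub: "LinearCombinations.submodule CC K U" using K by (simp add: VectorSpace.subspace_def)
  have neg: "\<ominus>\<^bsub>U\<^esub> v \<in> K" if "v \<in> K" for v
  proof -
    have "v \<in> carrier U" using that sub by (auto simp: LinearCombinations.submodule_def)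
    then have "\<ominus>\<^bsub>U\<^esub> v = (-1) \<odot>\<^bsub>U\<^esub> v" using U.smult_minus_1[of v] by (simp add: class_ring_simps)
    then show ?thesis using sub that by (simp add: LinearCombinations.submodule_def)
  qed
  show "additive_subgroup K U"
    by unfold_locales
       (use sub neg in \<open>auto simp: LinearCombinations.submodule_def a_inv_def[symmetric]\<close>)
qed (rule U.abelian_group_axioms)

lemma coset_eq_iff:
  assumes "u \<in> carrier U" "v \<in> carrier U"
  shows "K +>\<^bsub>U\<^esub> u = K +>\<^bsub>U\<^esub> v \<longleftrightarrow> u \<oplus>\<^bsub>U\<^esub> \<ominus>\<^bsub>U\<^esub> v \<in> K"
proof
  assume "K +>\<^bsub>U\<^esub> u = K +>\<^bsub>U\<^esub> v"
  then have "u \<in> K +>\<^bsub>U\<^esub> v" using a_repr_independenceD[OF assms(1), of v] by simp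
  then show "u \<oplus>\<^bsub>U\<^esub> \<ominus>\<^bsub>U\<^esub> v \<in> K" using a_rcos_module_imp[OF assms(2)] by simp
next
  assume "u \<oplus>\<^bsub>U\<^esub> \<ominus>\<^bsub>U\<^esub> v \<in> K"
  then have "u \<in> K +>\<^bsub>U\<^esub> v" using a_rcos_module_rev[OF assms(2,1)] by simp
  then show "K +>\<^bsub>U\<^esub> u = K +>\<^bsub>U\<^esub> v" using a_repr_independence'[OF _ assms(2)] by simp
qed

lemma quot_carrier_iff: "C \<in> carrier (quot_module U K) \<longleftrightarrow> (\<exists>u\<in>carrier U. C = K +>\<^bsub>U\<^esub> u)"
  by (auto simp: quot_module_def A_RCOSETS_def')

lemma quot_add:
  assumes "u \<in> carrier U" "v \<in> carrier U"
  shows "(K +>\<^bsub>U\<^esub> u) \<oplus>\<^bsub>quot_module U K\<^esub> (K +>\<^bsub>U\<^esub> v) = K +>\<^bsub>U\<^esub> (u \<oplus>\<^bsub>U\<^esub> v)"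
  using a_rcos_sum[OF assms] by (simp add: quot_module_def)

text \<open>The quotient multiplies a coset by taking a union over all its elements. The cosets
  united there all coincide, because multiples of elements of \<open>K\<close> stay in
  \<open>K\<close>, and the union is over a nonempty set.\<close>

lemma quot_smult:
  assumes v: "v \<in> carrier U"
  shows "c \<odot>\<^bsub>quot_module U K\<^esub> (K +>\<^bsub>U\<^esub> v) = K +>\<^bsub>U\<^esub> (c \<odot>\<^bsub>U\<^esub> v)"
proof -
  have "K +>\<^bsub>U\<^esub> (c \<odot>\<^bsub>U\<^esub> u) = K +>\<^bsub>U\<^esub> (c \<odot>\<^bsub>U\<^esub> v)" if "u \<in> K +>\<^bsub>U\<^esub> v" for u
  proof -
    have u: "u \<in> carrier U" using that v a_elemrcos_carrier by blast
    have "u \<oplus>\<^bsub>U\<^esub> \<ominus>\<^bsub>U\<^esub> v \<in> K" using that v a_rcos_module_imp by blast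
    then have "c \<odot>\<^bsub>U\<^esub> (u \<oplus>\<^bsub>U\<^esub> \<ominus>\<^bsub>U\<^esub> v) \<in> K"
      using K by (simp add: VectorSpace.subspace_def LinearCombinations.submodule_def)
    then have "c \<odot>\<^bsub>U\<^esub> u \<oplus>\<^bsub>U\<^esub> \<ominus>\<^bsub>U\<^esub> (c \<odot>\<^bsub>U\<^esub> v) \<in> K"
      using u v by (simp add: U.smult_r_distr U.smult_r_minus)
    then show ?thesis using coset_eq_iff u v by simp
  qed
  moreover have "v \<in> K +>\<^bsub>U\<^esub> v" using a_rcos_self v .
  ultimately have "(\<Union>u\<in>K +>\<^bsub>U\<^esub> v. K +>\<^bsub>U\<^esub> (c \<odot>\<^bsub>U\<^esub> u)) = K +>\<^bsub>U\<^esub> (c \<odot>\<^bsub>U\<^esub> v)"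
    by (metis (no_types, lifting) SUP_eq_const equals0D)
  then show ?thesis by (simp add: quot_module_def)
qed

lemma quot_zero: "\<zero>\<^bsub>quot_module U K\<^esub> = K +>\<^bsub>U\<^esub> \<zero>\<^bsub>U\<^esub>"
  using a_rcos_const[OF zero_closed] by (simp add: quot_module_def)

lemma coset_eq_zero_iff:
  assumes "u \<in> carrier U"
  shows "K +>\<^bsub>U\<^esub> u = \<zero>\<^bsub>quot_module U K\<^esub> \<longleftrightarrow> u \<in> K"
proof -
  have "\<ominus>\<^bsub>U\<^esub> \<zero>\<^bsub>U\<^esub> = \<zero>\<^bsub>U\<^esub>" using U.r_neg[OF U.zero_closed] by (simp only: U.l_zero U.a_inv_closed U.zero_closed)
  then show ?thesis
    unfolding quot_zero coset_eq_iff[OF assms U.zero_closed] by (simp only: U.r_zero[OF assms])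
qed

lemma quot_vectorspace: "vectorspace CC (quot_module U K)"
proof -
  let ?Q = "quot_module U K"
  have "abelian_group ?Q"
  proof (rule abelian_groupI)
    fix x assume "x \<in> carrier ?Q"
    then obtain u where u: "u \<in> carrier U" "x = K +>\<^bsub>U\<^esub> u" by (auto simp: quot_carrier_iff)
    have "(K +>\<^bsub>U\<^esub> (\<ominus>\<^bsub>U\<^esub> u)) \<oplus>\<^bsub>?Q\<^esub> x = \<zero>\<^bsub>?Q\<^esub>"
      using u by (simp add: quot_add quot_zero U.l_neg)
    moreover have "K +>\<^bsub>U\<^esub> (\<ominus>\<^bsub>U\<^esub> u) \<in> carrier ?Q" using u by (auto simp: quot_carrier_iff)
    ultimately show "\<exists>y\<in>carrier ?Q. y \<oplus>\<^bsub>?Q\<^esub> x = \<zero>\<^bsub>?Q\<^esub>" by blast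
  qed (auto simp: quot_carrier_iff quot_add quot_zero U.a_ac)
  then interpret Q: abelian_group ?Q .
  have "Module.module CC ?Q"
  proof (rule Module.moduleI)
    show "cring CC" by (rule class_cring.cring_axioms)
  qed (auto simp: Q.abelian_group_axioms quot_carrier_iff quot_add quot_smult
        U.smult_l_distr[simplified] U.smult_r_distr[simplified] U.smult_assoc1[simplified]
        U.smult_one[simplified])
  then show ?thesis by (simp add: vectorspace_def class_field)
qed

text \<open>The image of \<open>\<sigma>\<close> is a complement of \<open>K\<close>:
  \<open>zero\<close> makes the intersection trivial and \<open>decomp\<close> makes the sum
  everything. Hence \<open>\<sigma>\<close> provides coordinates on the quotient.\<close>

lemma quot_coord_iso:
  fixes \<sigma> :: "('i \<Rightarrow> complex) \<Rightarrow> 'v"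
  assumes car: "\<And>c. \<sigma> c \<in> carrier U"
    and add: "\<And>c d. \<sigma> (\<lambda>i. c i + d i) = \<sigma> c \<oplus>\<^bsub>U\<^esub> \<sigma> d"
    and smult: "\<And>a c. \<sigma> (\<lambda>i. a * c i) = a \<odot>\<^bsub>U\<^esub> \<sigma> c"
    and zero: "\<And>c. \<sigma> c \<in> K \<longleftrightarrow> (\<forall>i\<in>I. c i = 0)"
    and decomp: "\<And>u. u \<in> carrier U \<Longrightarrow> \<exists>k\<in>K. \<exists>c. u = k \<oplus>\<^bsub>U\<^esub> \<sigma> c"
  shows "coord_iso I (quot_module U K) (\<lambda>c. K +>\<^bsub>U\<^esub> \<sigma> c)"
  unfolding coord_iso_def
proof (intro conjI allI)
  show "carrier (quot_module U K) \<subseteq> range (\<lambda>c. K +>\<^bsub>U\<^esub> \<sigma> c)"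
  proof
    fix C assume "C \<in> carrier (quot_module U K)"
    then obtain u where u: "u \<in> carrier U" "C = K +>\<^bsub>U\<^esub> u" by (auto simp: quot_carrier_iff)
    then obtain k c where kc: "k \<in> K" "u = k \<oplus>\<^bsub>U\<^esub> \<sigma> c" using decomp by blast
    then have k: "k \<in> carrier U" using a_Hcarr by blast
    have "C = K +>\<^bsub>U\<^esub> \<sigma> c"
      using u kc k car by (simp add: coset_eq_iff U.a_assoc U.r_neg)
    then show "C \<in> range (\<lambda>c. K +>\<^bsub>U\<^esub> \<sigma> c)" by auto
  qed
next
  fix a c d
  show "K +>\<^bsub>U\<^esub> \<sigma> c \<in> carrier (quot_module U K)" using car quot_carrier_iff by blast
  show "K +>\<^bsub>U\<^esub> \<sigma> (\<lambda>i. c i + d i) = (K +>\<^bsub>U\<^esub> \<sigma> c) \<oplus>\<^bsub>quot_module U K\<^esub> (K +>\<^bsub>U\<^esub> \<sigma> d)"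
    unfolding add by (rule quot_add[OF car car, symmetric])
  show "K +>\<^bsub>U\<^esub> \<sigma> (\<lambda>i. a * c i) = a \<odot>\<^bsub>quot_module U K\<^esub> (K +>\<^bsub>U\<^esub> \<sigma> c)"
    unfolding smult by (rule quot_smult[OF car, symmetric])
  show "(K +>\<^bsub>U\<^esub> \<sigma> c = \<zero>\<^bsub>quot_module U K\<^esub>) = (\<forall>i\<in>I. c i = 0)"
    unfolding coset_eq_zero_iff[OF car] by (rule zero)
qed

end

text \<open>In dimension 0 the empty set would be a basis and every vector zero. The stability
  inequalities need only this sign of a dimension, never its value.\<close>

lemma vdim_pos:
  assumes "vectorspace CC U" "vectorspace.fin_dim CC U" "u \<in> carrier U" "u \<noteq> \<zero>\<^bsub>U\<^esub>"
  shows "vdim U > 0"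
proof (rule ccontr)
  interpret U: vectorspace CC U by fact
  assume "\<not> vdim U > 0"
  moreover obtain B where "finite B" "U.basis B" using U.finite_basis_exists assms(2) by blast
  ultimately have "U.basis {}" using U.dim_basis by (metis card_0_eq not_gr_zero)
  then have "U.span {} = carrier U" by (simp add: U.basis_def)
  then show False using assms(3,4) by (auto simp: U.span_def U.lincomb_def)
qed

text \<open>The projection is surjective, so rank-nullity makes the quotient finite-dimensional, and
  the coset of a vector outside \<open>K\<close> is not zero.\<close>

lemma vdim_quot_pos:
  assumes U: "vectorspace CC U" and fin: "vectorspace.fin_dim CC U"
    and K: "VectorSpace.subspace CC K U" and "K \<noteq> carrier U"
  shows "vdim (quot_module U K) > 0"
proof -
  interpret U: vectorspace CC U by fact
  interpret Q: vectorspace CC "quot_module U K" by (rule quot_vectorspace[OF U K])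
  have "(\<lambda>u. K +>\<^bsub>U\<^esub> u) \<in> LinearCombinations.module_hom CC U (quot_module U K)"
    unfolding LinearCombinations.module_hom_def
    using quot_carrier_iff[OF U K] quot_add[OF U K] quot_smult[OF U K] by auto
  then interpret lm: linear_map CC U "quot_module U K" "\<lambda>u. K +>\<^bsub>U\<^esub> u"
    by unfold_locales
  have "(\<lambda>u. K +>\<^bsub>U\<^esub> u) ` carrier U = carrier (quot_module U K)"
    by (auto simp: quot_carrier_iff[OF U K])
  then have "Q.fin_dim" using lm.rank_nullity_main(2)[OF fin] by simp
  moreover obtain u where "u \<in> carrier U" "u \<notin> K"
    using assms(4) K by (auto simp: VectorSpace.subspace_def LinearCombinations.submodule_def)
  ultimately show ?thesis
    using vdim_pos[OF Q.vectorspace_axioms, of "K +>\<^bsub>U\<^esub> u"]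
    by (auto simp: quot_carrier_iff[OF U K] coset_eq_zero_iff[OF U K])
qed

text \<open>Independent subsets of \<open>K\<close> have at most as many elements as the dimension
  of \<open>U\<close>; a maximal one exists and is a finite basis.\<close>

lemma subspace_fin_dim:
  assumes U: "vectorspace CC U" and fin: "vectorspace.fin_dim CC U"
    and K: "VectorSpace.subspace CC K U"
  shows "vectorspace.fin_dim CC (U\<lparr>carrier := K\<rparr>)"
proof -
  interpret U: vectorspace CC U by fact
  interpret S: vectorspace CC "U\<lparr>carrier := K\<rparr>" by (rule U.subspace_is_vs[OF K])
  have sub: "LinearCombinations.submodule CC K U" using K by (simp add: VectorSpace.subspace_def)
  have "finite A \<and> card A \<le> U.dim" if "A \<subseteq> K \<and> S.lin_indpt A" for A
  proof -
    have "U.lin_indpt A" "A \<subseteq> carrier U"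
      using that U.span_li_not_depend(2)[OF _ sub] sub
      by (auto simp: LinearCombinations.submodule_def)
    then show ?thesis using U.li_le_dim[OF fin] by auto
  qed
  moreover have "{} \<subseteq> K \<and> S.lin_indpt {}" by (auto simp: S.lin_dep_def)
  ultimately obtain A where A: "finite A" "maximal A (\<lambda>A. A \<subseteq> K \<and> S.lin_indpt A)"
    using maximal_exists[of "\<lambda>A. A \<subseteq> K \<and> S.lin_indpt A" U.dim "{}"] by blast
  then have "S.basis A" using S.max_li_is_basis by simp
  then show ?thesis using A(1) by (auto simp: S.fin_dim_def S.basis_def)
qed

lemma vdim_subspace_pos:
  assumes U: "vectorspace CC U" and fin: "vectorspace.fin_dim CC U"
    and K: "VectorSpace.subspace CC K U" and "K \<noteq> {\<zero>\<^bsub>U\<^esub>}"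
  shows "vdim (U\<lparr>carrier := K\<rparr>) > 0"
proof -
  interpret U: vectorspace CC U by fact
  interpret S: vectorspace CC "U\<lparr>carrier := K\<rparr>" by (rule U.subspace_is_vs[OF K])
  have sub: "LinearCombinations.submodule CC K U" using K by (simp add: VectorSpace.subspace_def)
  then obtain u where "u \<in> K" "u \<noteq> \<zero>\<^bsub>U\<^esub>"
    using assms(4) by (auto simp: LinearCombinations.submodule_def)
  moreover have "S.fin_dim" by (rule subspace_fin_dim[OF U fin K])
  ultimately show ?thesis using vdim_pos[OF S.vectorspace_axioms, of u] by simp
qed


section \<open>The actions on the space of triples\<close>

lemma GL_iff:
  "g \<in> GL n \<longleftrightarrow> g \<in> carrier_mat n n \<and> (\<exists>h\<in>carrier_mat n n. h * g = 1\<^sub>m n \<and> g * h = 1\<^sub>m n)"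
  by (auto simp: GL_def Units_def ring_mat_simps)

lemma GL_inv_unique:
  assumes "g \<in> carrier_mat n n" "h \<in> carrier_mat n n" "h * g = 1\<^sub>m n" "g * h = 1\<^sub>m n"
  shows "GL_inv n g = h"
proof -
  interpret R: ring "ring_mat TYPE(complex) n ()" by (rule ring_mat)
  show ?thesis unfolding GL_inv_def
    using R.inv_unique'[of g h] assms by (simp add: ring_mat_simps)
qed

lemma GL_carrier [simp]: "g \<in> GL n \<Longrightarrow> g \<in> carrier_mat n n"
  by (simp add: GL_iff)

lemma GL_inv:
  assumes "g \<in> GL n"
  shows GL_inv_carrier [simp]: "GL_inv n g \<in> carrier_mat n n"
    and GL_inv_left [simp]: "GL_inv n g * g = 1\<^sub>m n"
    and GL_inv_right [simp]: "g * GL_inv n g = 1\<^sub>m n"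
    and GL_inv_closed [simp]: "GL_inv n g \<in> GL n"
    and GL_inv_inv [simp]: "GL_inv n (GL_inv n g) = g"
proof -
  obtain h where h: "h \<in> carrier_mat n n" "h * g = 1\<^sub>m n" "g * h = 1\<^sub>m n" and g: "g \<in> carrier_mat n n"
    using assms unfolding GL_iff by blast
  have [simp]: "GL_inv n g = h" by (rule GL_inv_unique[OF g h])
  show "GL_inv n g \<in> carrier_mat n n" "GL_inv n g * g = 1\<^sub>m n" "g * GL_inv n g = 1\<^sub>m n"
    using h by simp_all
  show "GL_inv n g \<in> GL n" unfolding GL_iff using h g by auto
  show "GL_inv n (GL_inv n g) = g" using GL_inv_unique[OF h(1) g] h by simp
qed

lemma GL_one [simp]: "1\<^sub>m n \<in> GL n" and GL_inv_one [simp]: "GL_inv n (1\<^sub>m n) = 1\<^sub>m n"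
  using GL_inv_unique[of "1\<^sub>m n" n "1\<^sub>m n"] unfolding GL_iff by (auto intro!: bexI[of _ "1\<^sub>m n"])

lemma GL_cancel:
  assumes "g \<in> GL n" "A \<in> carrier_mat n m"
  shows GL_cancel_left: "GL_inv n g * (g * A) = A"
    and GL_cancel_right: "g * (GL_inv n g * A) = A"
proof -
  have "GL_inv n g * (g * A) = (GL_inv n g * g) * A"
    by (rule assoc_mult_mat[symmetric, of _ n n _ n _ m]) (use assms in auto)
  then show "GL_inv n g * (g * A) = A" using assms by simp
  have "g * (GL_inv n g * A) = (g * GL_inv n g) * A"
    by (rule assoc_mult_mat[symmetric, of _ n n _ n _ m]) (use assms in auto)
  then show "g * (GL_inv n g * A) = A" using assms by simp
qed

text \<open>Instances of the matrix laws at fixed dimensions: in their general form the simplifier cannot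
  guess the inner dimensions in the side conditions.\<close>

locale handsaw_dims =
  fixes r0 r1 n :: nat
begin

lemmas closed = mult_carrier_mat[of _ n n _ n] mult_carrier_mat[of _ n n _ r0] mult_carrier_mat[of _ r1 n _ n]
  mult_carrier_mat[of _ n r0 _ r0] mult_carrier_mat[of _ r1 r1 _ n]
  minus_carrier_mat[of _ n n] add_carrier_mat[of _ n n]

lemmas assoc = assoc_mult_mat[of _ n n _ n _ n] assoc_mult_mat[of _ n n _ n _ r0]
  assoc_mult_mat[of _ r1 n _ n _ n] assoc_mult_mat[of _ n n _ r0 _ r0]
  assoc_mult_mat[of _ r1 r1 _ n _ n]

lemmas distrib = mult_add_distrib_mat[of _ n n _ n] mult_add_distrib_mat[of _ n n _ r0]
  mult_add_distrib_mat[of _ r1 n _ n] add_mult_distrib_mat[of _ n n _ _ n]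
  add_mult_distrib_mat[of _ n n _ _ r0] add_mult_distrib_mat[of _ r1 n _ _ n]
  mult_minus_distrib_mat[of _ n n _ n] minus_mult_distrib_mat[of _ n n _ _ n]
  add_mult_distrib_mat[of _ n r0 _ _ r0] mult_add_distrib_mat[of _ r1 r1 _ n]

lemmas scale = mult_smult_distrib[of _ n n _ n] mult_smult_distrib[of _ n n _ r0]
  mult_smult_distrib[of _ r1 n _ n] mult_smult_assoc_mat[of _ n n _ n]
  mult_smult_assoc_mat[of _ n n _ r0] mult_smult_assoc_mat[of _ r1 n _ n]
  mult_smult_assoc_mat[of _ n r0 _ r0] mult_smult_distrib[of _ r1 r1 _ n]

lemmas cancel = GL_cancel[of _ n _ n] GL_cancel[of _ n _ r0]

lemmas mat_alg = closed assoc distrib scale cancel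

end

lemma GL_cancel_vec:
  assumes "g \<in> GL n" "v \<in> carrier_vec n"
  shows GL_cancel_vec_left [simp]: "GL_inv n g *\<^sub>v (g *\<^sub>v v) = v"
    and GL_cancel_vec_right [simp]: "g *\<^sub>v (GL_inv n g *\<^sub>v v) = v"
proof -
  have "GL_inv n g *\<^sub>v (g *\<^sub>v v) = (GL_inv n g * g) *\<^sub>v v"
    by (rule assoc_mult_mat_vec[symmetric, of _ n n _ n]) (use assms in auto)
  then show "GL_inv n g *\<^sub>v (g *\<^sub>v v) = v" using assms by simp
  have "g *\<^sub>v (GL_inv n g *\<^sub>v v) = (g * GL_inv n g) *\<^sub>v v"
    by (rule assoc_mult_mat_vec[symmetric, of _ n n _ n]) (use assms in auto)
  then show "g *\<^sub>v (GL_inv n g *\<^sub>v v) = v" using assms by simp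
qed

lemma GL_mult:
  assumes "g \<in> GL n" "h \<in> GL n"
  shows GL_mult_closed [simp]: "g * h \<in> GL n"
    and GL_inv_mult: "GL_inv n (g * h) = GL_inv n h * GL_inv n g"
proof -
  have c: "g \<in> carrier_mat n n" "h \<in> carrier_mat n n"
    "GL_inv n g \<in> carrier_mat n n" "GL_inv n h \<in> carrier_mat n n" using assms by auto
  have gh: "g * h \<in> carrier_mat n n" "GL_inv n h * GL_inv n g \<in> carrier_mat n n" using c by auto
  interpret handsaw_dims n n n .
  have 1: "(GL_inv n h * GL_inv n g) * (g * h) = 1\<^sub>m n"
    and 2: "(g * h) * (GL_inv n h * GL_inv n g) = 1\<^sub>m n"
    using assms c by (simp_all add: mat_alg)
  show "g * h \<in> GL n" unfolding GL_iff using gh 1 2 by blast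
  show "GL_inv n (g * h) = GL_inv n h * GL_inv n g" by (rule GL_inv_unique[OF gh 1 2])
qed

lemma GL_transpose:
  assumes "g \<in> GL n"
  shows GL_transpose_closed [simp]: "transpose_mat g \<in> GL n"
    and GL_inv_transpose: "GL_inv n (transpose_mat g) = transpose_mat (GL_inv n g)"
proof -
  have c: "g \<in> carrier_mat n n" "GL_inv n g \<in> carrier_mat n n" using assms by auto
  have 1: "transpose_mat (GL_inv n g) * transpose_mat g = 1\<^sub>m n"
    "transpose_mat g * transpose_mat (GL_inv n g) = 1\<^sub>m n"
    unfolding transpose_mult[OF c, symmetric] transpose_mult[OF c(2,1), symmetric] using assms by simp_all
  show "transpose_mat g \<in> GL n" unfolding GL_iff using c 1 by auto
  show "GL_inv n (transpose_mat g) = transpose_mat (GL_inv n g)"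
    by (rule GL_inv_unique) (use c 1 in auto)
qed

text \<open>A square matrix with trivial kernel has nonzero determinant. The classification uses
  this for the matrix of Krylov vectors.\<close>

lemma GL_I_kernel:
  assumes C: "C \<in> carrier_mat n n"
    and ker: "\<And>v. v \<in> carrier_vec n \<Longrightarrow> C *\<^sub>v v = 0\<^sub>v n \<Longrightarrow> v = 0\<^sub>v n"
  shows "C \<in> GL n"
proof -
  have "det C \<noteq> 0" using det_0_iff_vec_prod_zero_field[OF C] ker by blast
  then have "C \<in> Units (ring_mat TYPE(complex) n ())"
    by (rule det_non_zero_imp_unit[OF C])
  then show ?thesis by (simp add: GL_def)
qed

lemma mat_diag_GL:
  assumes "\<And>i. i < n \<Longrightarrow> f i \<noteq> (0::complex)"
  shows "mat_diag n f \<in> GL n" and "GL_inv n (mat_diag n f) = mat_diag n (\<lambda>i. inverse (f i))"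
proof -
  have 1: "mat_diag n (\<lambda>i. inverse (f i)) * mat_diag n f = 1\<^sub>m n"
    "mat_diag n f * mat_diag n (\<lambda>i. inverse (f i)) = 1\<^sub>m n"
    unfolding mat_diag_diag mat_diag_one[symmetric] using assms by (auto simp: mat_diag_def)
  show "mat_diag n f \<in> GL n" unfolding GL_iff using 1 by (auto intro!: bexI[of _ "mat_diag n (\<lambda>i. inverse (f i))"])
  show "GL_inv n (mat_diag n f) = mat_diag n (\<lambda>i. inverse (f i))"
    by (rule GL_inv_unique) (use 1 in auto)
qed

section \<open>The action of GL(V) on triples\<close>

abbreviation HS :: "nat \<Rightarrow> nat \<Rightarrow> nat \<Rightarrow> (complex, handsaw) module" where
  "HS \<equiv> handsaw_space"

lemma handsaw_vs: "vectorspace CC (HS r0 r1 n)"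
  unfolding handsaw_space_def by (intro direct_sum_is_vs matrix_vs)

lemma handsaw_carrier [simp]:
  "(B, z, w) \<in> carrier (HS r0 r1 n) \<longleftrightarrow>
     B \<in> carrier_mat n n \<and> z \<in> carrier_mat n r0 \<and> w \<in> carrier_mat r1 n"
  by (simp add: handsaw_space_def direct_sum_def module_mat_simps)

lemma handsaw_ops [simp]:
  "(B, z, w) \<oplus>\<^bsub>HS r0 r1 n\<^esub> (B', z', w') = (B + B', z + z', w + w')"
  "c \<odot>\<^bsub>HS r0 r1 n\<^esub> (B, z, w) = (c \<cdot>\<^sub>m B, c \<cdot>\<^sub>m z, c \<cdot>\<^sub>m w)"
  "\<zero>\<^bsub>HS r0 r1 n\<^esub> = (0\<^sub>m n n, 0\<^sub>m n r0, 0\<^sub>m r1 n)"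
  by (simp_all add: handsaw_space_def direct_sum_def module_mat_simps)

context
  fixes r0 r1 n :: nat and g :: "complex mat"
  assumes g: "g \<in> GL n"
begin

lemma GL_act_closed:
  assumes "b \<in> carrier (HS r0 r1 n)"
  shows "GL_act n g b \<in> carrier (HS r0 r1 n)"
proof -
  interpret handsaw_dims r0 r1 n .
  show ?thesis using assms g by (cases b) (auto simp: mat_alg)
qed

lemma GL_act_add:
  assumes "b \<in> carrier (HS r0 r1 n)" "b' \<in> carrier (HS r0 r1 n)"
  shows "GL_act n g (b \<oplus>\<^bsub>HS r0 r1 n\<^esub> b') =
    GL_act n g b \<oplus>\<^bsub>HS r0 r1 n\<^esub> GL_act n g b'"
proof -
  obtain B z w B' z' w' where b: "b = (B, z, w)" "b' = (B', z', w')" by (cases b, cases b')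
  have c: "B \<in> carrier_mat n n" "z \<in> carrier_mat n r0" "w \<in> carrier_mat r1 n"
    "B' \<in> carrier_mat n n" "z' \<in> carrier_mat n r0" "w' \<in> carrier_mat r1 n"
    using assms b by auto
  have d: "g \<in> carrier_mat n n" "GL_inv n g \<in> carrier_mat n n" using g by auto
  interpret handsaw_dims r0 r1 n .
  show ?thesis unfolding b using c d by (simp add: mat_alg)
qed

lemma GL_act_smult:
  assumes "b \<in> carrier (HS r0 r1 n)"
  shows "GL_act n g (c \<odot>\<^bsub>HS r0 r1 n\<^esub> b) = c \<odot>\<^bsub>HS r0 r1 n\<^esub> GL_act n g b"
proof -
  obtain B z w where b: "b = (B, z, w)" by (cases b)
  have c: "B \<in> carrier_mat n n" "z \<in> carrier_mat n r0" "w \<in> carrier_mat r1 n"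
    using assms b by auto
  have d: "g \<in> carrier_mat n n" "GL_inv n g \<in> carrier_mat n n" using g by auto
  interpret handsaw_dims r0 r1 n .
  show ?thesis unfolding b using c d by (simp add: mat_alg)
qed

end

lemma GL_act_one:
  assumes "b \<in> carrier (HS r0 r1 n)"
  shows "GL_act n (1\<^sub>m n) b = b"
  using assms by (cases b) auto

lemma GL_act_mult:
  assumes "g \<in> GL n" "h \<in> GL n" "b \<in> carrier (HS r0 r1 n)"
  shows "GL_act n (g * h) b = GL_act n g (GL_act n h b)"
proof -
  obtain B z w where b: "b = (B, z, w)" by (cases b)
  have c: "B \<in> carrier_mat n n" "z \<in> carrier_mat n r0" "w \<in> carrier_mat r1 n"
    using assms(3) b by auto
  have d: "g \<in> carrier_mat n n" "GL_inv n g \<in> carrier_mat n n"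
     "h \<in> carrier_mat n n" "GL_inv n h \<in> carrier_mat n n" using assms by auto
  interpret handsaw_dims r0 r1 n .
  show ?thesis unfolding b GL_act.simps GL_inv_mult[OF assms(1,2)]
    using c d by (simp add: mat_alg)
qed

lemma GL_act_inv:
  assumes "g \<in> GL n" "b \<in> carrier (HS r0 r1 n)"
  shows "GL_act n (GL_inv n g) (GL_act n g b) = b" "GL_act n g (GL_act n (GL_inv n g) b) = b"
  using assms by (simp_all add: GL_act_mult[symmetric] GL_act_one)

text \<open>The derivative of \<open>GL_act\<close> at the identity in the direction
  \<open>\<xi>\<close>. As a map it can be linear and equivariant, which the bare set
  \<open>gl_image\<close> cannot express.\<close>

fun gl_inf :: "complex mat \<Rightarrow> handsaw \<Rightarrow> handsaw" where
  "gl_inf \<xi> (B, z, w) = (\<xi> * B - B * \<xi>, \<xi> * z, - (w * \<xi>))"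

lemma gl_image_eq: "gl_image n b = (\<lambda>\<xi>. gl_inf \<xi> b) ` carrier_mat n n"
  by (cases b) auto

lemma gl_inf_closed:
  assumes "\<xi> \<in> carrier_mat n n" "b \<in> carrier (HS r0 r1 n)"
  shows "gl_inf \<xi> b \<in> carrier (HS r0 r1 n)"
proof -
  interpret handsaw_dims r0 r1 n .
  show ?thesis using assms by (cases b) (auto simp: mat_alg)
qed

lemma gl_inf_add:
  assumes "\<xi> \<in> carrier_mat n n" "\<xi>' \<in> carrier_mat n n" "b \<in> carrier (HS r0 r1 n)"
  shows "gl_inf (\<xi> + \<xi>') b = gl_inf \<xi> b \<oplus>\<^bsub>HS r0 r1 n\<^esub> gl_inf \<xi>' b"
proof -
  interpret handsaw_dims r0 r1 n .
  obtain B z w where b: "b = (B, z, w)" by (cases b)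
  have c: "B \<in> carrier_mat n n" "z \<in> carrier_mat n r0" "w \<in> carrier_mat r1 n"
    using assms(3) b by auto
  have "(\<xi> + \<xi>') * B - B * (\<xi> + \<xi>') = (\<xi> * B - B * \<xi>) + (\<xi>' * B - B * \<xi>')"
    using c assms by (simp add: mat_alg) (rule eq_matI, auto simp del: index_mult_mat(1))
  moreover have "- (w * (\<xi> + \<xi>')) = - (w * \<xi>) + - (w * \<xi>')"
    using c assms by (simp add: mat_alg) (rule eq_matI, auto simp del: index_mult_mat(1))
  ultimately show ?thesis unfolding b using c assms by (simp add: mat_alg)
qed

lemma gl_inf_smult:
  assumes "\<xi> \<in> carrier_mat n n" "b \<in> carrier (HS r0 r1 n)"
  shows "gl_inf (a \<cdot>\<^sub>m \<xi>) b = a \<odot>\<^bsub>HS r0 r1 n\<^esub> gl_inf \<xi> b"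
proof -
  interpret handsaw_dims r0 r1 n .
  obtain B z w where b: "b = (B, z, w)" by (cases b)
  have c: "B \<in> carrier_mat n n" "z \<in> carrier_mat n r0" "w \<in> carrier_mat r1 n"
    using assms(2) b by auto
  have "a \<cdot>\<^sub>m \<xi> * B - B * (a \<cdot>\<^sub>m \<xi>) = a \<cdot>\<^sub>m (\<xi> * B - B * \<xi>)"
    using c assms by (simp add: mat_alg) (rule eq_matI, auto simp: algebra_simps simp del: index_mult_mat(1))
  moreover have "- (w * (a \<cdot>\<^sub>m \<xi>)) = a \<cdot>\<^sub>m (- (w * \<xi>))"
    using c assms by (simp add: mat_alg) (rule eq_matI, auto simp del: index_mult_mat(1))
  ultimately show ?thesis unfolding b using c assms by (simp add: mat_alg)
qed

lemma gl_image_subspace: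
  assumes b: "b \<in> carrier (HS r0 r1 n)"
  shows "VectorSpace.subspace CC (gl_image n b) (HS r0 r1 n)"
proof -
  interpret U: vectorspace CC "HS r0 r1 n" by (rule handsaw_vs)
  have "LinearCombinations.submodule CC (gl_image n b) (HS r0 r1 n)"
  proof (unfold LinearCombinations.submodule_def, intro conjI allI impI)
    show "gl_image n b \<subseteq> carrier (HS r0 r1 n)"
      unfolding gl_image_eq using gl_inf_closed[OF _ b] by blast
    fix u v assume "u \<in> gl_image n b" "v \<in> gl_image n b"
    then obtain \<xi> \<xi>' where "\<xi> \<in> carrier_mat n n" "\<xi>' \<in> carrier_mat n n" "u = gl_inf \<xi> b" "v = gl_inf \<xi>' b"
      by (auto simp: gl_image_eq)
    then show "u \<oplus>\<^bsub>HS r0 r1 n\<^esub> v \<in> gl_image n b"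
      unfolding gl_image_eq using gl_inf_add[OF _ _ b] by (metis add_carrier_mat imageI)
  next
    fix a u assume "u \<in> gl_image n b"
    then obtain \<xi> where "\<xi> \<in> carrier_mat n n" "u = gl_inf \<xi> b"
      by (auto simp: gl_image_eq)
    then show "a \<odot>\<^bsub>HS r0 r1 n\<^esub> u \<in> gl_image n b"
      unfolding gl_image_eq using gl_inf_smult[OF _ b] by (metis smult_carrier_mat imageI)
  next
    have "gl_inf (0\<^sub>m n n) b = \<zero>\<^bsub>HS r0 r1 n\<^esub>" using b by (cases b) auto
    then show "\<zero>\<^bsub>HS r0 r1 n\<^esub> \<in> gl_image n b"
      unfolding gl_image_eq by (metis zero_carrier_mat imageI)
  qed (rule U.module_axioms)
  then show ?thesis using handsaw_vs by (simp add: VectorSpace.subspace_def)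
qed

text \<open>The derivative of the rule g(xb) = (gxg^-1)(gb) with respect to x at the identity:
  moving \<open>g\<close> past the infinitesimal action conjugates \<open>\<xi>\<close>.\<close>

lemma GL_act_gl_inf:
  assumes "g \<in> GL n" "\<xi> \<in> carrier_mat n n" "b \<in> carrier (HS r0 r1 n)"
  shows "GL_act n g (gl_inf \<xi> b) = gl_inf (g * \<xi> * GL_inv n g) (GL_act n g b)"
proof -
  obtain B z w where b: "b = (B, z, w)" by (cases b)
  have c: "B \<in> carrier_mat n n" "z \<in> carrier_mat n r0" "w \<in> carrier_mat r1 n"
    using assms(3) b by auto
  have d: "g \<in> carrier_mat n n" "GL_inv n g \<in> carrier_mat n n" using assms by auto
  interpret handsaw_dims r0 r1 n .
  have "g * (\<xi> * B - B * \<xi>) * GL_inv n g =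
     g * \<xi> * GL_inv n g * (g * B * GL_inv n g) - g * B * GL_inv n g * (g * \<xi> * GL_inv n g)"
    using c d assms by (simp add: mat_alg)
  moreover have "g * (\<xi> * z) = g * \<xi> * GL_inv n g * (g * z)"
    using c d assms by (simp add: mat_alg)
  moreover have "- (w * \<xi>) * GL_inv n g = - (w * GL_inv n g * (g * \<xi> * GL_inv n g))"
    using c d assms carrier_matD[OF d(2)] by (simp add: mat_alg)
  ultimately show ?thesis unfolding b by simp
qed

text \<open>The tangent space of an orbit moves along with its base point. Conjugation by
  \<open>g\<close> permutes all square matrices, which gives both inclusions.\<close>

lemma GL_act_gl_image:
  assumes g: "g \<in> GL n" and b: "b \<in> carrier (HS r0 r1 n)"
  shows "GL_act n g ` gl_image n b = gl_image n (GL_act n g b)"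
proof
  show "GL_act n g ` gl_image n b \<subseteq> gl_image n (GL_act n g b)"
  proof (rule subsetI, elim imageE)
    fix u v assume u: "u = GL_act n g v" and "v \<in> gl_image n b"
    then obtain \<xi> where x: "\<xi> \<in> carrier_mat n n" "v = gl_inf \<xi> b" by (auto simp: gl_image_eq)
    then have "g * \<xi> * GL_inv n g \<in> carrier_mat n n" using g by (meson GL_carrier GL_inv_carrier mult_carrier_mat)
    then show "u \<in> gl_image n (GL_act n g b)"
      unfolding u x gl_image_eq GL_act_gl_inf[OF g x(1) b] by (rule imageI)
  qed
  show "gl_image n (GL_act n g b) \<subseteq> GL_act n g ` gl_image n b"
  proof
    fix u assume "u \<in> gl_image n (GL_act n g b)"
    then obtain \<xi> where x: "\<xi> \<in> carrier_mat n n" "u = gl_inf \<xi> (GL_act n g b)"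
      by (auto simp: gl_image_eq)
    interpret handsaw_dims r0 r1 n .
    have y: "GL_inv n g * \<xi> * g \<in> carrier_mat n n" using g x by (auto simp: mat_alg)
    have "g * (GL_inv n g * \<xi> * g) * GL_inv n g = \<xi>"
      using g x GL_carrier[OF g] GL_inv_carrier[OF g] by (simp add: mat_alg)
    then have "u = GL_act n g (gl_inf (GL_inv n g * \<xi> * g) b)"
      using GL_act_gl_inf[OF g y b] x by simp
    then show "u \<in> GL_act n g ` gl_image n b" using y by (auto simp: gl_image_eq)
  qed
qed

section \<open>Orbits\<close>

lemma GL_orbit_refl: "b \<in> carrier (HS r0 r1 n) \<Longrightarrow> b \<in> GL_orbit n b"
  unfolding GL_orbit_def using GL_act_one GL_one by (metis imageI)

lemma GL_orbit_eq:
  assumes g: "g \<in> GL n" and b: "b \<in> carrier (HS r0 r1 n)"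
  shows "GL_orbit n (GL_act n g b) = GL_orbit n b"
proof
  show "GL_orbit n (GL_act n g b) \<subseteq> GL_orbit n b"
    unfolding GL_orbit_def image_image using GL_act_mult[OF _ g b, symmetric] g by (intro image_subsetI) simp
  show "GL_orbit n b \<subseteq> GL_orbit n (GL_act n g b)"
  proof
    fix c assume "c \<in> GL_orbit n b"
    then obtain h where h: "h \<in> GL n" "c = GL_act n h b" by (auto simp: GL_orbit_def)
    have "c = GL_act n (h * GL_inv n g) (GL_act n g b)"
      using h g b by (simp add: GL_act_mult[OF _ _ GL_act_closed[OF g b]] GL_act_inv)
    then show "c \<in> GL_orbit n (GL_act n g b)" using h g by (auto simp: GL_orbit_def)
  qed
qed

section \<open>The torus action on triples\<close>

lemma torus_nonzero: "t \<in> torus r \<Longrightarrow> i < 2 * r + 2 \<Longrightarrow> t i \<noteq> 0"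
  by (auto simp: torus_def PiE_def Pi_def)

lemma flavour_carrier [simp]:
  "flavour_mat J t \<in> carrier_mat (card J) (card J)" "flavour_inv_mat J t \<in> carrier_mat (card J) (card J)"
  by (simp_all add: flavour_mat_def flavour_inv_mat_def)

context
  fixes J0 J1 :: "nat set" and n :: nat and t :: "nat \<Rightarrow> complex"
begin

lemma torus_act_closed:
  assumes "b \<in> carrier (HS (card J0) (card J1) n)"
  shows "torus_act J0 J1 t b \<in> carrier (HS (card J0) (card J1) n)"
proof -
  interpret handsaw_dims "card J0" "card J1" n .
  show ?thesis using assms by (cases b) (auto simp: mat_alg)
qed

lemma torus_act_add:
  assumes "b \<in> carrier (HS (card J0) (card J1) n)" "b' \<in> carrier (HS (card J0) (card J1) n)"
  shows "torus_act J0 J1 t (b \<oplus>\<^bsub>HS (card J0) (card J1) n\<^esub> b') =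
    torus_act J0 J1 t b \<oplus>\<^bsub>HS (card J0) (card J1) n\<^esub> torus_act J0 J1 t b'"
proof -
  obtain B z w B' z' w' where b: "b = (B, z, w)" "b' = (B', z', w')" by (cases b, cases b')
  interpret handsaw_dims "card J0" "card J1" n .
  show ?thesis using assms unfolding b
    by (auto simp: mat_alg add_smult_distrib_left_mat[of _ n n] add_smult_distrib_left_mat[of _ "card J1" n])
qed

lemma torus_act_GL_act:
  assumes "g \<in> GL n" "b \<in> carrier (HS (card J0) (card J1) n)"
  shows "torus_act J0 J1 t (GL_act n g b) = GL_act n g (torus_act J0 J1 t b)"
proof -
  have d: "g \<in> carrier_mat n n" "GL_inv n g \<in> carrier_mat n n" using assms by auto
  interpret handsaw_dims "card J0" "card J1" n .
  show ?thesis using assms d by (cases b) (auto simp: mat_alg)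
qed

text \<open>The torus scales \<open>B\<close> and \<open>w\<close> and acts on the flavour side of
  \<open>z\<close> and \<open>w\<close>, whereas \<open>\<xi>\<close> multiplies on the side of
  \<open>V\<close>, so the two operations commute.\<close>

lemma torus_act_gl_inf:
  assumes "\<xi> \<in> carrier_mat n n" "b \<in> carrier (HS (card J0) (card J1) n)"
  shows "torus_act J0 J1 t (gl_inf \<xi> b) = gl_inf \<xi> (torus_act J0 J1 t b)"
proof -
  obtain B z w where b: "b = (B, z, w)" by (cases b)
  have c: "B \<in> carrier_mat n n" "z \<in> carrier_mat n (card J0)" "w \<in> carrier_mat (card J1) n"
    using assms(2) b by auto
  interpret handsaw_dims "card J0" "card J1" n .
  have "t q_ix \<cdot>\<^sub>m (\<xi> * B - B * \<xi>) = \<xi> * (t q_ix \<cdot>\<^sub>m B) - t q_ix \<cdot>\<^sub>m B * \<xi>"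
    using c assms by (simp add: mat_alg) (rule eq_matI, auto simp: algebra_simps simp del: index_mult_mat(1))
  moreover have "t q_ix \<cdot>\<^sub>m (flavour_mat J1 t * - (w * \<xi>)) = - (t q_ix \<cdot>\<^sub>m (flavour_mat J1 t * w) * \<xi>)"
  proof -
    have "flavour_mat J1 t * - (w * \<xi>) = - (flavour_mat J1 t * (w * \<xi>))"
      using c assms carrier_matD[OF flavour_carrier(1)[of J1 t]] by simp
    moreover have "t q_ix \<cdot>\<^sub>m (flavour_mat J1 t * w) * \<xi> = t q_ix \<cdot>\<^sub>m (flavour_mat J1 t * (w * \<xi>))"
      using c assms by (simp add: mat_alg)
    ultimately show ?thesis
      by (simp only:) (rule eq_matI, auto simp del: index_mult_mat(1))
  qed
  ultimately show ?thesis unfolding b using c assms by (simp add: mat_alg)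
qed

end

text \<open>Transposition exchanges the roles of \<open>W\<^sub>0\<close> and \<open>W\<^sub>1\<close>.  As \<open>z\<close> is twisted by
  \<open>e\<^sub>\<alpha>\<close> inverse and \<open>w\<close> by \<open>q e\<^sub>\<alpha>\<close>, it has to be combined with \<open>e\<^sub>\<alpha> \<mapsto> 1 / (q e\<^sub>\<alpha>)\<close> on the torus.\<close>

fun dual :: "handsaw \<Rightarrow> handsaw" where
  "dual (B, z, w) = (transpose_mat B, transpose_mat w, transpose_mat z)"

definition dual_torus :: "nat \<Rightarrow> (nat \<Rightarrow> complex) \<Rightarrow> nat \<Rightarrow> complex" where
  "dual_torus r t = restrict (\<lambda>i. if i \<in> {1..r} then inverse (t q_ix * t i) else t i) {..<2 * r + 2}"

lemma dual_dual [simp]: "dual (dual b) = b"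
  by (cases b) simp

lemma dual_closed [simp]:
  "dual b \<in> carrier (HS r0 r1 n) \<longleftrightarrow> b \<in> carrier (HS r1 r0 n)"
  by (cases b) auto

lemma dual_add:
  assumes "b \<in> carrier (HS r0 r1 n)" "b' \<in> carrier (HS r0 r1 n)"
  shows "dual (b \<oplus>\<^bsub>HS r0 r1 n\<^esub> b') = dual b \<oplus>\<^bsub>HS r1 r0 n\<^esub> dual b'"
  using assms by (cases b, cases b') (auto simp: transpose_add[of _ n n] transpose_add[of _ n r0] transpose_add[of _ r1 n])

lemma dual_smult:
  "dual (c \<odot>\<^bsub>HS r0 r1 n\<^esub> b) = c \<odot>\<^bsub>HS r1 r0 n\<^esub> dual b"
  by (cases b) (auto intro!: eq_matI)

text \<open>Transposition replaces \<open>V\<close> by its dual space, on which \<open>g\<close>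
  acts by the contragredient matrix.\<close>

lemma dual_GL_act:
  assumes "g \<in> GL n" "b \<in> carrier (HS r0 r1 n)"
  shows "dual (GL_act n g b) = GL_act n (transpose_mat (GL_inv n g)) (dual b)"
proof -
  obtain B z w where b: "b = (B, z, w)" by (cases b)
  have c: "B \<in> carrier_mat n n" "z \<in> carrier_mat n r0" "w \<in> carrier_mat r1 n"
    using assms(2) b by auto
  have d: "g \<in> carrier_mat n n" "GL_inv n g \<in> carrier_mat n n" using assms by auto
  interpret handsaw_dims r0 r1 n .
  show ?thesis unfolding b using c d assms
    by (simp add: mat_alg GL_inv_transpose transpose_mult[of _ n n _ n] transpose_mult[of _ n n _ r0]
       transpose_mult[of _ r1 n _ n] assoc_mult_mat[of _ n n _ n _ n])
qed

text \<open>Negative transposition is the derivative of the contragredient at the identity.\<close>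

lemma dual_gl_inf:
  assumes "\<xi> \<in> carrier_mat n n" "b \<in> carrier (HS r0 r1 n)"
  shows "dual (gl_inf \<xi> b) = gl_inf (- transpose_mat \<xi>) (dual b)"
proof -
  obtain B z w where b: "b = (B, z, w)" by (cases b)
  have c: "B \<in> carrier_mat n n" "z \<in> carrier_mat n r0" "w \<in> carrier_mat r1 n"
    using assms(2) b by auto
  have tr: "transpose_mat (\<xi> * B) = transpose_mat B * transpose_mat \<xi>"
    "transpose_mat (B * \<xi>) = transpose_mat \<xi> * transpose_mat B"
    "transpose_mat (\<xi> * z) = transpose_mat z * transpose_mat \<xi>"
    "transpose_mat (w * \<xi>) = transpose_mat \<xi> * transpose_mat w"
    using c assms(1) transpose_mult by blast+
  have "transpose_mat (\<xi> * B - B * \<xi>) = transpose_mat (\<xi> * B) - transpose_mat (B * \<xi>)"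
    by (rule transpose_minus[of _ n n]) (use c assms(1) in auto)
  also have "\<dots> = - transpose_mat \<xi> * transpose_mat B - transpose_mat B * - transpose_mat \<xi>"
    unfolding tr using c assms(1) by (intro eq_matI) auto
  finally have 1: "transpose_mat (\<xi> * B - B * \<xi>) = \<dots>" .
  have 2: "transpose_mat (- (w * \<xi>)) = - transpose_mat \<xi> * transpose_mat w"
    unfolding transpose_uminus tr using c assms(1) by simp
  have 3: "transpose_mat (\<xi> * z) = - (transpose_mat z * - transpose_mat \<xi>)"
    unfolding tr using c assms(1) by simp
  show ?thesis unfolding b using 1 2 3 by simp
qed

text \<open>One inclusion suffices: applied to \<open>dual b\<close> it is the converse, because
  \<open>dual\<close> is an involution.\<close>

lemma dual_gl_image:
  assumes "b \<in> carrier (HS r0 r1 n)"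
  shows "dual ` gl_image n b = gl_image n (dual b)"
proof -
  have sub: "dual ` gl_image n b \<subseteq> gl_image n (dual b)" if "b \<in> carrier (HS r0 r1 n)" for b r0 r1
    unfolding gl_image_eq using dual_gl_inf[OF _ that] by auto
  have "dual ` gl_image n (dual b) \<subseteq> gl_image n b" using sub[of "dual b" r1 r0] assms by simp
  then have "dual ` dual ` gl_image n (dual b) \<subseteq> dual ` gl_image n b" by (rule image_mono)
  then show ?thesis using sub[OF assms] by (simp add: image_image)
qed

lemma dual_GL_orbit:
  assumes b: "b \<in> carrier (HS r0 r1 n)"
  shows "dual ` GL_orbit n b = GL_orbit n (dual b)"
proof -
  have sub: "dual ` GL_orbit n b \<subseteq> GL_orbit n (dual b)" if "b \<in> carrier (HS r0 r1 n)" for b r0 r1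
    unfolding GL_orbit_def using dual_GL_act[OF _ that] by auto
  have "dual ` GL_orbit n (dual b) \<subseteq> GL_orbit n b" using sub[of "dual b" r1 r0] assms by simp
  then have "dual ` dual ` GL_orbit n (dual b) \<subseteq> dual ` GL_orbit n b" by (rule image_mono)
  then show ?thesis using sub[OF assms] by (simp add: image_image)
qed

lemma dual_torus_closed: "t \<in> torus r \<Longrightarrow> dual_torus r t \<in> torus r"
  by (auto simp: dual_torus_def torus_def q_ix_def PiE_def Pi_def)

text \<open>Put e' = 1/(qe). The factor qe' on a row of \<open>w\<close> is 1/e, and the factor 1/e'
  on a column of \<open>z\<close> is qe, so the twists of the two maps change places.\<close>

lemma torus_act_dual:
  assumes "J0 \<subseteq> {1..r}" "J1 \<subseteq> {1..r}" and t: "t \<in> torus r"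
    and b: "b \<in> carrier (HS (card J1) (card J0) n)"
  shows "torus_act J0 J1 t (dual b) = dual (torus_act J1 J0 (dual_torus r t) b)"
proof -
  obtain B z w where bb: "b = (B, z, w)" by (cases b)
  have c: "B \<in> carrier_mat n n" "z \<in> carrier_mat n (card J1)" "w \<in> carrier_mat (card J0) n"
    using b bb by auto
  have fin: "finite J0" "finite J1" using assms finite_subset by blast+
  have mem: "sorted_list_of_set J ! i \<in> {1..r}" if "J \<subseteq> {1..r}" "i < card J" for J i
  proof -
    have "finite J" using that finite_subset by blast
    then have "sorted_list_of_set J ! i \<in> set (sorted_list_of_set J)" using that by (intro nth_mem) simp
    then show ?thesis using that \<open>finite J\<close> by auto
  qed
  have q: "dual_torus r t q_ix = t q_ix" "t q_ix \<noteq> 0"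
    using torus_nonzero[OF t] by (auto simp: dual_torus_def q_ix_def)
  have d: "dual_torus r t (e_ix i) = inverse (t q_ix * t (e_ix i))" if "i \<in> {1..r}" for i
    using that by (auto simp: dual_torus_def e_ix_def)
  have 1: "transpose_mat w * flavour_inv_mat J0 t
      = transpose_mat (dual_torus r t q_ix \<cdot>\<^sub>m (flavour_mat J0 (dual_torus r t) * w))"
    unfolding q(1) flavour_mat_def flavour_inv_mat_def mat_diag_mult_left[OF c(3)]
    using c q mem[OF assms(1)]
    by (subst mat_diag_mult_right[of _ n "card J0"]) (auto simp: d intro!: eq_matI)
  have 2: "t q_ix \<cdot>\<^sub>m (flavour_mat J1 t * transpose_mat z)
      = transpose_mat (z * flavour_inv_mat J1 (dual_torus r t))"
    unfolding flavour_mat_def flavour_inv_mat_def mat_diag_mult_right[OF c(2)]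
    using c q mem[OF assms(2)]
    by (subst mat_diag_mult_left[of _ "card J1" n]) (auto simp: d intro!: eq_matI)
  have 3: "t q_ix \<cdot>\<^sub>m transpose_mat B = transpose_mat (dual_torus r t q_ix \<cdot>\<^sub>m B)"
    unfolding q(1) by (intro eq_matI) auto
  show ?thesis unfolding bb using 1 2 3 by simp
qed


section \<open>Euler classes of the fibre and of the tangent space\<close>

lemma mult_mat_zero_vec:
  fixes A :: "'a :: semiring_1 mat"
  assumes "A \<in> carrier_mat m n"
  shows "A *\<^sub>v 0\<^sub>v n = 0\<^sub>v m"
  using assms by (intro eq_vecI) auto

lemma mat_diag_mult_vec:
  fixes f :: "nat \<Rightarrow> 'a :: semiring_1"
  assumes "v \<in> carrier_vec n"
  shows "mat_diag n f *\<^sub>v v = vec n (\<lambda>i. f i * v $ i)"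
proof (rule eq_vecI)
  fix i assume "i < dim_vec (vec n (\<lambda>i. f i * v $ i))"
  then have i: "i < n" by simp
  have "(mat_diag n f *\<^sub>v v) $ i = (\<Sum>j<n. (if i = j then f j else 0) * v $ j)"
    using i assms by (simp add: mat_diag_def scalar_prod_def atLeast0LessThan)
  also have "\<dots> = f i * v $ i" using i by (simp add: if_distrib[of "\<lambda>x. x * _"] cong: if_cong)
  finally show "(mat_diag n f *\<^sub>v v) $ i = vec n (\<lambda>i. f i * v $ i) $ i" using i by simp
qed (simp add: mat_diag_def)

text \<open>Two solutions differ by an element that stabilises \<open>b\<close>, hence by the
  identity. This evaluates the definite description in \<open>fibre_mat\<close>.\<close>

lemma fibre_mat_eq:
  assumes b: "b \<in> carrier (HS (card J0) (card J1) n)"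
    and g: "g \<in> GL n" "GL_act n g (torus_act J0 J1 t b) = b"
    and free: "\<And>h. h \<in> GL n \<Longrightarrow> GL_act n h b = b \<Longrightarrow> h = 1\<^sub>m n"
  shows "fibre_mat J0 J1 n b t = g"
  unfolding fibre_mat_def
proof (rule the_equality)
  fix g' assume g': "g' \<in> GL n \<and> GL_act n g' (torus_act J0 J1 t b) = b"
  note tb = torus_act_closed[OF b, of t]
  have "torus_act J0 J1 t b = GL_act n (GL_inv n g) b"
    using GL_act_inv(1)[OF g(1) tb] g(2) by simp
  then have "GL_act n (g' * GL_inv n g) b = b"
    using g' g(1) by (simp add: GL_act_mult[OF _ _ b])
  then have 1: "g' * GL_inv n g = 1\<^sub>m n" using free g' g(1) by (meson GL_mult_closed GL_inv_closed)
  have "g' = g' * GL_inv n g * g"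
    using g' g(1) assoc_mult_mat[of g' n n "GL_inv n g" n g n] right_mult_one_mat[of g' n n] by simp
  then show "g' = g" using 1 g(1) left_mult_one_mat[of g n n] by simp
qed (use g in blast)

text \<open>The image of \<open>S\<close> is a complement of the orbit directions that is stable
  under the linearised torus action, so the coordinates \<open>c\<close> diagonalise the tangent
  space. One set of coordinates serves the Euler class and all its twists.\<close>

lemma tangent_Eu:
  fixes S :: "('i \<Rightarrow> complex) \<Rightarrow> handsaw"
  assumes b: "b \<in> carrier (HS (card J0) (card J1) n)" and x: "repr x = b"
    and free: "\<And>h. h \<in> GL n \<Longrightarrow> GL_act n h b = b \<Longrightarrow> h = 1\<^sub>m n"
    and g: "\<And>t. t \<in> torus r \<Longrightarrow> g t \<in> GL n"
    and fixed: "\<And>t. t \<in> torus r \<Longrightarrow> GL_act n (g t) (torus_act J0 J1 t b) = b"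
    and S: "\<And>c. S c \<in> carrier (HS (card J0) (card J1) n)"
      "\<And>c d. S (\<lambda>i. c i + d i) = S c \<oplus>\<^bsub>HS (card J0) (card J1) n\<^esub> S d"
      "\<And>a c. S (\<lambda>i. a * c i) = a \<odot>\<^bsub>HS (card J0) (card J1) n\<^esub> S c"
      "\<And>c. S c \<in> gl_image n b \<longleftrightarrow> (\<forall>i\<in>I. c i = 0)"
      "\<And>u. u \<in> carrier (HS (card J0) (card J1) n) \<Longrightarrow>
         \<exists>k\<in>gl_image n b. \<exists>c. u = k \<oplus>\<^bsub>HS (card J0) (card J1) n\<^esub> S c"
    and eigen: "\<And>t c. t \<in> torus r \<Longrightarrow>
      GL_act n (g t) (torus_act J0 J1 t (S c)) = S (\<lambda>i. char_val r (\<chi> i) t * c i)"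
    and \<chi>: "\<And>i. i \<in> I \<Longrightarrow> \<chi> i \<in> chars r" and I: "finite I"
  shows "Eu r (tangent_space (card J0) (card J1) n x) (tangent_act J0 J1 n x) = (\<Prod>i\<in>I. Eu_char r (\<chi> i))"
    and "Eu r (tangent_space (card J0) (card J1) n x)
        (twist r (tangent_space (card J0) (card J1) n x) \<mu> (tangent_act J0 J1 n x)) =
      (\<Prod>i\<in>I. Eu_char r \<mu> + Eu_char r (\<chi> i))"
proof -
  let ?U = "HS (card J0) (card J1) n" and ?K = "gl_image n b"
  let ?T = "tangent_space (card J0) (card J1) n x"
  interpret U: vectorspace CC ?U by (rule handsaw_vs)
  note sub = gl_image_subspace[OF b]
  have T: "?T = quot_module ?U ?K" by (simp add: tangent_space_def x)
  have vs: "vectorspace CC ?T" unfolding T by (rule quot_vectorspace[OF handsaw_vs sub])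
  have \<phi>: "coord_iso I ?T (\<lambda>c. ?K +>\<^bsub>?U\<^esub> S c)"
    unfolding T by (rule quot_coord_iso[OF handsaw_vs sub S])
  have Kcar: "?K \<subseteq> carrier ?U"
    using sub by (simp add: VectorSpace.subspace_def LinearCombinations.submodule_def)
  have act: "tangent_act J0 J1 n x t (?K +>\<^bsub>?U\<^esub> S c) = ?K +>\<^bsub>?U\<^esub> S (\<lambda>i. char_val r (\<chi> i) t * c i)"
    if t: "t \<in> torus r" for t c
  proof -
    define \<rho> where "\<rho> y = GL_act n (g t) (torus_act J0 J1 t y)" for y
    have add: "\<rho> (u \<oplus>\<^bsub>?U\<^esub> v) = \<rho> u \<oplus>\<^bsub>?U\<^esub> \<rho> v" if "u \<in> carrier ?U" "v \<in> carrier ?U" for u v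
      unfolding \<rho>_def torus_act_add[OF that]
      by (rule GL_act_add[OF g[OF t] torus_act_closed[OF that(1)] torus_act_closed[OF that(2)]])
    \<comment> \<open>The torus sends the orbit directions at \<open>b\<close> to those at its
      translate, and \<open>g t\<close> carries them back.\<close>
    have "torus_act J0 J1 t ` ?K = gl_image n (torus_act J0 J1 t b)"
      unfolding gl_image_eq image_image by (intro image_cong refl torus_act_gl_inf[OF _ b])
    moreover have "\<rho> ` ?K = GL_act n (g t) ` torus_act J0 J1 t ` ?K" by (simp add: \<rho>_def image_image)
    ultimately have K: "\<rho> ` ?K = ?K"
      using GL_act_gl_image[OF g[OF t] torus_act_closed[OF b]] fixed[OF t] by simp
    have fm: "fibre_mat J0 J1 n b t = g t"
      by (rule fibre_mat_eq[OF b g[OF t] fixed[OF t]]) (rule free)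
    have "tangent_act J0 J1 n x t (?K +>\<^bsub>?U\<^esub> S c) = \<rho> ` (?K +>\<^bsub>?U\<^esub> S c)"
      unfolding tangent_act_def x fm \<rho>_def by simp
    \<comment> \<open>The tangent action is by images, so the image of the coset is computed
      elementwise and then recognised as a coset of the same subspace \<open>?K\<close>.\<close>
    also have "\<dots> = (\<lambda>k. \<rho> k \<oplus>\<^bsub>?U\<^esub> \<rho> (S c)) ` ?K"
    proof -
      have "?K +>\<^bsub>?U\<^esub> S c = (\<lambda>k. k \<oplus>\<^bsub>?U\<^esub> S c) ` ?K" unfolding a_r_coset_def' by auto
      then show ?thesis using Kcar S(1) by (auto simp: image_image intro!: image_cong add)
    qed
    also have "\<dots> = (\<lambda>k. k \<oplus>\<^bsub>?U\<^esub> \<rho> (S c)) ` ?K"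
      by (subst (2) K[symmetric]) (simp add: image_image)
    also have "\<dots> = ?K +>\<^bsub>?U\<^esub> \<rho> (S c)" unfolding a_r_coset_def' by auto
    also have "\<rho> (S c) = S (\<lambda>i. char_val r (\<chi> i) t * c i)" unfolding \<rho>_def by (rule eigen[OF t])
    finally show ?thesis .
  qed
  show "Eu r ?T (tangent_act J0 J1 n x) = (\<Prod>i\<in>I. Eu_char r (\<chi> i))"
    by (rule Eu_coord[OF vs I \<phi> act \<chi>])
  show "Eu r ?T (twist r ?T \<mu> (tangent_act J0 J1 n x)) = (\<Prod>i\<in>I. Eu_char r \<mu> + Eu_char r (\<chi> i))"
    by (rule Eu_twist_coord[OF vs I \<phi> act])
qed

text \<open>The columns of \<open>h\<close> form an eigenbasis of the fibre, so multiplication by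
  \<open>h\<close> supplies the coordinates.\<close>

lemma fibre_Eu:
  assumes b: "b \<in> carrier (HS (card J0) (card J1) n)" and x: "repr x = b"
    and free: "\<And>h. h \<in> GL n \<Longrightarrow> GL_act n h b = b \<Longrightarrow> h = 1\<^sub>m n"
    and g: "\<And>t. t \<in> torus r \<Longrightarrow> g t \<in> GL n"
    and fixed: "\<And>t. t \<in> torus r \<Longrightarrow> GL_act n (g t) (torus_act J0 J1 t b) = b"
    and h: "h \<in> GL n"
    and diag: "\<And>t. t \<in> torus r \<Longrightarrow> g t * h = h * mat_diag n (\<lambda>s. char_val r (\<chi> s) t)"
  shows "Eu r (Cn n) (twist r (Cn n) \<mu> (fibre_act J0 J1 n x)) = (\<Prod>s<n. Eu_char r \<mu> + Eu_char r (\<chi> s))"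
proof (rule Eu_twist_coord)
  have hc: "h \<in> carrier_mat n n" using h by simp
  show "vectorspace CC (Cn n)" by (rule vec_vs)
  show "coord_iso {..<n} (Cn n) (\<lambda>c. h *\<^sub>v vec n c)"
    unfolding coord_iso_def
  proof (intro conjI allI)
    fix c d :: "nat \<Rightarrow> complex" and a :: complex
    show "h *\<^sub>v vec n c \<in> carrier (Cn n)" using hc by (simp add: module_vec_simps)
    have "vec n (\<lambda>i. c i + d i) = vec n c + vec n d" by auto
    then show "h *\<^sub>v vec n (\<lambda>i. c i + d i) = (h *\<^sub>v vec n c) \<oplus>\<^bsub>Cn n\<^esub> (h *\<^sub>v vec n d)"
      using hc by (simp add: module_vec_simps mult_add_distrib_mat_vec[of _ n n])
    have "vec n (\<lambda>i. a * c i) = a \<cdot>\<^sub>v vec n c" by auto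
    then show "h *\<^sub>v vec n (\<lambda>i. a * c i) = a \<odot>\<^bsub>Cn n\<^esub> (h *\<^sub>v vec n c)"
      using hc by (simp add: module_vec_simps mult_mat_vec[of _ n n])
    have "h *\<^sub>v vec n c = 0\<^sub>v n \<longleftrightarrow> vec n c = 0\<^sub>v n"
    proof
      assume "h *\<^sub>v vec n c = 0\<^sub>v n"
      then have "GL_inv n h *\<^sub>v (h *\<^sub>v vec n c) = GL_inv n h *\<^sub>v 0\<^sub>v n" by simp
      then show "vec n c = 0\<^sub>v n" using h GL_inv_carrier[OF h] by (simp add: mult_mat_zero_vec)
    qed (use hc in \<open>simp add: mult_mat_zero_vec\<close>)
    also have "\<dots> \<longleftrightarrow> (\<forall>i\<in>{..<n}. c i = 0)" by (auto simp: vec_eq_iff)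
    finally show "h *\<^sub>v vec n c = \<zero>\<^bsub>Cn n\<^esub> \<longleftrightarrow> (\<forall>i\<in>{..<n}. c i = 0)" by (simp add: module_vec_simps)
    show "carrier (Cn n) \<subseteq> range (\<lambda>c. h *\<^sub>v vec n c)"
    proof
      fix v assume "v \<in> carrier (Cn n)"
      then have v: "v \<in> carrier_vec n" by (simp add: module_vec_simps)
      then have "GL_inv n h *\<^sub>v v = vec n (\<lambda>i. (GL_inv n h *\<^sub>v v) $ i)"
        using GL_inv_carrier[OF h] by auto
      then have "v = h *\<^sub>v vec n (\<lambda>i. (GL_inv n h *\<^sub>v v) $ i)" using h v by simp
      then show "v \<in> range (\<lambda>c. h *\<^sub>v vec n c)" by blast
    qed
  qed
  fix t :: "nat \<Rightarrow> complex" and c :: "nat \<Rightarrow> complex" assume t: "t \<in> torus r"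
  have fm: "fibre_mat J0 J1 n b t = g t"
    by (rule fibre_mat_eq[OF b g[OF t] fixed[OF t]]) (rule free)
  have "fibre_act J0 J1 n x t (h *\<^sub>v vec n c) = g t *\<^sub>v (h *\<^sub>v vec n c)"
    unfolding fibre_act_def x fm by simp
  also have "\<dots> = (g t * h) *\<^sub>v vec n c"
    using g[OF t] hc by (intro assoc_mult_mat_vec[symmetric, of _ n n _ n]) auto
  also have "\<dots> = h *\<^sub>v (mat_diag n (\<lambda>s. char_val r (\<chi> s) t) *\<^sub>v vec n c)"
    unfolding diag[OF t] using hc by (intro assoc_mult_mat_vec[of _ n n _ n]) auto
  also have "mat_diag n (\<lambda>s. char_val r (\<chi> s) t) *\<^sub>v vec n c = vec n (\<lambda>s. char_val r (\<chi> s) t * c s)"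
    by (subst mat_diag_mult_vec) auto
  finally show "fibre_act J0 J1 n x t (h *\<^sub>v vec n c) = h *\<^sub>v vec n (\<lambda>s. char_val r (\<chi> s) t * c s)" .
qed simp


section \<open>The standard forms and their slices\<close>

lemma nth_sorted_bij:
  "finite J \<Longrightarrow> bij_betw (\<lambda>j. sorted_list_of_set J ! j) {..<card J} J"
  by (rule bij_betw_nth) auto

lemma mult_mat_unit_vec:
  fixes A :: "'a :: semiring_1 mat"
  assumes "A \<in> carrier_mat m n" "i < n"
  shows "A *\<^sub>v unit_vec n i = col A i"
  using assms by (intro eq_vecI) auto

lemma mat_eq_iff_cols:
  assumes "A \<in> carrier_mat m n" "B \<in> carrier_mat m n"
  shows "A = B \<longleftrightarrow> (\<forall>j<n. col A j = col B j)"
  using assms by (auto intro!: mat_col_eqI)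

text \<open>Each entry is scaled by a torus weight of its own; the invariance of the standard form
  and the weights of the slice are read off from these factors.\<close>

lemma diag_torus_act:
  assumes f: "\<And>i. i < n \<Longrightarrow> f i \<noteq> 0"
    and "B \<in> carrier_mat n n" "z \<in> carrier_mat n (card J0)" "w \<in> carrier_mat (card J1) n"
  shows "GL_act n (mat_diag n f) (torus_act J0 J1 t (B, z, w)) =
    (mat n n (\<lambda>(i, j). f i * t q_ix * inverse (f j) * B $$ (i, j)),
     mat n (card J0) (\<lambda>(i, j). f i * inverse (t (e_ix (sorted_list_of_set J0 ! j))) * z $$ (i, j)),
     mat (card J1) n (\<lambda>(i, j). t q_ix * t (e_ix (sorted_list_of_set J1 ! i)) * inverse (f j) * w $$ (i, j)))"
proof -
  have inv: "GL_inv n (mat_diag n f) = mat_diag n (\<lambda>i. inverse (f i))" by (rule mat_diag_GL(2)[OF f])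
  note c = assms(2-4)
  have 1: "mat_diag n f * (t q_ix \<cdot>\<^sub>m B) * mat_diag n (\<lambda>i. inverse (f i)) =
      mat n n (\<lambda>(i, j). f i * t q_ix * inverse (f j) * B $$ (i, j))"
    using c by (subst mat_diag_mult_left[of _ n n], simp, subst mat_diag_mult_right[of _ n n])
      (auto intro!: eq_matI)
  have 2: "mat_diag n f * (z * flavour_inv_mat J0 t) =
      mat n (card J0) (\<lambda>(i, j). f i * inverse (t (e_ix (sorted_list_of_set J0 ! j))) * z $$ (i, j))"
    unfolding flavour_inv_mat_def mat_diag_mult_right[OF c(2)]
    by (subst mat_diag_mult_left[of _ n "card J0"]) (auto intro!: eq_matI)
  have 3: "t q_ix \<cdot>\<^sub>m (flavour_mat J1 t * w) * mat_diag n (\<lambda>i. inverse (f i)) =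
      mat (card J1) n (\<lambda>(i, j). t q_ix * t (e_ix (sorted_list_of_set J1 ! i)) * inverse (f j) * w $$ (i, j))"
    unfolding flavour_mat_def mat_diag_mult_left[OF c(3)]
    by (subst mat_diag_mult_right[of _ "card J1" n]) (auto intro!: eq_matI)
  show ?thesis unfolding torus_act.simps GL_act.simps inv 1 2 3 by simp
qed

section \<open>Chains and the standard form\<close>

definition chains :: "nat set \<Rightarrow> (nat \<Rightarrow> nat) \<Rightarrow> (nat \<times> nat) set" where
  "chains J k = (SIGMA \<alpha>:J. {..<k \<alpha>})"

text \<open>Any enumeration serves, since it only labels the basis of \<open>V\<close> by matrix
  indices. Choosing it from \<open>J\<close> and \<open>k\<close> alone makes the standard form a
  function of the chain lengths.\<close>

definition chain_enum :: "nat set \<Rightarrow> (nat \<Rightarrow> nat) \<Rightarrow> nat \<Rightarrow> nat \<times> nat" where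
  "chain_enum J k = (SOME p. bij_betw p {..<sum k J} (chains J k))"

lemma chain_enum_bij: "finite J \<Longrightarrow> bij_betw (chain_enum J k) {..<sum k J} (chains J k)"
proof -
  assume J: "finite J"
  have "finite (chains J k)" "card (chains J k) = sum k J"
    using J by (auto simp: chains_def)
  then have "\<exists>p. bij_betw p {..<sum k J} (chains J k)"
    using ex_bij_betw_nat_finite[of "chains J k"] by (auto simp: atLeast0LessThan)
  then show ?thesis unfolding chain_enum_def by (rule someI_ex)
qed

text \<open>\<open>V\<close> has a basis \<open>v\<^sub>\<alpha>\<^sub>i\<close> with \<open>i < k \<alpha>\<close>, on which \<open>B v\<^sub>\<alpha>\<^sub>i = v\<^sub>\<alpha>\<^sub>,\<^sub>i\<^sub>+\<^sub>1\<close> (or \<open>0\<close> at the end of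
  the chain), \<open>z w\<^sub>\<alpha> = v\<^sub>\<alpha>\<^sub>0\<close> and \<open>w = 0\<close>.\<close>

definition std_form :: "nat set \<Rightarrow> nat set \<Rightarrow> (nat \<Rightarrow> nat) \<Rightarrow> handsaw" where
  "std_form J J' k =
    (let p = chain_enum J k; n = sum k J in
      (mat n n (\<lambda>(u, s). if p u = (fst (p s), Suc (snd (p s))) then 1 else 0),
       mat n (card J) (\<lambda>(u, j). if p u = (sorted_list_of_set J ! j, 0) then 1 else 0),
       0\<^sub>m (card J') n))"

text \<open>\<open>J\<close> holds the flavours whose chains span the space: \<open>J0\<close> for
  \<zeta> < 0 and, after dualising, \<open>J1\<close> for \<zeta> > 0. \<open>J'\<close> holds the
  remaining flavours.\<close>

locale chain_form =
  fixes J J' :: "nat set" and k :: "nat \<Rightarrow> nat"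
  assumes finJ: "finite J" and finJ': "finite J'" and disj: "J \<inter> J' = {}"
begin

definition n where "n = sum k J"
definition p where "p = chain_enum J k"
definition idx where "idx a = inv_into {..<n} p a"
definition J_nth where "J_nth j = sorted_list_of_set J ! j"
definition J'_nth where "J'_nth j = sorted_list_of_set J' ! j"
definition J_pos where "J_pos = inv_into {..<card J} J_nth"
definition J'_pos where "J'_pos = inv_into {..<card J'} J'_nth"
text \<open>The chain vectors, continued by zero past the end of a chain, so that
  \<open>std_B\<close> sends each one to the next without a case distinction.\<close>

definition E :: "nat \<times> nat \<Rightarrow> complex vec" where
  "E a = (if a \<in> chains J k then unit_vec n (idx a) else 0\<^sub>v n)"
definition std_B where "std_B = fst (std_form J J' k)"
definition std_z where "std_z = fst (snd (std_form J J' k))"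

lemma p_bij: "bij_betw p {..<n} (chains J k)"
  unfolding p_def n_def by (rule chain_enum_bij[OF finJ])

lemma p_chains [simp]: "s < n \<Longrightarrow> p s \<in> chains J k"
  using p_bij by (auto simp: bij_betw_def)

lemma idx_p [simp]: "s < n \<Longrightarrow> idx (p s) = s"
  using p_bij by (auto simp: idx_def bij_betw_def)

lemma p_idx [simp]: "a \<in> chains J k \<Longrightarrow> p (idx a) = a"
  unfolding idx_def using p_bij by (intro f_inv_into_f) (auto simp: bij_betw_def)

lemma idx_less [simp]: "a \<in> chains J k \<Longrightarrow> idx a < n"
  unfolding idx_def using p_bij inv_into_into[of a p "{..<n}"] by (auto simp: bij_betw_def)

lemma p_eq_iff: "s < n \<Longrightarrow> p s = a \<longleftrightarrow> a \<in> chains J k \<and> s = idx a"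
  by auto

lemma J_nth_pos [simp]: "\<alpha> \<in> J \<Longrightarrow> J_nth (J_pos \<alpha>) = \<alpha>" "\<alpha> \<in> J \<Longrightarrow> J_pos \<alpha> < card J"
  and J_nth_mem [simp]: "j < card J \<Longrightarrow> J_nth j \<in> J" "j < card J \<Longrightarrow> J_pos (J_nth j) = j"
  using nth_sorted_bij[OF finJ] inv_into_into[of \<alpha> J_nth "{..<card J}"]
  unfolding J_pos_def bij_betw_def J_nth_def[abs_def]
  by (auto intro: f_inv_into_f)

lemma J'_nth_pos [simp]: "\<alpha> \<in> J' \<Longrightarrow> J'_nth (J'_pos \<alpha>) = \<alpha>" "\<alpha> \<in> J' \<Longrightarrow> J'_pos \<alpha> < card J'"
  and J'_nth_mem [simp]: "j < card J' \<Longrightarrow> J'_nth j \<in> J'" "j < card J' \<Longrightarrow> J'_pos (J'_nth j) = j"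
  using nth_sorted_bij[OF finJ'] inv_into_into[of \<alpha> J'_nth "{..<card J'}"]
  unfolding J'_pos_def bij_betw_def J'_nth_def[abs_def]
  by (auto intro: f_inv_into_f)

lemma std_B_eq: "std_B = mat n n (\<lambda>(u, s). if p u = (fst (p s), Suc (snd (p s))) then 1 else 0)"
  by (simp add: std_B_def std_form_def Let_def p_def n_def)

lemma std_z_eq: "std_z = mat n (card J) (\<lambda>(u, j). if p u = (J_nth j, 0) then 1 else 0)"
  by (simp add: std_z_def std_form_def Let_def p_def n_def J_nth_def)

lemma std_form_eq: "std_form J J' k = (std_B, std_z, 0\<^sub>m (card J') n)"
  by (simp add: std_B_def std_z_def std_form_def Let_def n_def)

lemma std_carrier [simp]: "std_B \<in> carrier_mat n n" "std_z \<in> carrier_mat n (card J)"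
  by (simp_all add: std_B_eq std_z_eq)

lemma std_dim [simp]:
  "dim_row std_B = n" "dim_col std_B = n" "dim_row std_z = n" "dim_col std_z = card J"
  by (simp_all add: std_B_eq std_z_eq)

lemma std_B_zero [simp]: "std_B *\<^sub>v 0\<^sub>v n = 0\<^sub>v n"
  by (rule mult_mat_zero_vec) simp

lemma std_form_carrier: "std_form J J' k \<in> carrier (HS (card J) (card J') n)"
  by (simp add: std_form_eq)

lemma E_carrier [simp]: "E a \<in> carrier_vec n"
  by (simp add: E_def)

lemma col_std_B: "s < n \<Longrightarrow> col std_B s = E (fst (p s), Suc (snd (p s)))"
  by (intro eq_vecI) (auto simp: std_B_eq E_def p_eq_iff)

lemma col_std_z: "j < card J \<Longrightarrow> col std_z j = E (J_nth j, 0)"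
  by (intro eq_vecI) (auto simp: std_z_eq E_def p_eq_iff)

lemma mult_E:
  assumes "A \<in> carrier_mat m n"
  shows "A *\<^sub>v E a = (if a \<in> chains J k then col A (idx a) else 0\<^sub>v m)"
  using assms by (simp add: E_def mult_mat_unit_vec[OF assms] mult_mat_zero_vec[OF assms])

lemma std_B_E: "\<alpha> \<in> J \<Longrightarrow> std_B *\<^sub>v E (\<alpha>, i) = E (\<alpha>, Suc i)"
  by (auto simp: mult_E[OF std_carrier(1)] col_std_B) (auto simp: E_def chains_def)

lemma E_p: "s < n \<Longrightarrow> E (p s) = unit_vec n s"
  by (simp add: E_def)

lemma E_zero: "k \<alpha> \<le> i \<Longrightarrow> E (\<alpha>, i) = 0\<^sub>v n"
  by (simp add: E_def chains_def)

lemma col_mult_std: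
  assumes "\<xi> \<in> carrier_mat n n"
  shows "s < n \<Longrightarrow> col (\<xi> * std_B) s = \<xi> *\<^sub>v E (fst (p s), Suc (snd (p s)))"
    and "s < n \<Longrightarrow> col (std_B * \<xi>) s = std_B *\<^sub>v col \<xi> s"
    and "j < card J \<Longrightarrow> col (\<xi> * std_z) j = \<xi> *\<^sub>v E (J_nth j, 0)"
  using col_mult2[OF assms std_carrier(1), of s] col_mult2[OF std_carrier(1) assms, of s]
    col_mult2[OF assms std_carrier(2), of j]
  by (simp_all add: col_std_B col_std_z)

text \<open>A coordinate is a pair (u, \<beta>) of a matrix index of \<open>V\<close> and a flavour.
  A flavour in \<open>J\<close> owns one column, of \<open>B\<close> or, for an empty chain, of
  \<open>z\<close>; a flavour in \<open>J'\<close> owns a row of \<open>w\<close>. Either way it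
  owns exactly \<open>n\<close> coordinates.\<close>

definition slice_B :: "(nat \<times> nat \<Rightarrow> complex) \<Rightarrow> complex mat" where
  "slice_B c = mat n n (\<lambda>(u, s). if Suc (snd (p s)) = k (fst (p s)) then c (u, fst (p s)) else 0)"
definition slice_z :: "(nat \<times> nat \<Rightarrow> complex) \<Rightarrow> complex mat" where
  "slice_z c = mat n (card J) (\<lambda>(u, j). if k (J_nth j) = 0 then c (u, J_nth j) else 0)"
definition slice_w :: "(nat \<times> nat \<Rightarrow> complex) \<Rightarrow> complex mat" where
  "slice_w c = mat (card J') n (\<lambda>(j, u). c (u, J'_nth j))"
definition slice :: "(nat \<times> nat \<Rightarrow> complex) \<Rightarrow> handsaw" where
  "slice c = (slice_B c, slice_z c, slice_w c)"

lemma slice_carrier [simp]: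
  "slice_B c \<in> carrier_mat n n" "slice_z c \<in> carrier_mat n (card J)" "slice_w c \<in> carrier_mat (card J') n"
  by (simp_all add: slice_B_def slice_z_def slice_w_def)

lemma slice_dim [simp]:
  "dim_row (slice_B c) = n" "dim_col (slice_B c) = n" "dim_row (slice_z c) = n" "dim_col (slice_z c) = card J"
  "dim_row (slice_w c) = card J'" "dim_col (slice_w c) = n"
  by (simp_all add: slice_B_def slice_z_def slice_w_def)

lemma slice_closed: "slice c \<in> carrier (HS (card J) (card J') n)"
  by (simp add: slice_def)

lemma slice_add: "slice (\<lambda>i. c i + d i) = slice c \<oplus>\<^bsub>HS (card J) (card J') n\<^esub> slice d"
  by (auto simp: slice_def slice_B_def slice_z_def slice_w_def intro!: eq_matI)

lemma slice_smult: "slice (\<lambda>i. a * c i) = a \<odot>\<^bsub>HS (card J) (card J') n\<^esub> slice c"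
  by (auto simp: slice_def slice_B_def slice_z_def slice_w_def intro!: eq_matI)

text \<open>The columns of \<open>\<xi>\<close> are determined by recursion along the chains: the condition on \<open>z\<close> fixes
  \<open>\<xi> v\<^sub>\<alpha>\<^sub>0\<close>, and the condition on \<open>B\<close> fixes \<open>\<xi> v\<^sub>\<alpha>\<^sub>,\<^sub>i\<^sub>+\<^sub>1\<close> in terms of \<open>\<xi> v\<^sub>\<alpha>\<^sub>i\<close>.  What is left
  over at the ends of the chains is absorbed by the slice.\<close>

lemma slice_decomp:
  assumes "u \<in> carrier (HS (card J) (card J') n)"
  shows "\<exists>v\<in>gl_image n (std_form J J' k). \<exists>c. u = v \<oplus>\<^bsub>HS (card J) (card J') n\<^esub> slice c"
proof -
  obtain B' z' w' where u: "u = (B', z', w')" by (cases u)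
  have car: "B' \<in> carrier_mat n n" "z' \<in> carrier_mat n (card J)" "w' \<in> carrier_mat (card J') n"
    using assms u by auto
  define f where "f \<alpha> = rec_nat (col z' (J_pos \<alpha>)) (\<lambda>i v. col B' (idx (\<alpha>, i)) + std_B *\<^sub>v v)" for \<alpha>
  define \<xi> where "\<xi> = mat n n (\<lambda>(i, s). f (fst (p s)) (snd (p s)) $ i)"
  have \<xi>: "\<xi> \<in> carrier_mat n n" by (simp add: \<xi>_def)
  have fcar: "f \<alpha> i \<in> carrier_vec n" if "(\<alpha>, i) \<in> chains J k" for \<alpha> i
    using that
  proof (induction i)
    case 0
    then show ?case using col_carrier_vec[OF _ car(2), of "J_pos \<alpha>"] by (simp add: f_def chains_def)
  next
    case (Suc i)
    then have i: "(\<alpha>, i) \<in> chains J k" by (auto simp: chains_def)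
    have "std_B *\<^sub>v f \<alpha> i \<in> carrier_vec n" using Suc.IH[OF i] std_carrier(1) by (rule mult_mat_vec_carrier[rotated])
    moreover have "col B' (idx (\<alpha>, i)) \<in> carrier_vec n" using idx_less[OF i] car by simp
    ultimately show ?case by (simp add: f_def)
  qed
  have \<xi>E: "\<xi> *\<^sub>v E a = f (fst a) (snd a)" if "a \<in> chains J k" for a
    using that fcar[of "fst a" "snd a"] unfolding mult_E[OF \<xi>]
    by (auto simp: \<xi>_def intro!: eq_vecI)
  \<comment> \<open>The remainders of the three equations: all of \<open>w'\<close>, because the
    standard form has \<open>w = 0\<close>; the column of \<open>z'\<close> for an empty chain;
    otherwise the error of the equation for \<open>B\<close> at the last chain position
    \<open>k \<beta> - 1\<close>.\<close>
  define c where "c = (\<lambda>(i, \<beta>). if \<beta> \<in> J' then w' $$ (J'_pos \<beta>, i)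
    else if k \<beta> = 0 then z' $$ (i, J_pos \<beta>)
    else (B' - (\<xi> * std_B - std_B * \<xi>)) $$ (i, idx (\<beta>, k \<beta> - 1)))"
  have w: "w' = - (0\<^sub>m (card J') n * \<xi>) + slice_w c"
    using car \<xi> by (auto simp: slice_w_def c_def intro!: eq_matI)
  have z: "z' = \<xi> * std_z + slice_z c"
  proof (subst mat_eq_iff_cols[of _ n "card J"], goal_cases)
    case 3
    show ?case
    proof (intro allI impI)
      fix j assume j: "j < card J"
      have notJ': "J_nth j \<notin> J'" using disj J_nth_mem(1)[OF j] by blast
      have 1: "col (\<xi> * std_z + slice_z c) j = \<xi> *\<^sub>v E (J_nth j, 0) + col (slice_z c) j"
        unfolding col_mult_std(3)[OF \<xi> j, symmetric]
        using j \<xi> by (intro col_add[of _ n "card J"]) auto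
      show "col z' j = col (\<xi> * std_z + slice_z c) j"
      proof (cases "k (J_nth j) = 0")
        case True
        then have "\<xi> *\<^sub>v E (J_nth j, 0) = 0\<^sub>v n" using \<xi> by (simp add: E_zero mult_mat_zero_vec)
        moreover have "col (slice_z c) j = col z' j"
          using True j car notJ' by (intro eq_vecI) (auto simp: slice_z_def c_def)
        ultimately show ?thesis unfolding 1 using car j by simp
      next
        case False
        then have "(J_nth j, 0) \<in> chains J k" using j by (auto simp: chains_def)
        then have "\<xi> *\<^sub>v E (J_nth j, 0) = col z' j" using \<xi>E j by (simp add: f_def)
        moreover have "col (slice_z c) j = 0\<^sub>v n"
          using False j by (intro eq_vecI) (auto simp: slice_z_def)
        ultimately show ?thesis unfolding 1 using car j by simp
      qed
    qed
  qed (use car \<xi> in auto)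
  have B: "B' = \<xi> * std_B - std_B * \<xi> + slice_B c"
  proof (subst mat_eq_iff_cols[of _ n n], goal_cases)
    case 3
    show ?case
    proof (intro allI impI)
      fix s assume s: "s < n"
      obtain \<alpha> i where ps: "p s = (\<alpha>, i)" by (cases "p s")
      then have ch: "(\<alpha>, i) \<in> chains J k" using p_chains[OF s] by simp
      then have \<alpha>: "\<alpha> \<in> J" "i < k \<alpha>" "\<alpha> \<notin> J'" using disj by (auto simp: chains_def)
      have idx_s: "idx (\<alpha>, i) = s" using ps s idx_p by metis
      \<comment> \<open>At the end of a chain the equation holds by the choice of \<open>c\<close>;
        elsewhere it is the recursion that defines \<open>f\<close>.\<close>
      show "col B' s = col (\<xi> * std_B - std_B * \<xi> + slice_B c) s"
      proof (cases "Suc i = k \<alpha>")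
        case True
        show ?thesis
        proof (rule eq_vecI)
          fix u assume "u < dim_vec (col (\<xi> * std_B - std_B * \<xi> + slice_B c) s)"
          then have "u < n" using \<xi> by simp
          moreover have "k \<alpha> - 1 = i" "k \<alpha> \<noteq> 0" using True by auto
          ultimately show "col B' s $ u = col (\<xi> * std_B - std_B * \<xi> + slice_B c) s $ u"
            using s True \<alpha> ps idx_s \<xi> car by (simp add: slice_B_def c_def del: index_mult_mat(1))
        qed (use car \<xi> in simp)
      next
        case False
        then have ch': "(\<alpha>, Suc i) \<in> chains J k" using \<alpha> by (auto simp: chains_def)
        have "col (\<xi> * std_B) s = f \<alpha> (Suc i)"
          using \<xi> s \<xi>E[OF ch'] by (simp add: col_mult_std ps)
        also have "\<dots> = col B' s + std_B *\<^sub>v f \<alpha> i" by (simp add: f_def idx_s)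
        also have "f \<alpha> i = col \<xi> s"
          using \<xi>E[OF ch] ch idx_s by (simp add: mult_E[OF \<xi>])
        also have "std_B *\<^sub>v col \<xi> s = col (std_B * \<xi>) s" using \<xi> s by (simp add: col_mult_std)
        finally have 1: "col (\<xi> * std_B) s = col B' s + col (std_B * \<xi>) s" .
        show ?thesis
        proof (rule eq_vecI)
          fix u assume "u < dim_vec (col (\<xi> * std_B - std_B * \<xi> + slice_B c) s)"
          then have u: "u < n" using \<xi> by simp
          have "(\<xi> * std_B) $$ (u, s) = B' $$ (u, s) + (std_B * \<xi>) $$ (u, s)"
            using arg_cong[OF 1, of "\<lambda>v. v $ u"] u s car \<xi> by (simp del: index_mult_mat(1) col_mult2)
          then show "col B' s $ u = col (\<xi> * std_B - std_B * \<xi> + slice_B c) s $ u"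
            using u s False ps \<xi> car by (simp add: slice_B_def del: index_mult_mat(1))
        qed (use car \<xi> in simp)
      qed
    qed
  qed (use car \<xi> in auto)
  have "u = gl_inf \<xi> (std_form J J' k) \<oplus>\<^bsub>HS (card J) (card J') n\<^esub> slice c"
    unfolding u std_form_eq gl_inf.simps slice_def handsaw_ops(1) using B z w by simp
  then show ?thesis using \<xi> unfolding gl_image_eq by blast
qed

text \<open>Away from the chain ends the slice is zero, so the recursion for the columns of
  \<open>\<xi>\<close> runs with zero data and gives \<open>\<xi> = 0\<close> on all chains. Then
  the equations at the ends force the slice to vanish as well.\<close>

lemma slice_in_gl_image:
  "slice c \<in> gl_image n (std_form J J' k) \<longleftrightarrow> (\<forall>i\<in>{..<n} \<times> (J \<union> J'). c i = 0)"
proof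
  assume 0: "\<forall>i\<in>{..<n} \<times> (J \<union> J'). c i = 0"
  have "fst (p s) \<in> J" if "s < n" for s using p_chains[OF that] by (auto simp: chains_def)
  then have "slice c = (0\<^sub>m n n, 0\<^sub>m n (card J), 0\<^sub>m (card J') n)"
    unfolding slice_def using 0
    by (auto simp: slice_B_def slice_z_def slice_w_def intro!: eq_matI)
  also have "\<dots> = gl_inf (0\<^sub>m n n) (std_form J J' k)"
    unfolding std_form_eq gl_inf.simps left_mult_zero_mat[OF std_carrier(1)] left_mult_zero_mat[OF std_carrier(2)]
      right_mult_zero_mat[OF std_carrier(1)] right_mult_zero_mat[OF zero_carrier_mat]
    by (auto intro!: eq_matI)
  finally have "slice c = gl_inf (0\<^sub>m n n) (std_form J J' k)" .
  then show "slice c \<in> gl_image n (std_form J J' k)" unfolding gl_image_eq by (metis imageI zero_carrier_mat)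
next
  assume "slice c \<in> gl_image n (std_form J J' k)"
  then obtain \<xi> where \<xi>: "\<xi> \<in> carrier_mat n n" and eq: "slice c = gl_inf \<xi> (std_form J J' k)"
    by (auto simp: gl_image_eq)
  have B: "slice_B c = \<xi> * std_B - std_B * \<xi>" and z: "slice_z c = \<xi> * std_z"
    and w: "slice_w c = - (0\<^sub>m (card J') n * \<xi>)"
    using eq unfolding slice_def std_form_eq by simp_all
  have zE: "col (slice_z c) j = \<xi> *\<^sub>v E (J_nth j, 0)" if "j < card J" for j
    unfolding z using that \<xi> by (simp add: col_mult_std)
  have BE: "\<xi> *\<^sub>v E (\<alpha>, Suc i) = col (slice_B c) (idx (\<alpha>, i)) + std_B *\<^sub>v (\<xi> *\<^sub>v E (\<alpha>, i))"
    if "(\<alpha>, i) \<in> chains J k" for \<alpha> i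
  proof -
    let ?s = "idx (\<alpha>, i)"
    have s: "?s < n" "p ?s = (\<alpha>, i)" using that by auto
    have "col (slice_B c) ?s = col (\<xi> * std_B) ?s - col (std_B * \<xi>) ?s"
      unfolding B using s \<xi> carrier_matD[OF std_carrier(1)]
      by (intro eq_vecI) (auto simp del: index_mult_mat(1) col_mult2)
    also have "col (\<xi> * std_B) ?s = \<xi> *\<^sub>v E (\<alpha>, Suc i)" using \<xi> s by (simp add: col_mult_std)
    also have "col (std_B * \<xi>) ?s = std_B *\<^sub>v (\<xi> *\<^sub>v E (\<alpha>, i))"
      using \<xi> s that by (simp add: col_mult_std mult_E)
    finally show ?thesis
    proof -
      assume a: "col (slice_B c) ?s = \<xi> *\<^sub>v E (\<alpha>, Suc i) - std_B *\<^sub>v (\<xi> *\<^sub>v E (\<alpha>, i))"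
      have "\<xi> *\<^sub>v E (\<alpha>, Suc i) \<in> carrier_vec n" "std_B *\<^sub>v (\<xi> *\<^sub>v E (\<alpha>, i)) \<in> carrier_vec n"
        using \<xi> by (meson E_carrier mult_mat_vec_carrier std_carrier(1))+
      moreover have "x = (x - y) + y" if "x \<in> carrier_vec n" "y \<in> carrier_vec n" for x y :: "complex vec"
        using that by (intro eq_vecI) auto
      ultimately show ?thesis unfolding a by blast
    qed
  qed
  have zero: "\<xi> *\<^sub>v E (\<alpha>, i) = 0\<^sub>v n" if "\<alpha> \<in> J" "i < k \<alpha>" for \<alpha> i
    using that(2)
  proof (induction i)
    case 0
    have "col (slice_z c) (J_pos \<alpha>) = 0\<^sub>v n"
      using 0 that(1) by (intro eq_vecI) (auto simp: slice_z_def)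
    then show ?case using zE[of "J_pos \<alpha>"] that(1) by simp
  next
    case (Suc i)
    have ch: "(\<alpha>, i) \<in> chains J k" using Suc that by (auto simp: chains_def)
    have "col (slice_B c) (idx (\<alpha>, i)) = 0\<^sub>v n"
      using Suc ch by (intro eq_vecI) (auto simp: slice_B_def)
    then show ?case unfolding BE[OF ch] using Suc by simp
  qed
  show "\<forall>i\<in>{..<n} \<times> (J \<union> J'). c i = 0"
  proof (intro ballI)
    fix x assume "x \<in> {..<n} \<times> (J \<union> J')"
    then obtain u \<beta> where x: "x = (u, \<beta>)" "u < n" "\<beta> \<in> J \<or> \<beta> \<in> J'" by auto
    show "c x = 0"
    proof (cases "\<beta> \<in> J'")
      case True
      have "c (u, \<beta>) = slice_w c $$ (J'_pos \<beta>, u)" using True x by (simp add: slice_w_def)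
      then show ?thesis unfolding w using True x \<xi> by simp
    next
      case False
      then have \<beta>: "\<beta> \<in> J" using x by simp
      show ?thesis
      proof (cases "k \<beta> = 0")
        case True
        have "c (u, \<beta>) = col (slice_z c) (J_pos \<beta>) $ u" using True \<beta> x by (simp add: slice_z_def)
        then show ?thesis unfolding zE[OF J_nth_pos(2)[OF \<beta>]] using True \<beta> x \<xi> by (simp add: E_zero mult_mat_zero_vec)
      next
        case False
        then have ch: "(\<beta>, k \<beta> - 1) \<in> chains J k" using \<beta> by (auto simp: chains_def)
        \<comment> \<open>One position past the end \<open>E\<close> is zero, so nothing is left of
          the last equation but the column of the slice.\<close>
        have "\<xi> *\<^sub>v E (\<beta>, Suc (k \<beta> - 1)) = 0\<^sub>v n" using \<xi> False by (simp add: E_zero mult_mat_zero_vec)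
        then have "col (slice_B c) (idx (\<beta>, k \<beta> - 1)) = 0\<^sub>v n"
          unfolding BE[OF ch] using zero[of \<beta> "k \<beta> - 1"] \<beta> False
            right_zero_vec[OF col_carrier_vec[OF idx_less[OF ch] slice_carrier(1)[of c]]] by simp
        moreover have "c (u, \<beta>) = col (slice_B c) (idx (\<beta>, k \<beta> - 1)) $ u"
          using ch False x by (simp add: slice_B_def)
        ultimately show ?thesis using x by simp
      qed
    qed
  qed
qed

text \<open>The weight of a chain vector: \<open>z\<close> is equivariant and gives the start of the
  chain the flavour weight, and each application of B : V -> V tensored with q lowers the power of q
  by one.\<close>

definition lam :: "(nat \<Rightarrow> complex) \<Rightarrow> nat \<Rightarrow> complex" where
  "lam t s = t (e_ix (fst (p s))) * inverse (t q_ix) ^ snd (p s)"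

text \<open>An entry of \<open>B\<close> has weight q times \<open>lam\<close> of its row over
  \<open>lam\<close> of its column. The last column of a chain sits at position
  \<open>k - 1\<close>, which makes the total power of q coming from the column equal to
  \<open>k\<close>. For \<open>k = 0\<close> the same formula is the weight of an entry of
  \<open>z\<close>.\<close>

definition slice_weight :: "(nat \<Rightarrow> complex) \<Rightarrow> nat \<times> nat \<Rightarrow> complex" where
  "slice_weight t x = (if snd x \<in> J then lam t (fst x) * inverse (t (e_ix (snd x))) * t q_ix ^ k (snd x)
     else t q_ix * t (e_ix (snd x)) * inverse (lam t (fst x)))"

context
  fixes t :: "nat \<Rightarrow> complex"
  assumes q: "t q_ix \<noteq> 0" and e: "\<And>\<alpha>. \<alpha> \<in> J \<Longrightarrow> t (e_ix \<alpha>) \<noteq> 0"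
begin

lemma lam_nonzero: "s < n \<Longrightarrow> lam t s \<noteq> 0"
  using q e p_chains[of s] by (auto simp: lam_def chains_def)

lemma std_form_fixed: "GL_act n (mat_diag n (lam t)) (torus_act J J' t (std_form J J' k)) = std_form J J' k"
proof -
  have 1: "lam t u * t q_ix * inverse (lam t s) = 1"
    if "u < n" "s < n" "p u = (fst (p s), Suc (snd (p s)))" for u s
    using that q e p_chains[of s] by (auto simp: lam_def chains_def field_simps)
  have 2: "lam t u * inverse (t (e_ix \<alpha>)) = 1" if "u < n" "p u = (\<alpha>, 0)" for u \<alpha>
    using that e p_chains[of u] by (auto simp: lam_def chains_def)
  have B: "mat n n (\<lambda>(i, j). lam t i * t q_ix * inverse (lam t j) * std_B $$ (i, j)) = std_B"
    by (rule eq_matI) (auto simp: std_B_eq 1)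
  have z: "mat n (card J) (\<lambda>(i, j). lam t i * inverse (t (e_ix (sorted_list_of_set J ! j))) * std_z $$ (i, j)) = std_z"
    by (rule eq_matI) (auto simp: std_z_eq J_nth_def 2)
  show ?thesis unfolding std_form_eq
    by (subst diag_torus_act) (use B z in \<open>auto simp: lam_nonzero intro!: eq_matI\<close>)
qed

lemma slice_eigen:
  "GL_act n (mat_diag n (lam t)) (torus_act J J' t (slice c)) = slice (\<lambda>x. slice_weight t x * c x)"
proof -
  have "lam t u * t q_ix * inverse (lam t s) = slice_weight t (u, fst (p s))"
    if "u < n" "s < n" "Suc (snd (p s)) = k (fst (p s))" for u s
  proof -
    have "fst (p s) \<in> J" using p_chains[of s] that by (auto simp: chains_def)
    moreover have "inverse (lam t s) = inverse (t (e_ix (fst (p s)))) * t q_ix ^ snd (p s)"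
      by (simp add: lam_def power_inverse)
    ultimately show ?thesis unfolding slice_weight_def by (simp add: that(3)[symmetric] mult_ac)
  qed
  then have B: "mat n n (\<lambda>(i, j). lam t i * t q_ix * inverse (lam t j) * slice_B c $$ (i, j))
      = slice_B (\<lambda>x. slice_weight t x * c x)"
    by (intro eq_matI) (auto simp: slice_B_def)
  have z: "mat n (card J) (\<lambda>(i, j). lam t i * inverse (t (e_ix (sorted_list_of_set J ! j))) * slice_z c $$ (i, j))
      = slice_z (\<lambda>x. slice_weight t x * c x)"
    by (intro eq_matI) (auto simp: slice_z_def slice_weight_def J_nth_def[symmetric])
  have "J'_nth j \<notin> J" if "j < card J'" for j using disj J'_nth_mem(1)[OF that] by blast
  then have w: "mat (card J') n (\<lambda>(i, j). t q_ix * t (e_ix (sorted_list_of_set J' ! i)) * inverse (lam t j) * slice_w c $$ (i, j))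
      = slice_w (\<lambda>x. slice_weight t x * c x)"
    by (intro eq_matI) (auto simp: slice_w_def slice_weight_def J'_nth_def[symmetric])
  show ?thesis unfolding slice_def
    by (subst diag_torus_act) (use B z w in \<open>auto simp: lam_nonzero\<close>)
qed

end

end


section \<open>Stability\<close>

definition krylov :: "complex mat \<Rightarrow> complex mat \<Rightarrow> nat \<Rightarrow> nat \<Rightarrow> complex vec" where
  "krylov B z j i = ((*\<^sub>v) B ^^ i) (col z j)"

lemma krylov_simps [simp]: "krylov B z j 0 = col z j" "krylov B z j (Suc i) = B *\<^sub>v krylov B z j i"
  by (simp_all add: krylov_def)

lemma krylov_carrier [simp]:
  assumes "B \<in> carrier_mat n n" "z \<in> carrier_mat n m" "j < m"
  shows "krylov B z j i \<in> carrier_vec n"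
  using assms by (induction i) (auto intro: col_carrier_vec mult_mat_vec_carrier)

text \<open>The columns of \<open>z\<close> generate \<open>V\<close> under \<open>B\<close>, in the form that no linear functional other
  than zero vanishes on all \<open>B\<^sup>i z\<^sub>j\<close>.\<close>

fun generating :: "nat \<Rightarrow> handsaw \<Rightarrow> bool" where
  "generating n (B, z, w) \<longleftrightarrow>
     (\<forall>y\<in>carrier_vec n. (\<forall>j<dim_col z. \<forall>i. y \<bullet> krylov B z j i = 0) \<longrightarrow> y = 0\<^sub>v n)"

lemma subspace_CnI:
  assumes "P \<subseteq> carrier_vec n" "0\<^sub>v n \<in> P" "\<And>u v. u \<in> P \<Longrightarrow> v \<in> P \<Longrightarrow> u + v \<in> P"
    "\<And>c v. v \<in> P \<Longrightarrow> c \<cdot>\<^sub>v v \<in> P"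
  shows "VectorSpace.subspace CC P (Cn n)"
proof -
  interpret V: vectorspace CC "Cn n" by (rule vec_vs)
  show ?thesis using assms V.module_axioms V.vectorspace_axioms
    by (simp add: VectorSpace.subspace_def LinearCombinations.submodule_def module_vec_simps)
qed

lemma subspace_CnD:
  assumes "VectorSpace.subspace CC P (Cn n)"
  shows "P \<subseteq> carrier_vec n" "0\<^sub>v n \<in> P" "u \<in> P \<Longrightarrow> v \<in> P \<Longrightarrow> u + v \<in> P" "v \<in> P \<Longrightarrow> c \<cdot>\<^sub>v v \<in> P"
  using assms by (simp_all add: VectorSpace.subspace_def LinearCombinations.submodule_def module_vec_simps)

lemma Cn_fin_dim: "vectorspace.fin_dim CC (Cn n)"
proof -
  interpret V: vec_space "TYPE(complex)" n .
  show ?thesis by (rule V.fin_dim)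
qed

lemma zero_vecI_scalar_prod:
  fixes y :: "complex vec"
  assumes "y \<in> carrier_vec n" "\<And>v. v \<in> carrier_vec n \<Longrightarrow> y \<bullet> v = 0"
  shows "y = 0\<^sub>v n"
proof (rule eq_vecI)
  fix i assume "i < dim_vec (0\<^sub>v n :: complex vec)"
  then show "y $ i = 0\<^sub>v n $ i" using assms(2)[of "unit_vec n i"] assms(1) by simp
qed (use assms in simp)

text \<open>\<open>P\<close> is the double annihilator of the Krylov vectors. It is invariant and
  contains the image of \<open>z\<close>, while for negative \<zeta> the required inequality cannot
  hold for a proper subspace; so \<open>P\<close> is everything and the annihilator \<open>Y\<close>
  is zero.\<close>

lemma stable_neg_generating:
  assumes "\<zeta> < 0" and b: "b \<in> carrier (HS r0 r1 n)" and st: "handsaw_stable r0 n \<zeta> b"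
  shows "generating n b"
proof -
  obtain B z w where bb: "b = (B, z, w)" by (cases b)
  have c: "B \<in> carrier_mat n n" "z \<in> carrier_mat n r0" using b bb by auto
  define Y where "Y = {y \<in> carrier_vec n. \<forall>j<r0. \<forall>i. y \<bullet> krylov B z j i = 0}"
  define P where "P = {v \<in> carrier_vec n. \<forall>y\<in>Y. y \<bullet> v = 0}"
  have Ycar: "y \<in> carrier_vec n" if "y \<in> Y" for y using that by (simp add: Y_def)
  have sub: "VectorSpace.subspace CC P (Cn n)"
    by (rule subspace_CnI) (use Ycar in \<open>auto simp: P_def scalar_prod_add_distrib[of _ n]\<close>)
  have YB: "transpose_mat B *\<^sub>v y \<in> Y" if "y \<in> Y" for y
  proof -
    have "(transpose_mat B *\<^sub>v y) \<bullet> krylov B z j i = 0" if "j < r0" for j i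
    proof -
      have "(transpose_mat B *\<^sub>v y) \<bullet> krylov B z j i = y \<bullet> krylov B z j (Suc i)"
        using transpose_vec_mult_scalar[OF c(1) krylov_carrier[OF c that, of i] Ycar[OF \<open>y \<in> Y\<close>]] by simp
      also have "\<dots> = 0" using \<open>y \<in> Y\<close> that unfolding Y_def by blast
      finally show ?thesis .
    qed
    moreover have "transpose_mat B *\<^sub>v y \<in> carrier_vec n"
      using c Ycar[OF that] by (intro mult_mat_vec_carrier[of _ n n]) auto
    ultimately show ?thesis by (simp add: Y_def)
  qed
  have inv: "(\<lambda>v. B *\<^sub>v v) ` P \<subseteq> P"
  proof (rule image_subsetI)
    fix v assume v: "v \<in> P"
    then have vc: "v \<in> carrier_vec n" by (simp add: P_def)
    have "y \<bullet> (B *\<^sub>v v) = 0" if "y \<in> Y" for y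
      using transpose_vec_mult_scalar[OF c(1) vc Ycar[OF that]] YB[OF that] v by (simp add: P_def)
    then show "B *\<^sub>v v \<in> P" using c vc by (auto simp: P_def intro: mult_mat_vec_carrier)
  qed
  have im: "(\<lambda>u. z *\<^sub>v u) ` carrier_vec r0 \<subseteq> P"
  proof (rule image_subsetI)
    fix u :: "complex vec" assume u: "u \<in> carrier_vec r0"
    have "y \<bullet> (z *\<^sub>v u) = 0" if "y \<in> Y" for y
    proof -
      have "transpose_mat z *\<^sub>v y = 0\<^sub>v r0"
      proof (rule eq_vecI)
        fix j assume "j < dim_vec (0\<^sub>v r0 :: complex vec)"
        then have j: "j < r0" by simp
        have "y \<bullet> krylov B z j 0 = 0" using that j unfolding Y_def by blast
        then show "(transpose_mat z *\<^sub>v y) $ j = 0\<^sub>v r0 $ j"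
          using j c Ycar[OF that] comm_scalar_prod[of "col z j" n y] col_carrier_vec[OF j c(2)] by simp
      qed (use c in simp)
      then show ?thesis
        using transpose_vec_mult_scalar[OF c(2) u Ycar[OF that]] u by simp
    qed
    then show "z *\<^sub>v u \<in> P" using c u by (auto simp: P_def intro: mult_mat_vec_carrier)
  qed
  have "P = carrier_vec n"
  proof (rule ccontr)
    assume "P \<noteq> carrier_vec n"
    then have "\<zeta> * real (vdim (quot_module (Cn n) P)) > 0"
      using st sub inv im unfolding bb handsaw_stable.simps by blast
    then show False using \<open>\<zeta> < 0\<close> by (simp add: zero_less_mult_iff)
  qed
  then have "y = 0\<^sub>v n" if "y \<in> Y" for y
    using zero_vecI_scalar_prod[OF Ycar[OF that]] that by (auto simp: P_def)
  then show ?thesis using c unfolding bb by (auto simp: Y_def)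
qed

text \<open>Adjointness moves one application of \<open>B\<close> from the Krylov vector to
  \<open>v\<close>, which is the step of every induction on the power of \<open>B\<close>.\<close>

lemma krylov_transpose:
  assumes B: "B \<in> carrier_mat n n" and z: "z \<in> carrier_mat n m" "j < m" and v: "v \<in> carrier_vec n"
  shows "v \<bullet> krylov (transpose_mat B) z j (Suc i) = (B *\<^sub>v v) \<bullet> krylov (transpose_mat B) z j i"
  using transpose_vec_mult_scalar[of "transpose_mat B" n n "krylov (transpose_mat B) z j i" v] assms
  by simp

text \<open>The vectors killed by all functionals w_j B^i form an invariant subspace of the kernel
  of \<open>w\<close>. For positive \<zeta> no dimension satisfies the required inequality, so this
  subspace is zero.\<close>

lemma stable_pos_generating:
  assumes "\<zeta> > 0" and b: "b \<in> carrier (HS r0 r1 n)" and st: "handsaw_stable r0 n \<zeta> b"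
  shows "generating n (dual b)"
proof -
  obtain B z w where bb: "b = (B, z, w)" by (cases b)
  have c: "B \<in> carrier_mat n n" "w \<in> carrier_mat r1 n" using b bb by auto
  have wT: "transpose_mat w \<in> carrier_mat n r1" using c by simp
  define P where "P = {v \<in> carrier_vec n. \<forall>j<r1. \<forall>i. v \<bullet> krylov (transpose_mat B) (transpose_mat w) j i = 0}"
  have kc: "krylov (transpose_mat B) (transpose_mat w) j i \<in> carrier_vec n" if "j < r1" for j i
    by (rule krylov_carrier[OF _ wT that]) (use c in simp)
  have sub: "VectorSpace.subspace CC P (Cn n)"
    by (rule subspace_CnI) (use kc in \<open>auto simp: P_def add_scalar_prod_distrib[of _ n]\<close>)
  have inv: "(\<lambda>v. B *\<^sub>v v) ` P \<subseteq> P"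
  proof (rule image_subsetI)
    fix v assume v: "v \<in> P"
    then have vc: "v \<in> carrier_vec n" by (simp add: P_def)
    have "(B *\<^sub>v v) \<bullet> krylov (transpose_mat B) (transpose_mat w) j i = 0" if "j < r1" for j i
      unfolding krylov_transpose[OF c(1) wT that vc, symmetric] using v that unfolding P_def by blast
    then show "B *\<^sub>v v \<in> P" using c vc by (auto simp: P_def intro: mult_mat_vec_carrier)
  qed
  have ker: "P \<subseteq> mat_kernel w"
  proof
    fix v assume v: "v \<in> P"
    then have vc: "v \<in> carrier_vec n" by (simp add: P_def)
    have "w *\<^sub>v v = 0\<^sub>v r1"
    proof (rule eq_vecI)
      fix j assume "j < dim_vec (0\<^sub>v r1 :: complex vec)"
      then have j: "j < r1" by simp
      have "v \<bullet> krylov (transpose_mat B) (transpose_mat w) j 0 = 0" using v j unfolding P_def by blast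
      then show "(w *\<^sub>v v) $ j = 0\<^sub>v r1 $ j"
        using j c vc comm_scalar_prod[of "row w j" n v] row_carrier_vec[OF j c(2)] by simp
    qed (use c in simp)
    then show "v \<in> mat_kernel w" using c vc unfolding mat_kernel_def by simp
  qed
  have "P = {0\<^sub>v n}"
  proof (rule ccontr)
    assume "P \<noteq> {0\<^sub>v n}"
    then have "\<zeta> * real (vdim ((Cn n)\<lparr>carrier := P\<rparr>)) < 0"
      using st sub inv ker unfolding bb handsaw_stable.simps by blast
    then show False using \<open>\<zeta> > 0\<close> by (simp add: mult_less_0_iff)
  qed
  then show ?thesis using c unfolding bb by (auto simp: P_def)
qed

text \<open>An invariant subspace of the kernel of \<open>w\<close> pairs to zero with all Krylov
  vectors of the dual triple, so it is zero and the first condition is vacuous. The second is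
  positivity of the dimension of a nonzero quotient.\<close>

lemma generating_stable_pos:
  assumes "\<zeta> > 0" and b: "b \<in> carrier (HS r0 r1 n)" and gen: "generating n (dual b)"
  shows "handsaw_stable r0 n \<zeta> b"
proof -
  obtain B z w where bb: "b = (B, z, w)" by (cases b)
  have c: "B \<in> carrier_mat n n" "w \<in> carrier_mat r1 n" using b bb by auto
  have wT: "transpose_mat w \<in> carrier_mat n r1" using c by simp
  have 1: "P = {0\<^sub>v n}" if sub: "VectorSpace.subspace CC P (Cn n)" and inv: "(\<lambda>v. B *\<^sub>v v) ` P \<subseteq> P"
    and ker: "P \<subseteq> mat_kernel w" for P
  proof -
    note P = subspace_CnD[OF sub]
    have "v \<bullet> krylov (transpose_mat B) (transpose_mat w) j i = 0" if "v \<in> P" and j: "j < r1" for v j i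
      using that(1)
    proof (induction i arbitrary: v)
      case 0
      then have "v \<in> carrier_vec n" and wv: "w *\<^sub>v v = 0\<^sub>v r1" using P ker c unfolding mat_kernel_def by auto
      have "row w j \<bullet> v = 0" using j c arg_cong[OF wv, of "\<lambda>v. v $ j"] by simp
      then show ?case
        using j c \<open>v \<in> carrier_vec n\<close> comm_scalar_prod[of "row w j" n v] row_carrier_vec[OF j c(2)] by simp
    next
      case (Suc i)
      then have v: "v \<in> carrier_vec n" "B *\<^sub>v v \<in> P" using P inv by auto
      show ?case unfolding krylov_transpose[OF c(1) wT j v(1)] by (rule Suc.IH[OF v(2)])
    qed
    then have "v = 0\<^sub>v n" if "v \<in> P" for v
      using gen that P(1) c unfolding bb by auto
    then show ?thesis using P by blast
  qed
  have 2: "\<zeta> * real (vdim (quot_module (Cn n) P)) > 0"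
    if "VectorSpace.subspace CC P (Cn n)" "P \<noteq> carrier_vec n" for P
    using vdim_quot_pos[OF vec_vs Cn_fin_dim that(1)] that(2) \<open>\<zeta> > 0\<close>
    by (simp add: module_vec_simps)
  show ?thesis unfolding bb handsaw_stable.simps
  proof (intro allI impI conjI; elim conjE)
    fix P assume P: "VectorSpace.subspace CC P (Cn n)" "(\<lambda>v. B *\<^sub>v v) ` P \<subseteq> P"
    show "\<zeta> * real (vdim ((Cn n)\<lparr>carrier := P\<rparr>)) < 0" if "P \<subseteq> mat_kernel w" "P \<noteq> {0\<^sub>v n}"
      using 1[OF P that(1)] that(2) by contradiction
    show "\<zeta> * real (vdim (quot_module (Cn n) P)) > 0" if "P \<noteq> carrier_vec n" by (rule 2[OF P(1) that])
  qed
qed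

text \<open>A stabiliser commutes with \<open>B\<close> and fixes \<open>z\<close>, hence fixes
  every Krylov vector. The rows of \<open>g - 1\<close> therefore annihilate all of them and
  vanish.\<close>

lemma generating_free:
  assumes b: "b \<in> carrier (HS r0 r1 n)" and gen: "generating n b"
    and g: "g \<in> GL n" "GL_act n g b = b"
  shows "g = 1\<^sub>m n"
proof -
  obtain B z w where bb: "b = (B, z, w)" by (cases b)
  have c: "B \<in> carrier_mat n n" "z \<in> carrier_mat n r0" using b bb by auto
  have gc: "g \<in> carrier_mat n n" "GL_inv n g \<in> carrier_mat n n" using g by auto
  have gB: "g * B = B * g"
  proof -
    interpret handsaw_dims r0 r0 n .
    have "g * B = g * B * (GL_inv n g * g)" using gc g c by simp
    also have "\<dots> = (g * B * GL_inv n g) * g" using gc c by (simp add: mat_alg)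
    finally show ?thesis using g unfolding bb by simp
  qed
  have gz: "g * z = z" using g unfolding bb by simp
  have gk: "g *\<^sub>v krylov B z j i = krylov B z j i" if "j < r0" for j i
  proof (induction i)
    case 0
    show ?case using col_mult2[OF gc(1) c(2) that] gz by simp
  next
    case (Suc i)
    note kc = krylov_carrier[OF c that, of i]
    have "g *\<^sub>v (B *\<^sub>v krylov B z j i) = (B * g) *\<^sub>v krylov B z j i"
      unfolding gB[symmetric] using gc c kc by (intro assoc_mult_mat_vec[symmetric, of _ n n _ n]) auto
    also have "\<dots> = B *\<^sub>v (g *\<^sub>v krylov B z j i)"
      using gc c kc by (intro assoc_mult_mat_vec[of _ n n _ n]) auto
    finally show ?case using Suc by simp
  qed
  have row: "row (g - 1\<^sub>m n) s = 0\<^sub>v n" if s: "s < n" for s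
  proof -
    have "row (g - 1\<^sub>m n) s \<bullet> krylov B z j i = 0" if "j < r0" for j i
    proof -
      note kc = krylov_carrier[OF c that, of i]
      have "row (g - 1\<^sub>m n) s \<bullet> krylov B z j i = ((g - 1\<^sub>m n) *\<^sub>v krylov B z j i) $ s"
        using s gc by simp
      also have "(g - 1\<^sub>m n) *\<^sub>v krylov B z j i = g *\<^sub>v krylov B z j i - 1\<^sub>m n *\<^sub>v krylov B z j i"
        using gc kc by (intro minus_mult_distrib_mat_vec[of _ n n]) auto
      also have "\<dots> $ s = 0" using gk[OF that] kc s by simp
      finally show ?thesis .
    qed
    moreover have "row (g - 1\<^sub>m n) s \<in> carrier_vec n" by (rule row_carrier_vec[OF s]) (simp add: minus_carrier_mat)
    ultimately show ?thesis using gen c unfolding bb by simp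
  qed
  show ?thesis
  proof (rule eq_matI)
    fix i j assume ij: "i < dim_row (1\<^sub>m n)" "j < dim_col (1\<^sub>m n)"
    then have "(g - 1\<^sub>m n) $$ (i, j) = row (g - 1\<^sub>m n) i $ j" using gc by simp
    also have "\<dots> = 0" using row[of i] ij by simp
    finally show "g $$ (i, j) = 1\<^sub>m n $$ (i, j)" using ij gc by simp
  qed (use gc in auto)
qed

text \<open>Zero rows complete \<open>A\<close> to a square matrix; its transpose kills
  \<open>unit_vec n m\<close>, so the determinant vanishes.\<close>

lemma exists_kernel_vec:
  fixes A :: "complex mat"
  assumes A: "A \<in> carrier_mat m n" and "m < n"
  obtains v where "v \<in> carrier_vec n" "v \<noteq> 0\<^sub>v n" "A *\<^sub>v v = 0\<^sub>v m"
proof -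
  define C where "C = mat n n (\<lambda>(i, j). if i < m then A $$ (i, j) else 0)"
  have C: "C \<in> carrier_mat n n" by (simp add: C_def)
  have "transpose_mat C *\<^sub>v unit_vec n m = 0\<^sub>v n"
    unfolding mult_mat_unit_vec[of "transpose_mat C" n n m, simplified, OF C \<open>m < n\<close>]
    using C \<open>m < n\<close> by (intro eq_vecI) (auto simp: C_def)
  then have "det (transpose_mat C) = 0"
    using det_0_iff_vec_prod_zero_field[of "transpose_mat C" n] C \<open>m < n\<close> unit_vec_carrier unit_vec_nonzero
    by (metis transpose_carrier_mat)
  then have "det C = 0" using det_transpose[OF C] by simp
  then obtain v where v: "v \<in> carrier_vec n" "v \<noteq> 0\<^sub>v n" "C *\<^sub>v v = 0\<^sub>v n"
    using det_0_iff_vec_prod_zero_field[OF C] by blast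
  have "A *\<^sub>v v = 0\<^sub>v m"
  proof (rule eq_vecI)
    fix i assume "i < dim_vec (0\<^sub>v m :: complex vec)"
    then have i: "i < m" by simp
    have "row C i = row A i" using i A \<open>m < n\<close> by (intro eq_vecI) (auto simp: C_def)
    then have "(A *\<^sub>v v) $ i = (C *\<^sub>v v) $ i" using i A C \<open>m < n\<close> by simp
    then show "(A *\<^sub>v v) $ i = 0\<^sub>v m $ i" using v i \<open>m < n\<close> by simp
  qed (use A in simp)
  then show ?thesis using that v by blast
qed

text \<open>Applying \<open>g - ev s0\<close> to a linear relation removes the term at
  \<open>s0\<close> and no new term appears, so induction on the number of nonzero coefficients
  applies.\<close>

lemma eigen_independent:
  fixes g :: "complex mat"
  assumes g: "g \<in> carrier_mat n n" and C: "C \<in> carrier_mat n m"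
    and eig: "\<And>s. s < m \<Longrightarrow> g *\<^sub>v col C s = ev s \<cdot>\<^sub>v col C s"
    and inj: "inj_on ev {..<m}" and nz: "\<And>s. s < m \<Longrightarrow> col C s \<noteq> 0\<^sub>v n"
    and "c \<in> carrier_vec m" "C *\<^sub>v c = 0\<^sub>v n"
  shows "c = 0\<^sub>v m"
  using assms(6,7)
proof (induction "card {s. s < m \<and> c $ s \<noteq> 0}" arbitrary: c rule: less_induct)
  case less
  show ?case
  proof (cases "\<exists>s0<m. c $ s0 \<noteq> 0")
    case False
    then show ?thesis using less.prems by (intro eq_vecI) auto
  next
    case True
    then obtain s0 where s0: "s0 < m" "c $ s0 \<noteq> 0" by blast
    have gC: "g * C = C * mat_diag m ev"
    proof (subst mat_eq_iff_cols[of _ n m], goal_cases)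
      case 3
      show ?case
      proof (intro allI impI)
        fix j assume j: "j < m"
        have "col (g * C) j = ev j \<cdot>\<^sub>v col C j" using col_mult2[OF g C j] eig[OF j] by simp
        also have "\<dots> = col (C * mat_diag m ev) j"
          unfolding mat_diag_mult_right[OF C] using j C by (intro eq_vecI) auto
        finally show "col (g * C) j = col (C * mat_diag m ev) j" .
      qed
    qed (use g C in \<open>auto intro: mult_carrier_mat\<close>)
    \<comment> \<open>The coefficients of the relation after applying
      \<open>g - ev s0\<close>.\<close>
    define d where "d = vec m (\<lambda>s. (ev s - ev s0) * c $ s)"
    have dg: "mat_diag m ev *\<^sub>v c = vec m (\<lambda>s. ev s * c $ s)" by (rule mat_diag_mult_vec[OF less.prems(1)])
    have "d = mat_diag m ev *\<^sub>v c - ev s0 \<cdot>\<^sub>v c"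
      unfolding dg d_def using less.prems(1) by (intro eq_vecI) (auto simp: algebra_simps)
    then have "C *\<^sub>v d = C *\<^sub>v (mat_diag m ev *\<^sub>v c) - C *\<^sub>v (ev s0 \<cdot>\<^sub>v c)"
      using C less.prems(1) dg mult_minus_distrib_mat_vec[OF C, of "mat_diag m ev *\<^sub>v c" "ev s0 \<cdot>\<^sub>v c"] by simp
    also have "C *\<^sub>v (mat_diag m ev *\<^sub>v c) = (C * mat_diag m ev) *\<^sub>v c"
      using C less.prems(1) by (intro assoc_mult_mat_vec[symmetric, of _ n m _ m]) auto
    also have "\<dots> = g *\<^sub>v (C *\<^sub>v c)"
      unfolding gC[symmetric] using g C less.prems(1) by (intro assoc_mult_mat_vec[of _ n n _ m]) auto
    also have "\<dots> = 0\<^sub>v n" unfolding less.prems(2) by (rule mult_mat_zero_vec[OF g])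
    also have "C *\<^sub>v (ev s0 \<cdot>\<^sub>v c) = 0\<^sub>v n" 
      using mult_mat_vec[OF C less.prems(1)] less.prems(2) by (simp, intro eq_vecI) auto
    finally have Cd: "C *\<^sub>v d = 0\<^sub>v n" by simp
    have sub: "{s. s < m \<and> d $ s \<noteq> 0} \<subset> {s. s < m \<and> c $ s \<noteq> 0}"
    proof -
      have "{s. s < m \<and> d $ s \<noteq> 0} \<subseteq> {s. s < m \<and> c $ s \<noteq> 0} - {s0}" by (auto simp: d_def)
      then show ?thesis using s0 by blast
    qed
    have "d = 0\<^sub>v m"
      by (rule less.hyps[OF psubset_card_mono[OF _ sub]]) (use Cd in \<open>auto simp: d_def\<close>)
    have cs: "c $ s = 0" if "s < m" "s \<noteq> s0" for s
    proof -
      have "(ev s - ev s0) * c $ s = 0" using arg_cong[OF \<open>d = 0\<^sub>v m\<close>, of "\<lambda>v. v $ s"] that by (simp add: d_def)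
      then show ?thesis using inj that s0 by (auto simp: inj_on_def)
    qed
    have "c = c $ s0 \<cdot>\<^sub>v unit_vec m s0"
      using cs s0 less.prems(1) by (intro eq_vecI) auto
    then have "C *\<^sub>v c = c $ s0 \<cdot>\<^sub>v col C s0"
      using mult_mat_vec[OF C unit_vec_carrier[of m s0], of "c $ s0"] mult_mat_unit_vec[OF C s0(1)] by simp
    then have 0: "c $ s0 \<cdot>\<^sub>v col C s0 = 0\<^sub>v n" using less.prems(2) by simp
    have "col C s0 = 0\<^sub>v n"
    proof (rule eq_vecI)
      fix i assume "i < dim_vec (0\<^sub>v n :: complex vec)"
      then show "col C s0 $ i = 0\<^sub>v n $ i" using arg_cong[OF 0, of "\<lambda>v. v $ i"] s0 C by simp
    qed (use C in simp)
    then show ?thesis using nz s0 by blast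
  qed
qed


section \<open>Fixed points\<close>

context chain_form
begin

lemma krylov_std:
  assumes h: "h \<in> GL n" and j: "j < card J"
  shows "krylov (h * std_B * GL_inv n h) (h * std_z) j i = h *\<^sub>v E (J_nth j, i)"
proof (induction i)
  case 0
  show ?case using col_mult2[OF GL_carrier[OF h] std_carrier(2) j] col_std_z[OF j] by simp
next
  case (Suc i)
  have c: "h \<in> carrier_mat n n" "GL_inv n h \<in> carrier_mat n n" using h by auto
  let ?v = "E (J_nth j, i)"
  have hv: "h *\<^sub>v ?v \<in> carrier_vec n" using c by (intro mult_mat_vec_carrier[of _ n n]) auto
  have "(h * std_B * GL_inv n h) *\<^sub>v (h *\<^sub>v ?v) = (h * std_B) *\<^sub>v (GL_inv n h *\<^sub>v (h *\<^sub>v ?v))"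
    using c hv by (intro assoc_mult_mat_vec[of _ n n _ n]) (auto intro: mult_carrier_mat)
  also have "\<dots> = (h * std_B) *\<^sub>v ?v" using GL_cancel_vec_left[OF h E_carrier] by simp
  also have "\<dots> = h *\<^sub>v (std_B *\<^sub>v ?v)"
    using c by (intro assoc_mult_mat_vec[of _ n n _ n]) auto
  also have "std_B *\<^sub>v ?v = E (J_nth j, Suc i)" by (rule std_B_E) (simp add: j)
  finally show ?case using Suc by simp
qed

lemma GL_E_eq_zero_iff:
  assumes "h \<in> GL n"
  shows "h *\<^sub>v E a = 0\<^sub>v n \<longleftrightarrow> a \<notin> chains J k"
proof
  assume "h *\<^sub>v E a = 0\<^sub>v n"
  then have "GL_inv n h *\<^sub>v (h *\<^sub>v E a) = 0\<^sub>v n"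
    using mult_mat_zero_vec[OF GL_inv_carrier[OF assms]] by simp
  then have "E a = 0\<^sub>v n" using assms by simp
  then show "a \<notin> chains J k" using unit_vec_nonzero[of n "idx a"] by (auto simp: E_def)
qed (simp add: E_def mult_mat_zero_vec[OF GL_carrier[OF assms]])

lemma GL_act_std:
  "GL_act n h (std_form J J' k) = (h * std_B * GL_inv n h, h * std_z, 0\<^sub>m (card J') n * GL_inv n h)"
  by (simp add: std_form_eq)

text \<open>Among the Krylov vectors of the translate are all columns of \<open>h\<close>; a
  functional that kills these is zero because \<open>h\<close> is invertible.\<close>

lemma generating_std:
  assumes h: "h \<in> GL n"
  shows "generating n (GL_act n h (std_form J J' k))"
  unfolding GL_act_std generating.simps
proof (intro ballI impI)
  fix y assume y: "y \<in> carrier_vec n"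
    and 0: "\<forall>j<dim_col (h * std_z). \<forall>i. y \<bullet> krylov (h * std_B * GL_inv n h) (h * std_z) j i = 0"
  have c: "h \<in> carrier_mat n n" using h by simp
  have hy: "transpose_mat h *\<^sub>v y = 0\<^sub>v n"
  proof (rule eq_vecI)
    fix s assume "s < dim_vec (0\<^sub>v n :: complex vec)"
    then have s: "s < n" by simp
    obtain \<alpha> i where ps: "p s = (\<alpha>, i)" by (cases "p s")
    then have "\<alpha> \<in> J" using p_chains[OF s] by (auto simp: chains_def)
    then have "y \<bullet> (h *\<^sub>v E (\<alpha>, i)) = 0" 
      using 0[rule_format, of "J_pos \<alpha>" i] krylov_std[OF h, of "J_pos \<alpha>" i] by simp
    then have "(transpose_mat h *\<^sub>v y) \<bullet> E (\<alpha>, i) = 0"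
      using transpose_vec_mult_scalar[OF c E_carrier y] by simp
    moreover have "E (\<alpha>, i) = unit_vec n s" using E_p[OF s] ps by simp
    moreover have "transpose_mat h *\<^sub>v y \<in> carrier_vec n" using c y by (intro mult_mat_vec_carrier[of _ n n]) auto
    ultimately show "(transpose_mat h *\<^sub>v y) $ s = 0\<^sub>v n $ s" using s by simp
  qed (use c in simp)
  have "y = GL_inv n (transpose_mat h) *\<^sub>v (transpose_mat h *\<^sub>v y)" using h y by simp
  also have "\<dots> = 0\<^sub>v n" unfolding hy by (rule mult_mat_zero_vec) (use h in simp)
  finally show "y = 0\<^sub>v n" .
qed

text \<open>An invariant subspace containing the image of \<open>z\<close> contains all Krylov
  vectors, hence all columns of \<open>h\<close>, hence everything, so the second condition is
  vacuous. The first is positivity of the dimension of a nonzero subspace.\<close>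

lemma std_stable_neg:
  assumes h: "h \<in> GL n" and "\<zeta> < 0"
  shows "handsaw_stable (card J) n \<zeta> (GL_act n h (std_form J J' k))"
proof -
  define B z where "B = h * std_B * GL_inv n h" and "z = h * std_z"
  have c: "h \<in> carrier_mat n n" "z \<in> carrier_mat n (card J)" using h mult_carrier_mat[OF GL_carrier[OF h] std_carrier(2)] by (auto simp: z_def)
  have 1: "P = carrier_vec n" if sub: "VectorSpace.subspace CC P (Cn n)"
    and inv: "(\<lambda>v. B *\<^sub>v v) ` P \<subseteq> P" and im: "(\<lambda>u. z *\<^sub>v u) ` carrier_vec (card J) \<subseteq> P" for P
  proof -
    note P = subspace_CnD[OF sub]
    have kry: "krylov B z j i \<in> P" if j: "j < card J" for j i
    proof (induction i)
      case 0
      have "z *\<^sub>v unit_vec (card J) j \<in> P" using im by auto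
      then show ?case using mult_mat_unit_vec[OF c(2) j] by simp
    next
      case (Suc i)
      then show ?case using inv by auto
    qed
    have unit: "h *\<^sub>v unit_vec n s \<in> P" if s: "s < n" for s
    proof -
      obtain \<alpha> i where ps: "p s = (\<alpha>, i)" by (cases "p s")
      then have "\<alpha> \<in> J" using p_chains[OF s] by (auto simp: chains_def)
      then show ?thesis
        using krylov_std[OF h, of "J_pos \<alpha>" i] kry[of "J_pos \<alpha>" i] E_p[OF s] ps unfolding B_def z_def by simp
    qed
    have all: "h *\<^sub>v u \<in> P" if u: "u \<in> carrier_vec n" for u
    proof -
      \<comment> \<open>The vector \<open>u\<close> is assembled one coordinate at a time, which
        needs closure of \<open>P\<close> under binary sums and multiples only.\<close>
      have "h *\<^sub>v vec n (\<lambda>i. if i < m then u $ i else 0) \<in> P" if "m \<le> n" for m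
        using that
      proof (induction m)
        case 0
        have "vec n (\<lambda>i. if i < 0 then u $ i else 0) = 0\<^sub>v n" by auto
        then show ?case using P(2) mult_mat_zero_vec[OF c(1)] by simp
      next
        case (Suc m)
        let ?a = "vec n (\<lambda>i. if i < m then u $ i else 0)"
        have "vec n (\<lambda>i. if i < Suc m then u $ i else 0) = ?a + u $ m \<cdot>\<^sub>v unit_vec n m"
          using Suc.prems by (intro eq_vecI) (auto simp: less_Suc_eq)
        also have "h *\<^sub>v \<dots> = h *\<^sub>v ?a + u $ m \<cdot>\<^sub>v (h *\<^sub>v unit_vec n m)"
          using c by (simp add: mult_add_distrib_mat_vec[of _ n n] mult_mat_vec[of _ n n])
        also have "\<dots> \<in> P" using Suc P(3,4) unit[of m] by simp
        finally show ?case .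
      qed
      from this[of n] have "h *\<^sub>v vec n (\<lambda>i. if i < n then u $ i else 0) \<in> P" by simp
      also have "vec n (\<lambda>i. if i < n then u $ i else 0) = u" using u by (intro eq_vecI) auto
      finally show ?thesis .
    qed
    have "v \<in> P" if v: "v \<in> carrier_vec n" for v
    proof -
      have "GL_inv n h *\<^sub>v v \<in> carrier_vec n" using h v by (intro mult_mat_vec_carrier[of _ n n]) auto
      from all[OF this] show ?thesis using h v by simp
    qed
    then show ?thesis using P(1) by blast
  qed
  show ?thesis unfolding GL_act_std B_def[symmetric] z_def[symmetric] handsaw_stable.simps
  proof (intro allI impI conjI; elim conjE)
    fix P assume P: "VectorSpace.subspace CC P (Cn n)" "(\<lambda>v. B *\<^sub>v v) ` P \<subseteq> P"
    show "\<zeta> * real (vdim ((Cn n)\<lparr>carrier := P\<rparr>)) < 0" if "P \<noteq> {0\<^sub>v n}"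
      using vdim_subspace_pos[OF vec_vs Cn_fin_dim P(1)] that \<open>\<zeta> < 0\<close>
      by (simp add: module_vec_simps mult_neg_pos)
    show "\<zeta> * real (vdim (quot_module (Cn n) P)) > 0"
      if "(\<lambda>u. z *\<^sub>v u) ` carrier_vec (card J) \<subseteq> P" "P \<noteq> carrier_vec n"
      using 1[OF P that(1)] that(2) by contradiction
  qed
qed

end

text \<open>The chain length of a flavour is recovered from any translate as the first power of
  \<open>B\<close> that kills its column of \<open>z\<close>.\<close>

lemma std_form_inj:
  assumes "finite J" "finite J'" "J \<inter> J' = {}" "k \<in> J \<rightarrow>\<^sub>E UNIV" "k' \<in> J \<rightarrow>\<^sub>E UNIV"
    and n: "sum k J = n" "sum k' J = n"
    and h: "h \<in> GL n" "h' \<in> GL n" and eq: "GL_act n h (std_form J J' k) = GL_act n h' (std_form J J' k')"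
  shows "k = k'"
proof -
  interpret A: chain_form J J' k by unfold_locales (use assms in auto)
  interpret B: chain_form J J' k' by unfold_locales (use assms in auto)
  have nn: "A.n = n" "B.n = n" using n by (simp_all add: A.n_def B.n_def)
  have "k \<alpha> = k' \<alpha>" if "\<alpha> \<in> J" for \<alpha>
  proof -
    have "i < k \<alpha> \<longleftrightarrow> i < k' \<alpha>" for i
    proof -
      have "h *\<^sub>v A.E (\<alpha>, i) = h' *\<^sub>v B.E (\<alpha>, i)"
        using A.krylov_std[of h "A.J_pos \<alpha>" i] B.krylov_std[of h' "A.J_pos \<alpha>" i] h eq that
          A.GL_act_std B.GL_act_std by (simp add: nn)
      then show ?thesis
        using A.GL_E_eq_zero_iff[of h "(\<alpha>, i)"] B.GL_E_eq_zero_iff[of h' "(\<alpha>, i)"] h nn that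
        by (simp add: chains_def)
    qed
    then show ?thesis by (meson linorder_neqE_nat order_less_irrefl)
  qed
  then show ?thesis using PiE_ext[OF assms(4,5)] by blast
qed

section \<open>Classification of the fixed triples\<close>

lemma smult_mat_mult_vec:
  fixes A :: "complex mat"
  assumes "A \<in> carrier_mat m n" "v \<in> carrier_vec n"
  shows "(c \<cdot>\<^sub>m A) *\<^sub>v v = c \<cdot>\<^sub>v (A *\<^sub>v v)"
  using assms by (intro eq_vecI) auto

text \<open>Clearing the inverse turns the fixed point equation for \<open>B\<close> into Bg = q gB,
  so \<open>g\<close> picks up a factor 1/q each time it passes \<open>B\<close>. The equation for
  \<open>z\<close> gives the eigenvalue at the start of the chain.\<close>

lemma fixed_relations:
  assumes b: "B \<in> carrier_mat n n" "z \<in> carrier_mat n (card J)" "w \<in> carrier_mat (card J') n"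
    and t: "t q_ix \<noteq> 0" "\<And>\<alpha>. \<alpha> \<in> J \<Longrightarrow> t (e_ix \<alpha>) \<noteq> 0" and J: "finite J"
    and g: "g \<in> GL n" "GL_act n g (torus_act J J' t (B, z, w)) = (B, z, w)"
  shows "j < card J \<Longrightarrow> g *\<^sub>v krylov B z j i =
      (t (e_ix (sorted_list_of_set J ! j)) * inverse (t q_ix) ^ i) \<cdot>\<^sub>v krylov B z j i"
    and "w * g = t q_ix \<cdot>\<^sub>m (flavour_mat J' t * w)"
proof -
  interpret handsaw_dims "card J" "card J'" n .
  have gc: "g \<in> carrier_mat n n" "GL_inv n g \<in> carrier_mat n n" using g by auto
  have eqs: "g * (t q_ix \<cdot>\<^sub>m B) * GL_inv n g = B" "g * (z * flavour_inv_mat J t) = z"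
    "t q_ix \<cdot>\<^sub>m (flavour_mat J' t * w) * GL_inv n g = w"
    using g(2) by simp_all
  have Bg: "B * g = t q_ix \<cdot>\<^sub>m (g * B)"
  proof -
    have "B * g = g * (t q_ix \<cdot>\<^sub>m B) * GL_inv n g * g" by (simp only: eqs(1))
    also have "\<dots> = t q_ix \<cdot>\<^sub>m (g * B)" using gc g(1) b by (simp add: mat_alg)
    finally show ?thesis .
  qed
  have gx: "g *\<^sub>v (B *\<^sub>v v) = inverse (t q_ix) \<cdot>\<^sub>v (B *\<^sub>v (g *\<^sub>v v))" if v: "v \<in> carrier_vec n" for v
  proof -
    have gv: "g *\<^sub>v v \<in> carrier_vec n" "B *\<^sub>v v \<in> carrier_vec n"
      using gc b v by (auto intro: mult_mat_vec_carrier)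
    have "B *\<^sub>v (g *\<^sub>v v) = (B * g) *\<^sub>v v"
      using gc b v by (intro assoc_mult_mat_vec[symmetric, of _ n n _ n]) auto
    also have "\<dots> = t q_ix \<cdot>\<^sub>v ((g * B) *\<^sub>v v)" 
      unfolding Bg by (rule smult_mat_mult_vec[OF mult_carrier_mat[OF gc(1) b(1)] v])
    also have "(g * B) *\<^sub>v v = g *\<^sub>v (B *\<^sub>v v)"
      using gc b v by (intro assoc_mult_mat_vec[of _ n n _ n]) auto
    finally show ?thesis using t by (simp add: smult_smult_assoc)
  qed
  show "g *\<^sub>v krylov B z j i = (t (e_ix (sorted_list_of_set J ! j)) * inverse (t q_ix) ^ i) \<cdot>\<^sub>v krylov B z j i"
    if j: "j < card J"
  proof (induction i)
    case 0
    let ?e = "t (e_ix (sorted_list_of_set J ! j))"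
    have e: "?e \<noteq> 0" using t(2) nth_sorted_bij[OF J] j by (auto simp: bij_betw_def)
    have zc: "col z j \<in> carrier_vec n" by (rule col_carrier_vec[OF j b(2)])
    have "col z j = g *\<^sub>v col (z * flavour_inv_mat J t) j"
      using col_mult2[OF gc(1) mult_carrier_mat[OF b(2) flavour_carrier(2)[of J t]] j] unfolding eqs(2) .
    also have "col (z * flavour_inv_mat J t) j = inverse ?e \<cdot>\<^sub>v col z j"
      unfolding flavour_inv_mat_def mat_diag_mult_right[OF b(2)] using j b by (intro eq_vecI) auto
    also have "g *\<^sub>v \<dots> = inverse ?e \<cdot>\<^sub>v (g *\<^sub>v col z j)" by (rule mult_mat_vec[OF gc(1) zc])
    finally have "?e \<cdot>\<^sub>v col z j = ?e \<cdot>\<^sub>v (inverse ?e \<cdot>\<^sub>v (g *\<^sub>v col z j))" by simp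
    then show ?case using e by (simp add: smult_smult_assoc)
  next
    case (Suc i)
    have kc: "krylov B z j i \<in> carrier_vec n" by (rule krylov_carrier[OF b(1,2) j])
    show ?case
      unfolding krylov_simps gx[OF kc] Suc mult_mat_vec[OF b(1) kc]
      by (simp add: smult_smult_assoc mult_ac)
  qed
  have "t q_ix \<cdot>\<^sub>m (flavour_mat J' t * w) * GL_inv n g * g = t q_ix \<cdot>\<^sub>m (flavour_mat J' t * w)"
    using gc g(1) b by (simp add: mat_alg)
  then show "w * g = t q_ix \<cdot>\<^sub>m (flavour_mat J' t * w)" unfolding eqs(3) .
qed

text \<open>Independence allows at most \<open>n\<close> nonzero Krylov vectors, so all chains end;
  generation gives the opposite bound, so these vectors form an invertible matrix \<open>h\<close>,
  which conjugates the standard form to \<open>b\<close>. \<open>w\<close> vanishes because it would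
  map a weight with a flavour from \<open>J\<close> to weights with flavours from
  \<open>J'\<close>.\<close>

lemma classification:
  assumes J: "J \<subseteq> {1..r}" and J': "J' \<subseteq> {1..r}" and disj: "J \<inter> J' = {}"
    and b: "b \<in> carrier (HS (card J) (card J') n)" and gen: "generating n b"
    and fixed: "\<And>t. t \<in> torus r \<Longrightarrow> \<exists>g\<in>GL n. GL_act n g (torus_act J J' t b) = b"
  shows "\<exists>k\<in>J \<rightarrow>\<^sub>E UNIV. sum k J = n \<and> (\<exists>h\<in>GL n. b = GL_act n h (std_form J J' k))"
proof -
  obtain B z w where bb: "b = (B, z, w)" by (cases b)
  have c: "B \<in> carrier_mat n n" "z \<in> carrier_mat n (card J)" "w \<in> carrier_mat (card J') n"
    using b bb by auto
  have fin: "finite J" "finite J'" using J J' finite_subset by blast+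
  \<comment> \<open>\<open>J_pos\<close> and \<open>J_nth\<close> do not involve the chain lengths;
    they are made available with all lengths 0 until the true ones are known.\<close>
  interpret D: chain_form J J' "\<lambda>_. 0" by unfold_locales (use fin disj in auto)
  define v where "v a = krylov B z (D.J_pos (fst a)) (snd a)" for a
  have vc: "v a \<in> carrier_vec n" if "fst a \<in> J" for a
    unfolding v_def using that by (intro krylov_carrier[OF c(1,2)]) simp
  have vSuc: "v (\<alpha>, Suc i) = B *\<^sub>v v (\<alpha>, i)" for \<alpha> i by (simp add: v_def)
  define eig where "eig t g \<longleftrightarrow>
      (\<forall>a. fst a \<in> J \<longrightarrow> g *\<^sub>v v a = (t (e_ix (fst a)) * inverse (t q_ix) ^ snd a) \<cdot>\<^sub>v v a) \<and>
      w * g = t q_ix \<cdot>\<^sub>m (flavour_mat J' t * w)" for t g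
  have eigD: "g *\<^sub>v v a = (t (e_ix (fst a)) * inverse (t q_ix) ^ snd a) \<cdot>\<^sub>v v a"
    if "eig t g" "fst a \<in> J" for t g a using that unfolding eig_def by blast
  have ex_eig: "\<exists>g\<in>GL n. eig t g" if t: "t \<in> torus r" for t
  proof -
    obtain g where g: "g \<in> GL n" "GL_act n g (torus_act J J' t (B, z, w)) = (B, z, w)"
      using fixed[OF t] bb by blast
    have q: "t q_ix \<noteq> 0" using torus_nonzero[OF t] by (simp add: q_ix_def)
    have e: "t (e_ix \<alpha>) \<noteq> 0" if "\<alpha> \<in> J" for \<alpha>
      using torus_nonzero[OF t, of \<alpha>] J that by (auto simp: e_ix_def)
    note f = fixed_relations[OF c q e fin(1) g]
    have "g *\<^sub>v v a = (t (e_ix (fst a)) * inverse (t q_ix) ^ snd a) \<cdot>\<^sub>v v a" if "fst a \<in> J" for a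
      using f(1)[of "D.J_pos (fst a)" "snd a"] that by (simp add: v_def D.J_nth_def[symmetric])
    then have "eig t g" unfolding eig_def using f(2) by simp
    then show ?thesis using g(1) by (rule bexI)
  qed
  define N where "N = {a. fst a \<in> J \<and> v a \<noteq> 0\<^sub>v n}"
  have indep: "x = 0\<^sub>v m"
    if F: "bij_betw p {..<m} F" "F \<subseteq> N" and x: "x \<in> carrier_vec m"
      "mat n m (\<lambda>(u, s). v (p s) $ u) *\<^sub>v x = 0\<^sub>v n" for m F p x
  proof -
    have "finite F" using F(1) by (meson bij_betw_finite finite_lessThan)
    define M where "M = Suc (Max (snd ` F))"
    have M: "snd a < M" if "a \<in> F" for a using that \<open>finite F\<close> by (simp add: M_def less_Suc_eq_le)
    \<comment> \<open>One torus element separates the finitely many characters: with q = 2 and e_i =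
      2^(M i), the character e_a q^(-i) has value 2^(M a - i), and \<open>M\<close> exceeds all
      chain positions in \<open>F\<close>.\<close>
    define t :: "nat \<Rightarrow> complex" where "t = restrict (\<lambda>i. if i = q_ix then 2 else 2 ^ (M * i)) {..<2 * r + 2}"
    have t: "t \<in> torus r" by (auto simp: t_def torus_def)
    obtain g where g: "g \<in> GL n" "eig t g" using ex_eig[OF t] by blast
    define C where "C = mat n m (\<lambda>(u, s). v (p s) $ u)"
    have pF: "p s \<in> F" "p s \<in> N" if "s < m" for s using F that by (auto simp: bij_betw_def)
    have colC: "col C s = v (p s)" if "s < m" for s
      using that vc[of "p s"] pF[OF that] by (intro eq_vecI) (auto simp: C_def N_def)
    define ev where "ev s = t (e_ix (fst (p s))) * inverse (t q_ix) ^ snd (p s)" for s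
    have inj: "inj_on ev {..<m}"
    proof (rule inj_onI)
      fix s s' assume s: "s \<in> {..<m}" "s' \<in> {..<m}" and eq: "ev s = ev s'"
      have ev: "ev s = 2 ^ (M * fst (p s)) / 2 ^ snd (p s)" if "s < m" for s
      proof -
        have "fst (p s) \<in> {1..r}" using pF[OF that] J by (auto simp: N_def)
        then have "t (e_ix (fst (p s))) = 2 ^ (M * fst (p s))" "t q_ix = 2"
          by (auto simp: t_def e_ix_def q_ix_def)
        then show ?thesis by (simp only: ev_def divide_inverse power_inverse)
      qed
      have "(2::complex) ^ (M * fst (p s) + snd (p s')) = 2 ^ (M * fst (p s') + snd (p s))"
        using eq s by (simp add: ev frac_eq_eq power_add)
      \<comment> \<open>Over the naturals powers of 2 can be compared by their exponents.\<close>
      then have "of_nat (2 ^ (M * fst (p s) + snd (p s'))) = (of_nat (2 ^ (M * fst (p s') + snd (p s))) :: complex)"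
        by simp
      then have "(2::nat) ^ (M * fst (p s) + snd (p s')) = 2 ^ (M * fst (p s') + snd (p s))"
        by (rule of_nat_eq_iff[THEN iffD1])
      then have e: "M * fst (p s) + snd (p s') = M * fst (p s') + snd (p s)"
        by (rule power_inject_exp[THEN iffD1, rotated]) simp
      \<comment> \<open>Chain positions are below \<open>M\<close>, so division by \<open>M\<close>
        recovers the flavours from the equal exponents.\<close>
      have lt: "snd (p s) < M" "snd (p s') < M" using M pF s by auto
      have "(M * fst (p s) + snd (p s')) div M = fst (p s)" "(M * fst (p s') + snd (p s)) div M = fst (p s')"
        using lt by simp_all
      with e have "fst (p s) = fst (p s')" by simp
      moreover from this e have "snd (p s) = snd (p s')" by simp
      ultimately have "p s = p s'" by (rule prod_eqI)
      then show "s = s'" using F(1) s by (auto simp: bij_betw_def inj_on_def)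
    qed
    have ec: "g *\<^sub>v col C s = ev s \<cdot>\<^sub>v col C s" "col C s \<noteq> 0\<^sub>v n" if "s < m" for s
      unfolding colC[OF that] ev_def using eigD[OF g(2)] pF(2)[OF that] by (simp_all add: N_def)
    have C: "C \<in> carrier_mat n m" by (simp add: C_def)
    show ?thesis
      by (rule eigen_independent[OF GL_carrier[OF g(1)] C ec(1) inj ec(2) x(1) x(2)[folded C_def]])
  qed
  have card_le: "card F \<le> n" if F: "finite F" "F \<subseteq> N" for F
  proof (rule ccontr)
    assume "\<not> card F \<le> n"
    obtain p where p: "bij_betw p {..<card F} F"
      using ex_bij_betw_nat_finite[OF F(1)] by (auto simp: atLeast0LessThan)
    obtain x where "x \<in> carrier_vec (card F)" "x \<noteq> 0\<^sub>v (card F)"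
      "mat n (card F) (\<lambda>(u, s). v (p s) $ u) *\<^sub>v x = 0\<^sub>v n"
      using exists_kernel_vec[of "mat n (card F) (\<lambda>(u, s). v (p s) $ u)" n "card F"] \<open>\<not> card F \<le> n\<close> by auto
    then show False using indep[OF p F(2)] by blast
  qed
  have v_zero: "v (\<alpha>, j) = 0\<^sub>v n" if "v (\<alpha>, i) = 0\<^sub>v n" "i \<le> j" for \<alpha> i j
    using that(2)
  proof (induction j rule: dec_induct)
    case base
    show ?case by (rule that(1))
  next
    case (step j)
    then show ?case using mult_mat_zero_vec[OF c(1)] by (simp add: vSuc)
  qed
  \<comment> \<open>A chain still nonzero at position \<open>n\<close> would contain
    \<open>n + 1\<close> independent vectors.\<close>
  have vn: "v (\<alpha>, n) = 0\<^sub>v n" if "\<alpha> \<in> J" for \<alpha>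
  proof (rule ccontr)
    assume "v (\<alpha>, n) \<noteq> 0\<^sub>v n"
    then have "Pair \<alpha> ` {..n} \<subseteq> N" using v_zero that by (auto simp: N_def)
    from card_le[OF _ this] show False by (simp add: card_image inj_on_def)
  qed
  define k where "k = restrict (\<lambda>\<alpha>. LEAST i. v (\<alpha>, i) = 0\<^sub>v n) J"
  have N: "N = chains J k"
  proof -
    have "v (\<alpha>, i) \<noteq> 0\<^sub>v n \<longleftrightarrow> i < k \<alpha>" if "\<alpha> \<in> J" for \<alpha> i
    proof
      assume nz: "v (\<alpha>, i) \<noteq> 0\<^sub>v n"
      have "v (\<alpha>, k \<alpha>) = 0\<^sub>v n" unfolding k_def using that LeastI[of "\<lambda>i. v (\<alpha>, i) = 0\<^sub>v n", OF vn[OF that]] by simp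
      then show "i < k \<alpha>" using v_zero nz by (meson not_less)
    next
      assume "i < k \<alpha>"
      then show "v (\<alpha>, i) \<noteq> 0\<^sub>v n" using not_less_Least[of i "\<lambda>i. v (\<alpha>, i) = 0\<^sub>v n"] that by (simp add: k_def)
    qed
    then show ?thesis unfolding N_def chains_def by auto
  qed
  interpret chain_form J J' k by unfold_locales (use fin disj in auto)
  define m where "m = sum k J"
  have [simp]: "chain_form.n J k = m" by (simp add: n_def m_def)
  define h where "h = mat n m (\<lambda>(u, s). v (p s) $ u)"
  have pb: "bij_betw p {..<m} N" unfolding N using p_bij by simp
  have hc: "h \<in> carrier_mat n m" by (simp add: h_def)
  have colh: "col h s = v (p s)" if "s < m" for s
  proof -
    have "fst (p s) \<in> J" using p_chains[of s] that by (auto simp: chains_def)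
    then show ?thesis using that vc[of "p s"] by (intro eq_vecI) (auto simp: h_def)
  qed
  have "m \<le> n"
    using card_le[of N] bij_betw_same_card[OF pb] bij_betw_finite[OF pb] by simp
  \<comment> \<open>With fewer than \<open>n\<close> nonzero Krylov vectors some nonzero functional
    would kill them all, against generation.\<close>
  moreover have "n \<le> m"
  proof (rule ccontr)
    assume "\<not> n \<le> m"
    then obtain y where y: "y \<in> carrier_vec n" "y \<noteq> 0\<^sub>v n" "transpose_mat h *\<^sub>v y = 0\<^sub>v m"
      using exists_kernel_vec[of "transpose_mat h" m n] hc by auto
    have "y \<bullet> krylov B z j i = 0" if j: "j < card J" for j i
    proof (cases "(D.J_nth j, i) \<in> N")
      case True
      then obtain s where s: "s < m" "p s = (D.J_nth j, i)" using pb by (metis bij_betw_iff_bijections lessThan_iff)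
      have "(transpose_mat h *\<^sub>v y) $ s = 0" using y s by simp
      then have "col h s \<bullet> y = 0" using s hc by simp
      then have "krylov B z j i \<bullet> y = 0" unfolding colh[OF s(1)] s(2) v_def using j by simp
      then show ?thesis using comm_scalar_prod[OF y(1) krylov_carrier[OF c(1,2) j]] by simp
    next
      case False
      then have "krylov B z j i = 0\<^sub>v n" using j by (simp add: N_def v_def)
      then show ?thesis using y by simp
    qed
    then have "y = 0\<^sub>v n" using gen y(1) c unfolding bb by simp
    then show False using y by blast
  qed
  ultimately have mn: "m = n" by simp
  have nn: "chain_form.n J k = n" using mn by simp
  have hn: "h \<in> carrier_mat n n" using hc mn by simp
  have h: "h \<in> GL n"
  proof (rule GL_I_kernel[OF hn])
    fix x assume "x \<in> carrier_vec n" "h *\<^sub>v x = 0\<^sub>v n"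
    then show "x = 0\<^sub>v n" using indep[OF pb subset_refl, of x] unfolding h_def mn by simp
  qed
  have hE: "h *\<^sub>v E (\<alpha>, i) = v (\<alpha>, i)" if "\<alpha> \<in> J" for \<alpha> i
  proof (cases "(\<alpha>, i) \<in> chains J k")
    case True
    then show ?thesis using mult_E[of h n "(\<alpha>, i)"] hn nn colh[of "idx (\<alpha>, i)"] idx_less[OF True] mn by simp
  next
    case False
    then have "(\<alpha>, i) \<notin> N" unfolding N .
    then have "v (\<alpha>, i) = 0\<^sub>v n" using that unfolding N_def by simp
    then show ?thesis using mult_E[of h n "(\<alpha>, i)"] hn nn False by simp
  qed
  have ps: "fst (p s) \<in> J" if "s < n" for s using p_chains[of s] that nn by (auto simp: chains_def)
  have std: "std_B \<in> carrier_mat n n" "std_z \<in> carrier_mat n (card J)" using std_carrier nn by simp_all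
  have "B * h = h * std_B"
  proof (subst mat_eq_iff_cols[of _ n n], goal_cases)
    case 3
    show ?case
    proof (intro allI impI)
      fix s assume s: "s < n"
      have "col (B * h) s = v (fst (p s), Suc (snd (p s)))"
        using col_mult2[OF c(1) hn s] colh[of s] s mn by (simp add: vSuc)
      also have "\<dots> = col (h * std_B) s"
        using col_mult2[OF hn std(1) s] col_std_B[of s] s nn hE[OF ps[OF s]] by simp
      finally show "col (B * h) s = col (h * std_B) s" .
    qed
  qed (use c hn std in auto)
  then have "h * std_B * GL_inv n h = B * h * GL_inv n h" by simp
  also have "\<dots> = B" using assoc_mult_mat[OF c(1) hn GL_inv_carrier[OF h]] h c by simp
  finally have 1: "B = h * std_B * GL_inv n h" by simp
  have 2: "z = h * std_z"
  proof (subst mat_eq_iff_cols[of _ n "card J"], goal_cases)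
    case 3
    show ?case
    proof (intro allI impI)
      fix j assume j: "j < card J"
      have "col z j = v (J_nth j, 0)" using j by (simp add: v_def)
      also have "\<dots> = col (h * std_z) j"
        using col_mult2[OF hn std(2) j] col_std_z[OF j] hE[of "J_nth j" 0] j by simp
      finally show "col z j = col (h * std_z) j" .
    qed
  qed (use c hn std in auto)
  have wh: "w * h = 0\<^sub>m (card J') n"
  proof (rule eq_matI)
    fix j s assume "j < dim_row (0\<^sub>m (card J') n :: complex mat)" "s < dim_col (0\<^sub>m (card J') n :: complex mat)"
    then have js: "j < card J'" "s < n" by auto
    define \<alpha> where "\<alpha> = fst (p s)"
    have \<alpha>: "\<alpha> \<in> J" using ps[OF js(2)] by (simp add: \<alpha>_def)
    \<comment> \<open>Only the coordinate of the flavour \<open>\<alpha>\<close> is 2. The chain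
      vector is then doubled by \<open>g\<close>, while row \<open>j\<close> of \<open>w\<close>,
      whose flavour is different, stays unchanged; so the entry equals its own double.\<close>
    define t :: "nat \<Rightarrow> complex" where "t = restrict ((\<lambda>_. 1)(\<alpha> := 2)) {..<2 * r + 2}"
    have t: "t \<in> torus r" by (auto simp: t_def torus_def)
    obtain g where g: "g \<in> GL n" "g *\<^sub>v v (p s) = (t (e_ix \<alpha>) * inverse (t q_ix) ^ snd (p s)) \<cdot>\<^sub>v v (p s)"
      "w * g = t q_ix \<cdot>\<^sub>m (flavour_mat J' t * w)"
    proof -
      obtain g where g: "g \<in> GL n" "eig t g" using ex_eig[OF t] by blast
      then have "w * g = t q_ix \<cdot>\<^sub>m (flavour_mat J' t * w)" unfolding eig_def by blast
      with that[OF g(1)] show ?thesis using eigD[OF g(2) ps[OF js(2)]] unfolding \<alpha>_def by blast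
    qed
    have "\<alpha> \<in> {1..r}" "J'_nth j \<in> {1..r}" "J'_nth j \<noteq> \<alpha>"
      using \<alpha> J J' disj J'_nth_mem(1)[OF js(1)] by auto
    then have tv: "t q_ix = 1" "t (e_ix \<alpha>) = 2" "t (e_ix (J'_nth j)) = 1"
      by (auto simp: t_def q_ix_def e_ix_def)
    have vs: "v (p s) \<in> carrier_vec n" by (rule vc[OF ps[OF js(2)]])
    have "(w * g) *\<^sub>v v (p s) = w *\<^sub>v (2 \<cdot>\<^sub>v v (p s))"
      using assoc_mult_mat_vec[OF c(3) GL_carrier[OF g(1)] vs] g(2) tv by simp
    also have "\<dots> = 2 \<cdot>\<^sub>v (w *\<^sub>v v (p s))" by (rule mult_mat_vec[OF c(3) vs])
    finally have e: "(w * g) *\<^sub>v v (p s) = 2 \<cdot>\<^sub>v (w *\<^sub>v v (p s))" .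
    have "(w * g) *\<^sub>v v (p s) = 1 \<cdot>\<^sub>v ((flavour_mat J' t * w) *\<^sub>v v (p s))"
      unfolding g(3) tv(1) by (rule smult_mat_mult_vec[OF mult_carrier_mat[OF flavour_carrier(1) c(3)] vs])
    then have "(flavour_mat J' t * w) *\<^sub>v v (p s) = 2 \<cdot>\<^sub>v (w *\<^sub>v v (p s))" using e by simp
    then have "((flavour_mat J' t * w) *\<^sub>v v (p s)) $ j = 2 * (w *\<^sub>v v (p s)) $ j"
      using js c by simp
    moreover have "(flavour_mat J' t * w *\<^sub>v v (p s)) $ j = (w *\<^sub>v v (p s)) $ j"
    proof -
      have "row (flavour_mat J' t * w) j = row w j"
        unfolding flavour_mat_def mat_diag_mult_left[OF c(3)]
        using js c tv(3) by (intro eq_vecI) (auto simp: J'_nth_def)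
      then show ?thesis using js c carrier_matD[OF flavour_carrier(1)[of J' t]] by simp
    qed
    ultimately have "(w *\<^sub>v v (p s)) $ j = 0" by simp
    then show "(w * h) $$ (j, s) = 0\<^sub>m (card J') n $$ (j, s)"
      using js c hn colh[of s] mn by simp
  qed (use c hn in auto)
  have 3: "w = 0\<^sub>m (card J') n * GL_inv n h"
    unfolding wh[symmetric] using assoc_mult_mat[OF c(3) hn GL_inv_carrier[OF h]] h c by simp
  have "b = GL_act n h (std_form J J' k)" unfolding bb std_form_eq GL_act.simps nn using 1 2 3 by simp
  moreover have "k \<in> J \<rightarrow>\<^sub>E UNIV" by (simp add: k_def)
  ultimately show ?thesis using mn h unfolding m_def by blast
qed

text \<open>The torus action commutes with \<open>GL_act\<close> and so permutes orbits. It remains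
  to see that the translate of the standard form itself lies in the orbit, by way of the diagonal
  matrix \<open>lam t\<close>.\<close>

lemma std_orbit_torus:
  assumes J: "J \<subseteq> {1..r}" and J': "J' \<subseteq> {1..r}" and disj: "J \<inter> J' = {}" and n: "sum k J = n" and t: "t \<in> torus r"
  shows "torus_act J J' t ` GL_orbit n (std_form J J' k) = GL_orbit n (std_form J J' k)"
proof -
  interpret chain_form J J' k
    by unfold_locales (use J J' disj finite_subset in blast)+
  have nn: "chain_form.n J k = n" using n by (simp add: n_def)
  note std = std_form_carrier[unfolded nn]
  have q: "t q_ix \<noteq> 0" using torus_nonzero[OF t] by (simp add: q_ix_def)
  have e: "t (e_ix \<alpha>) \<noteq> 0" if "\<alpha> \<in> J" for \<alpha>
    using torus_nonzero[OF t, of \<alpha>] J that by (auto simp: e_ix_def)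
  let ?d = "mat_diag n (lam t)"
  have d: "?d \<in> GL n" by (rule mat_diag_GL(1)) (use lam_nonzero[OF q e] nn in auto)
  have fixed: "GL_act n ?d (torus_act J J' t (std_form J J' k)) = std_form J J' k"
    using std_form_fixed[OF q e] nn by simp
  have "torus_act J J' t (std_form J J' k) = GL_act n (GL_inv n ?d) (std_form J J' k)"
    using GL_act_inv(1)[OF d torus_act_closed[OF std, of t]] fixed by simp
  then have "GL_orbit n (torus_act J J' t (std_form J J' k)) = GL_orbit n (std_form J J' k)"
    using GL_orbit_eq[OF GL_inv_closed[OF d] std] by simp
  moreover have "torus_act J J' t ` GL_orbit n (std_form J J' k) = GL_orbit n (torus_act J J' t (std_form J J' k))"
    unfolding GL_orbit_def image_image by (intro image_cong refl torus_act_GL_act[OF _ std])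
  ultimately show ?thesis by simp
qed

lemma fixed_ex_GL:
  assumes b: "b \<in> carrier (HS (card J) (card J') n)"
    and "torus_act J J' t ` GL_orbit n b = GL_orbit n b"
  shows "\<exists>g\<in>GL n. torus_act J J' t b = GL_act n g b"
  using assms(2) GL_orbit_refl[OF b] unfolding GL_orbit_def by blast

section \<open>Parametrisation of the fixed points by chain lengths\<close>

definition families :: "nat set \<Rightarrow> nat \<Rightarrow> (nat \<Rightarrow> nat) set" where
  "families J n = {k. k \<in> J \<rightarrow>\<^sub>E UNIV \<and> sum k J = n}"

context
  fixes r :: nat and J J' :: "nat set"
  assumes J: "J \<subseteq> {1..r}" and J': "J' \<subseteq> {1..r}" and disj: "J \<inter> J' = {}"
begin

lemma flavours_finite: "finite J" "finite J'"
  using J J' finite_subset by blast+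

lemma chain_form_flavours: "chain_form J J'"
  by unfold_locales (use flavours_finite disj in auto)

lemma std_form_closed: "sum k J = n \<Longrightarrow> std_form J J' k \<in> carrier (HS (card J) (card J') n)"
  using chain_form.std_form_carrier[OF chain_form_flavours, of k] chain_form.n_def[OF chain_form_flavours, of k] by simp

lemma fixed_points_neg:
  assumes "\<zeta> < 0"
  shows "fixed_points r J J' \<zeta> n = (\<lambda>k. GL_orbit n (std_form J J' k)) ` families J n"
proof (intro equalityI subsetI)
  fix x assume "x \<in> fixed_points r J J' \<zeta> n"
  then obtain b where b: "b \<in> carrier (HS (card J) (card J') n)"
      "handsaw_stable (card J) n \<zeta> b" "x = GL_orbit n b"
    and fx: "\<And>t. t \<in> torus r \<Longrightarrow> torus_act J J' t ` x = x"
    by (auto simp: fixed_points_def handsaw_variety_def stable_points_def)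
  have "\<exists>g\<in>GL n. GL_act n g (torus_act J J' t b) = b" if t: "t \<in> torus r" for t
  proof -
    obtain g where g: "g \<in> GL n" "torus_act J J' t b = GL_act n g b"
      using fixed_ex_GL[OF b(1)] fx[OF t] b(3) by blast
    then have "GL_act n (GL_inv n g) (torus_act J J' t b) = b" using GL_act_inv(1)[OF g(1) b(1)] by simp
    then show ?thesis using GL_inv_closed[OF g(1)] by blast
  qed
  then obtain k h where k: "k \<in> J \<rightarrow>\<^sub>E UNIV" "sum k J = n" "h \<in> GL n" "b = GL_act n h (std_form J J' k)"
    using classification[OF J J' disj b(1) stable_neg_generating[OF assms b(1,2)]] by blast
  then have "x = GL_orbit n (std_form J J' k)" using GL_orbit_eq[OF k(3) std_form_closed[OF k(2)]] b(3) by simp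
  then show "x \<in> (\<lambda>k. GL_orbit n (std_form J J' k)) ` families J n" using k by (auto simp: families_def)
next
  fix x assume "x \<in> (\<lambda>k. GL_orbit n (std_form J J' k)) ` families J n"
  then obtain k where k: "sum k J = n" "x = GL_orbit n (std_form J J' k)" by (auto simp: families_def)
  note std = std_form_closed[OF k(1)]
  have "chain_form.n J k = n" using k chain_form.n_def[OF chain_form_flavours, of k] by simp
  then have "handsaw_stable (card J) n \<zeta> (std_form J J' k)"
    using chain_form.std_stable_neg[OF chain_form_flavours, where k = k and h = "1\<^sub>m n" and \<zeta> = \<zeta>] assms GL_act_one[OF std] by simp
  then show "x \<in> fixed_points r J J' \<zeta> n"
    using std k std_orbit_torus[OF J J' disj k(1)]
    by (auto simp: fixed_points_def handsaw_variety_def stable_points_def)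
qed

lemma std_orbit_inj: "inj_on (\<lambda>k. GL_orbit n (std_form J J' k)) (families J n)"
proof (rule inj_onI)
  fix k k' assume k: "k \<in> families J n" "k' \<in> families J n"
    and eq: "GL_orbit n (std_form J J' k) = GL_orbit n (std_form J J' k')"
  then have s: "sum k J = n" "sum k' J = n" by (simp_all add: families_def)
  have "std_form J J' k \<in> GL_orbit n (std_form J J' k')" using GL_orbit_refl[OF std_form_closed[OF s(1)]] eq by simp
  then obtain h where "h \<in> GL n" "std_form J J' k = GL_act n h (std_form J J' k')" by (auto simp: GL_orbit_def)
  then show "k = k'"
    using std_form_inj[OF flavours_finite disj _ _ s GL_one, of h] k GL_act_one[OF std_form_closed[OF s(1)]]
    by (simp add: families_def)
qed

text \<open>\<open>J'\<close> stands in the place of \<open>J0\<close> and \<open>J\<close> in that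
  of \<open>J1\<close>. Transposition reduces the claim to the classification by chains, with the
  torus acting through \<open>dual_torus\<close>.\<close>

lemma fixed_points_pos:
  assumes "\<zeta> > 0"
  shows "fixed_points r J' J \<zeta> n = (\<lambda>k. dual ` GL_orbit n (std_form J J' k)) ` families J n"
proof (intro equalityI subsetI)
  fix x assume "x \<in> fixed_points r J' J \<zeta> n"
  then obtain b where b: "b \<in> carrier (HS (card J') (card J) n)"
      "handsaw_stable (card J') n \<zeta> b" "x = GL_orbit n b"
    and fx: "\<And>t. t \<in> torus r \<Longrightarrow> torus_act J' J t ` x = x"
    by (auto simp: fixed_points_def handsaw_variety_def stable_points_def)
  have db: "dual b \<in> carrier (HS (card J) (card J') n)" using b(1) by simp
  have "\<exists>g\<in>GL n. GL_act n g (torus_act J J' t (dual b)) = dual b" if t: "t \<in> torus r" for t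
  proof -
    \<comment> \<open>The orbit of \<open>b\<close> is fixed by every torus element, in particular
      by the one through which \<open>t\<close> acts on the dual triple.\<close>
    obtain g where g: "g \<in> GL n" "torus_act J' J (dual_torus r t) b = GL_act n g b"
      using fixed_ex_GL[OF b(1)] fx[OF dual_torus_closed[OF t]] b(3) by blast
    have "torus_act J J' t (dual b) = GL_act n (transpose_mat (GL_inv n g)) (dual b)"
      unfolding torus_act_dual[OF J J' t b(1)] g(2) by (rule dual_GL_act[OF g(1) b(1)])
    moreover have gt: "transpose_mat (GL_inv n g) \<in> GL n" using g(1) by simp
    ultimately have "GL_act n (GL_inv n (transpose_mat (GL_inv n g))) (torus_act J J' t (dual b)) = dual b"
      using GL_act_inv(1)[OF gt db] by simp
    then show ?thesis using GL_inv_closed[OF gt] by blast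
  qed
  then obtain k h where k: "k \<in> J \<rightarrow>\<^sub>E UNIV" "sum k J = n" "h \<in> GL n" "dual b = GL_act n h (std_form J J' k)"
    using classification[OF J J' disj db stable_pos_generating[OF assms b(1,2)]] by blast
  have "dual ` x = GL_orbit n (std_form J J' k)"
    unfolding b(3) dual_GL_orbit[OF b(1)] k(4) by (rule GL_orbit_eq[OF k(3) std_form_closed[OF k(2)]])
  then have "x = dual ` GL_orbit n (std_form J J' k)" by (metis (no_types, lifting) dual_dual image_cong image_ident image_image)
  then show "x \<in> (\<lambda>k. dual ` GL_orbit n (std_form J J' k)) ` families J n" using k by (auto simp: families_def)
next
  fix x assume "x \<in> (\<lambda>k. dual ` GL_orbit n (std_form J J' k)) ` families J n"
  then obtain k where k: "sum k J = n" "x = dual ` GL_orbit n (std_form J J' k)" by (auto simp: families_def)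
  note std = std_form_closed[OF k(1)]
  have "chain_form.n J k = n" using k chain_form.n_def[OF chain_form_flavours, of k] by simp
  then have "generating n (dual (dual (std_form J J' k)))"
    using chain_form.generating_std[OF chain_form_flavours, where k = k and h = "1\<^sub>m n"] GL_act_one[OF std] by simp
  then have st: "handsaw_stable (card J') n \<zeta> (dual (std_form J J' k))"
    by (intro generating_stable_pos[OF assms, of _ "card J'" "card J"]) (use std in simp_all)
  have orb: "GL_orbit n (std_form J J' k) \<subseteq> carrier (HS (card J) (card J') n)"
    using GL_act_closed[OF _ std] by (auto simp: GL_orbit_def)
  have "torus_act J' J t ` x = x" if t: "t \<in> torus r" for t
  proof -
    have "torus_act J' J t ` x = dual ` torus_act J J' (dual_torus r t) ` GL_orbit n (std_form J J' k)"
      unfolding k(2) image_image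
      by (intro image_cong refl torus_act_dual[OF J' J t]) (use orb in blast)
    then show ?thesis unfolding std_orbit_torus[OF J J' disj k(1) dual_torus_closed[OF t]] k(2) .
  qed
  moreover have "x = GL_orbit n (dual (std_form J J' k))" unfolding k(2) by (rule dual_GL_orbit[OF std])
  ultimately show "x \<in> fixed_points r J' J \<zeta> n"
    using std st by (auto simp: fixed_points_def handsaw_variety_def stable_points_def)
qed

lemma dual_orbit_inj: "inj_on (\<lambda>k. dual ` GL_orbit n (std_form J J' k)) (families J n)"
proof -
  have "inj dual" by (metis dual_dual injI)
  then show ?thesis using std_orbit_inj[of n] by (simp add: inj_on_def inj_image_eq_iff)
qed

end

section \<open>Characters of the fibre and of the tangent space\<close>

definition ech :: "nat \<Rightarrow> nat \<Rightarrow> int \<Rightarrow> nat \<Rightarrow> int" where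
  "ech r i m = restrict ((\<lambda>_. 0)(i := m)) {..<2 * r + 2}"

lemma char_val_ech: "i < 2 * r + 2 \<Longrightarrow> char_val r (ech r i m) t = t i powi m"
proof -
  assume i: "i < 2 * r + 2"
  have "char_val r (ech r i m) t = (\<Prod>j<2 * r + 2. if j = i then t i powi m else 1)"
    unfolding char_val_def ech_def by (intro prod.cong) auto
  then show ?thesis using i by simp
qed

lemma Eu_char_ech: "i < 2 * r + 2 \<Longrightarrow> Eu_char r (ech r i m) = of_int m * X i"
proof -
  assume i: "i < 2 * r + 2"
  have "Eu_char r (ech r i m) = (\<Sum>j<2 * r + 2. if j = i then of_int m * X i else 0)"
    unfolding Eu_char_def ech_def by (intro sum.cong) auto
  then show ?thesis using i by simp
qed

definition fibre_char :: "nat \<Rightarrow> nat \<Rightarrow> int \<Rightarrow> nat \<Rightarrow> int" where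
  "fibre_char r \<alpha> m = char_mult r (ech r (e_ix \<alpha>) 1) (ech r q_ix m)"

text \<open>The exponent \<open>\<sigma>\<close> is 1 for negative and -1 for positive stability:
  duality inverts ratios of flavour weights.\<close>

definition tangent_char :: "nat \<Rightarrow> int \<Rightarrow> nat \<Rightarrow> nat \<Rightarrow> int \<Rightarrow> nat \<Rightarrow> int" where
  "tangent_char r \<sigma> \<alpha> \<beta> m = char_mult r (char_mult r (ech r (e_ix \<alpha>) \<sigma>) (ech r (e_ix \<beta>) (- \<sigma>))) (ech r q_ix m)"

lemma char_val_fibre_char:
  assumes "t \<in> torus r" "\<alpha> \<in> {1..r}"
  shows "char_val r (fibre_char r \<alpha> m) t = t (e_ix \<alpha>) * t q_ix powi m"
  using assms by (simp add: fibre_char_def char_val_char_mult char_val_ech e_ix_def q_ix_def)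

lemma char_val_tangent_char:
  assumes "t \<in> torus r" "\<alpha> \<in> {1..r}" "\<beta> \<in> {1..r}"
  shows "char_val r (tangent_char r \<sigma> \<alpha> \<beta> m) t = t (e_ix \<alpha>) powi \<sigma> * t (e_ix \<beta>) powi (- \<sigma>) * t q_ix powi m"
  using assms by (simp add: tangent_char_def char_val_char_mult char_val_ech e_ix_def q_ix_def)

lemma Eu_fibre_char:
  "\<alpha> \<in> {1..r} \<Longrightarrow> Eu_char r (fibre_char r \<alpha> m) = avar \<alpha> + of_int m * eps"
  by (simp add: fibre_char_def Eu_char_char_mult Eu_char_ech e_ix_def q_ix_def avar_def eps_def)

lemma Eu_tangent_char:
  "\<alpha> \<in> {1..r} \<Longrightarrow> \<beta> \<in> {1..r} \<Longrightarrow>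
    Eu_char r (tangent_char r \<sigma> \<alpha> \<beta> m) = of_int \<sigma> * avar \<alpha> - of_int \<sigma> * avar \<beta> + of_int m * eps"
  by (simp add: tangent_char_def Eu_char_char_mult Eu_char_ech e_ix_def q_ix_def avar_def eps_def)

lemma Eu_adj_char: "Eu_char r (adj_char r) = thvar r"
proof -
  have "adj_char r = ech r (th_ix r) 1" by (simp add: adj_char_def ech_def)
  then show ?thesis by (simp add: Eu_char_ech th_ix_def thvar_def)
qed

lemma Eu_fund_char: "f \<in> {1..r} \<Longrightarrow> Eu_char r (fund_char r f) = mvar r f - eps"
proof -
  assume f: "f \<in> {1..r}"
  then have "fund_char r f = char_mult r (ech r (m_ix r f) 1) (ech r q_ix (-1))"
    by (auto simp: fund_char_def char_mult_def ech_def m_ix_def q_ix_def fun_eq_iff)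
  then show ?thesis using f by (simp add: Eu_char_char_mult Eu_char_ech m_ix_def q_ix_def mvar_def eps_def)
qed


section \<open>Euler classes at the fixed points\<close>

lemma repr_mem: "x \<noteq> {} \<Longrightarrow> repr x \<in> x"
  unfolding repr_def by (rule someI_ex) blast

text \<open>A representative \<open>b\<close> of the fixed point \<open>k\<close> for negative stability, written as \<open>h\<close> applied
  to the standard form, together with its slice \<open>S\<close> and the torus action \<open>g\<close> on the fibre.\<close>

locale fixed_pt = chain_form J J' k for J J' :: "nat set" and k +
  fixes r :: nat and h :: "complex mat"
  assumes J: "J \<subseteq> {1..r}" and J': "J' \<subseteq> {1..r}" and h: "h \<in> GL n"
begin

definition b where "b = GL_act n h (std_form J J' k)"
definition g where "g t = h * mat_diag n (lam t) * GL_inv n h"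
definition S where "S c = GL_act n h (slice c)"

abbreviation "M \<equiv> HS (card J) (card J') n"

lemma b_closed: "b \<in> carrier M"
  unfolding b_def by (rule GL_act_closed[OF h std_form_carrier])

lemma b_free: "f \<in> GL n \<Longrightarrow> GL_act n f b = b \<Longrightarrow> f = 1\<^sub>m n"
  using generating_free[OF b_closed generating_std[OF h, folded b_def]] .

lemma h_carrier: "h \<in> carrier_mat n n" "GL_inv n h \<in> carrier_mat n n"
  using h by auto

lemma S_closed: "S c \<in> carrier M"
  unfolding S_def by (rule GL_act_closed[OF h slice_closed])

lemma S_add: "S (\<lambda>i. c i + d i) = S c \<oplus>\<^bsub>M\<^esub> S d"
  unfolding S_def slice_add by (rule GL_act_add[OF h slice_closed slice_closed])

lemma S_smult: "S (\<lambda>i. a * c i) = a \<odot>\<^bsub>M\<^esub> S c"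
  unfolding S_def slice_smult by (rule GL_act_smult[OF h slice_closed])

lemma gl_image_b: "gl_image n b = GL_act n h ` gl_image n (std_form J J' k)"
  unfolding b_def by (rule GL_act_gl_image[OF h std_form_carrier, symmetric])

lemma gl_image_carrier: "b' \<in> carrier M \<Longrightarrow> gl_image n b' \<subseteq> carrier M"
  unfolding gl_image_eq using gl_inf_closed by blast

lemma S_in_gl_image: "S c \<in> gl_image n b \<longleftrightarrow> (\<forall>i\<in>{..<n} \<times> (J \<union> J'). c i = 0)"
proof -
  have "S c \<in> gl_image n b \<longleftrightarrow> slice c \<in> gl_image n (std_form J J' k)"
  proof
    assume "S c \<in> gl_image n b"
    then obtain y where y: "y \<in> gl_image n (std_form J J' k)" "GL_act n h (slice c) = GL_act n h y"
      unfolding gl_image_b S_def by blast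
    then have "y \<in> carrier M"
      using gl_image_carrier[OF std_form_carrier] by blast
    have "slice c = GL_act n (GL_inv n h) (GL_act n h (slice c))"
      by (rule GL_act_inv(1)[OF h slice_closed, symmetric])
    also have "\<dots> = y" unfolding y(2) by (rule GL_act_inv(1)[OF h \<open>y \<in> carrier M\<close>])
    finally have "slice c = y" .
    then show "slice c \<in> gl_image n (std_form J J' k)" using y(1) by simp
  qed (unfold gl_image_b S_def, rule imageI)
  then show ?thesis unfolding slice_in_gl_image .
qed

lemma S_decomp:
  assumes u: "u \<in> carrier M"
  shows "\<exists>v\<in>gl_image n b. \<exists>c. u = v \<oplus>\<^bsub>M\<^esub> S c"
proof -
  have "GL_act n (GL_inv n h) u \<in> carrier M" by (rule GL_act_closed[OF GL_inv_closed[OF h] u])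
  then obtain v c where v: "v \<in> gl_image n (std_form J J' k)" "GL_act n (GL_inv n h) u = v \<oplus>\<^bsub>M\<^esub> slice c"
    using slice_decomp by blast
  then have vc: "v \<in> carrier M" using gl_image_carrier[OF std_form_carrier] by blast
  have "u = GL_act n h (v \<oplus>\<^bsub>M\<^esub> slice c)" using GL_act_inv(2)[OF h u] v(2) by simp
  also have "\<dots> = GL_act n h v \<oplus>\<^bsub>M\<^esub> S c" unfolding S_def by (rule GL_act_add[OF h vc slice_closed])
  finally show ?thesis using v(1) unfolding gl_image_b by blast
qed

lemma g_facts:
  assumes t: "t \<in> torus r"
  shows g_GL: "g t \<in> GL n"
    and g_fixed: "GL_act n (g t) (torus_act J J' t b) = b"
    and g_eigen: "GL_act n (g t) (torus_act J J' t (S c)) = S (\<lambda>x. slice_weight t x * c x)"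
    and g_diag: "g t * h = h * mat_diag n (lam t)"
    and g_inv: "GL_inv n (g t) = h * mat_diag n (\<lambda>s. inverse (lam t s)) * GL_inv n h"
proof -
  have q: "t q_ix \<noteq> 0" using torus_nonzero[OF t] by (simp add: q_ix_def)
  have e: "t (e_ix \<alpha>) \<noteq> 0" if "\<alpha> \<in> J" for \<alpha>
    using torus_nonzero[OF t, of \<alpha>] J that by (auto simp: e_ix_def)
  let ?d = "mat_diag n (lam t)"
  have sf: "GL_act n ?d (torus_act J J' t (std_form J J' k)) = std_form J J' k"
    by (rule std_form_fixed[of t, OF q]) (rule e)
  have se: "GL_act n ?d (torus_act J J' t (slice c)) = slice (\<lambda>x. slice_weight t x * c x)"
    by (rule slice_eigen[of t, OF q]) (rule e)
  have d: "?d \<in> GL n" and dinv: "GL_inv n ?d = mat_diag n (\<lambda>s. inverse (lam t s))"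
    using mat_diag_GL[of n "lam t"] lam_nonzero[OF q e] by auto
  have hi: "GL_inv n h \<in> GL n" using h by simp
  have hd: "h * ?d \<in> GL n" using h d by simp
  show g: "g t \<in> GL n" unfolding g_def using hd hi by simp
  \<comment> \<open>The torus action commutes with \<open>h\<close>, so the inner \<open>h\<close>
    cancels against the inverse in \<open>g t\<close>, which reduces all claims to the standard
    form.\<close>
  have conj: "GL_act n (g t) (torus_act J J' t (GL_act n h y)) = GL_act n h (GL_act n ?d (torus_act J J' t y))"
    if y: "y \<in> carrier M" for y
  proof -
    note ty = torus_act_closed[OF y, of t]
    have "GL_act n (g t) (torus_act J J' t (GL_act n h y)) = GL_act n (h * ?d) (GL_act n (GL_inv n h) (GL_act n h (torus_act J J' t y)))"
      unfolding g_def torus_act_GL_act[OF h y] by (rule GL_act_mult[OF hd hi GL_act_closed[OF h ty]])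
    also have "\<dots> = GL_act n h (GL_act n ?d (torus_act J J' t y))"
      unfolding GL_act_inv(1)[OF h ty] by (rule GL_act_mult[OF h d ty])
    finally show ?thesis .
  qed
  show "GL_act n (g t) (torus_act J J' t b) = b"
    unfolding b_def conj[OF std_form_carrier] sf ..
  show "GL_act n (g t) (torus_act J J' t (S c)) = S (\<lambda>x. slice_weight t x * c x)"
    unfolding S_def conj[OF slice_closed] se ..
  have c: "h * ?d \<in> carrier_mat n n" "?d \<in> carrier_mat n n" using h_carrier(1) by auto
  show "g t * h = h * ?d"
    unfolding g_def assoc_mult_mat[OF c(1) h_carrier(2,1)] GL_inv_left[OF h] by (rule right_mult_one_mat[OF c(1)])
  show "GL_inv n (g t) = h * mat_diag n (\<lambda>s. inverse (lam t s)) * GL_inv n h"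
    unfolding g_def GL_inv_mult[OF hd hi] GL_inv_mult[OF h d] GL_inv_inv[OF h] dinv
    by (rule assoc_mult_mat[symmetric, OF h_carrier(1) _ h_carrier(2)]) simp
qed

lemma chain_mem: "s < n \<Longrightarrow> fst (p s) \<in> J" "s < n \<Longrightarrow> fst (p s) \<in> {1..r}"
  using p_chains[of s] J by (auto simp: chains_def)

text \<open>Weights need to be matched only on the actual coordinate set.\<close>

lemma S_cong:
  assumes "\<forall>i\<in>{..<n} \<times> (J \<union> J'). c i = d i"
  shows "S c = S d"
proof -
  have "slice c = slice d" unfolding slice_def slice_B_def slice_z_def slice_w_def
    using assms chain_mem(1) by (auto intro!: eq_matI)
  then show ?thesis by (simp add: S_def)
qed

text \<open>The power of q does not depend on \<open>\<sigma>\<close>: under e -> 1/(qe) a ratio of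
  two flavour weights is inverted and the two factors q cancel.\<close>

definition tchar :: "int \<Rightarrow> nat \<times> nat \<Rightarrow> nat \<Rightarrow> nat \<Rightarrow> int" where
  "tchar \<sigma> a \<beta> = (if \<beta> \<in> J then tangent_char r \<sigma> (fst a) \<beta> (int (k \<beta>) - int (snd a))
     else tangent_char r \<sigma> \<beta> (fst a) (int (snd a) + 1))"

lemma tchar_chars: "tchar \<sigma> a \<beta> \<in> chars r"
  by (simp add: tchar_def tangent_char_def)

lemma lam_char:
  assumes "t \<in> torus r" "s < n"
  shows "lam t s = char_val r (fibre_char r (fst (p s)) (- int (snd (p s)))) t"
  using assms chain_mem(2)[of s] by (simp add: lam_def char_val_fibre_char power_int_minus power_inverse)

text \<open>The dual fibre has inverse weights; the inverse of e' q^(-i) with e' = 1/(qe) is e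
  q^(i+1), which is where the shift by one comes from.\<close>

lemma lam_dual_char:
  assumes t: "t \<in> torus r" and s: "s < n"
  shows "inverse (lam (dual_torus r t) s) = char_val r (fibre_char r (fst (p s)) (int (snd (p s)) + 1)) t"
proof -
  have q: "t q_ix \<noteq> 0" using torus_nonzero[OF t] by (simp add: q_ix_def)
  have "dual_torus r t (e_ix \<alpha>) = inverse (t q_ix * t (e_ix \<alpha>))" if "\<alpha> \<in> {1..r}" for \<alpha>
    using that by (auto simp: dual_torus_def e_ix_def)
  moreover have "dual_torus r t q_ix = t q_ix" by (simp add: dual_torus_def q_ix_def)
  ultimately show ?thesis
    using t chain_mem(2)[OF s] q
    by (simp add: lam_def char_val_fibre_char power_int_add power_inverse[symmetric] mult_ac)
qed

lemma slice_weight_char: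
  assumes t: "t \<in> torus r" and s: "s < n" and \<beta>: "\<beta> \<in> J \<union> J'"
  shows "slice_weight t (s, \<beta>) = char_val r (tchar 1 (p s) \<beta>) t"
proof -
  have q: "t q_ix \<noteq> 0" using torus_nonzero[OF t] by (simp add: q_ix_def)
  have "\<beta> \<in> {1..r}" using \<beta> J J' by auto
  then show ?thesis
    using t chain_mem(2)[OF s] q
    by (simp add: slice_weight_def tchar_def lam_def char_val_tangent_char power_int_diff power_int_add
        power_int_minus power_inverse divide_inverse mult_ac)
qed

lemma slice_weight_dual_char:
  assumes t: "t \<in> torus r" and s: "s < n" and \<beta>: "\<beta> \<in> J \<union> J'"
  shows "slice_weight (dual_torus r t) (s, \<beta>) = char_val r (tchar (- 1) (p s) \<beta>) t"
proof -
  have q: "t q_ix \<noteq> 0" using torus_nonzero[OF t] by (simp add: q_ix_def)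
  have \<beta>: "\<beta> \<in> {1..r}" using \<beta> J J' by auto
  have "dual_torus r t (e_ix \<alpha>) = inverse (t q_ix * t (e_ix \<alpha>))" if "\<alpha> \<in> {1..r}" for \<alpha>
    using that by (auto simp: dual_torus_def e_ix_def)
  moreover have "dual_torus r t q_ix = t q_ix" by (simp add: dual_torus_def q_ix_def)
  ultimately show ?thesis
    using t chain_mem(2)[OF s] q \<beta>
    by (simp add: slice_weight_def tchar_def lam_def char_val_tangent_char power_int_diff power_int_add
        power_int_minus power_inverse divide_inverse mult_ac)
qed

section \<open>Products over the weights of a fixed point\<close>

lemma prod_enum: "(\<Prod>s<n. f (p s)) = (\<Prod>\<alpha>\<in>J. \<Prod>i<k \<alpha>. f (\<alpha>, i))" for f :: "nat \<times> nat \<Rightarrow> ratfun"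
proof -
  have "(\<Prod>s<n. f (p s)) = (\<Prod>a\<in>chains J k. f a)" by (rule prod.reindex_bij_betw[OF p_bij])
  also have "\<dots> = (\<Prod>\<alpha>\<in>J. \<Prod>i<k \<alpha>. f (\<alpha>, i))"
    unfolding chains_def by (subst prod.Sigma) (auto simp: finJ intro!: prod.cong)
  finally show ?thesis .
qed

lemma prod_slice: "(\<Prod>x\<in>{..<n} \<times> (J \<union> J'). f (p (fst x)) (snd x)) =
    (\<Prod>\<alpha>\<in>J. \<Prod>i<k \<alpha>. (\<Prod>\<beta>\<in>J. f (\<alpha>, i) \<beta>) * (\<Prod>\<beta>\<in>J'. f (\<alpha>, i) \<beta>))"
  for f :: "nat \<times> nat \<Rightarrow> nat \<Rightarrow> ratfun"
proof -
  have "(\<Prod>x\<in>{..<n} \<times> (J \<union> J'). f (p (fst x)) (snd x)) = (\<Prod>s<n. \<Prod>\<beta>\<in>J \<union> J'. f (p s) \<beta>)"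
    unfolding prod.cartesian_product by (intro prod.cong) auto
  also have "\<dots> = (\<Prod>s<n. (\<Prod>\<beta>\<in>J. f (p s) \<beta>) * (\<Prod>\<beta>\<in>J'. f (p s) \<beta>))"
    by (intro prod.cong refl prod.union_disjoint finJ finJ' disj)
  finally show ?thesis
    unfolding prod_enum[of "\<lambda>a. (\<Prod>\<beta>\<in>J. f a \<beta>) * (\<Prod>\<beta>\<in>J'. f a \<beta>)"] .
qed

text \<open>The tangent weights, each shifted by \<open>\<theta>\<close>: the shift 0 gives the
  tangent Euler class and \<open>thvar r\<close> gives the adjoint matter class.\<close>

definition tan_prod :: "int \<Rightarrow> ratfun \<Rightarrow> ratfun" where
  "tan_prod \<sigma> \<theta> = (\<Prod>\<alpha>\<in>J. \<Prod>i<k \<alpha>.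
     (\<Prod>\<beta>\<in>J. \<theta> + of_int \<sigma> * avar \<alpha> - of_int \<sigma> * avar \<beta> + of_int (int (k \<beta>) - int i) * eps) *
     (\<Prod>\<beta>\<in>J'. \<theta> + of_int \<sigma> * avar \<beta> - of_int \<sigma> * avar \<alpha> + of_int (int i + 1) * eps))"

lemma prod_tchar:
  "(\<Prod>x\<in>{..<n} \<times> (J \<union> J'). \<theta> + Eu_char r (tchar \<sigma> (p (fst x)) (snd x))) = tan_prod \<sigma> \<theta>"
proof -
  have "\<beta> \<notin> J" if "\<beta> \<in> J'" for \<beta> using that disj by blast
  then show ?thesis
    unfolding prod_slice[of "\<lambda>a \<beta>. \<theta> + Eu_char r (tchar \<sigma> a \<beta>)"] tan_prod_def
    using J J' by (intro prod.cong refl arg_cong2[of _ _ _ _ "(*)"])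
      (auto simp: tchar_def Eu_tangent_char subset_iff add.assoc add_diff_eq simp del: of_int_diff of_int_add)
qed

lemma neg_Eu:
  assumes x: "repr x = b"
  shows "Eu r (tangent_space (card J) (card J') n x) (tangent_act J J' n x) = tan_prod 1 0"
    and "psi_adj r J J' n x = tan_prod 1 (thvar r)"
    and "psi_fund r J J' n x = (\<Prod>f=1..r. \<Prod>\<alpha>\<in>J. \<Prod>i<k \<alpha>. mvar r f - eps + (avar \<alpha> + of_int (- int i) * eps))"
proof -
  let ?I = "{..<n} \<times> (J \<union> J')" and ?\<chi> = "\<lambda>x. tchar 1 (p (fst x)) (snd x)"
  have eig: "GL_act n (g t) (torus_act J J' t (S c)) = S (\<lambda>x. char_val r (?\<chi> x) t * c x)" if t: "t \<in> torus r" for t c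
    unfolding g_eigen[OF t] by (rule S_cong) (auto simp: slice_weight_char[OF t])
  have fin: "finite ?I" using finJ finJ' by simp
  note T = tangent_Eu[OF b_closed x, where g = g and S = S and I = ?I and \<chi> = ?\<chi> and r = r]
  have T1: "Eu r (tangent_space (card J) (card J') n x) (tangent_act J J' n x) = (\<Prod>y\<in>?I. Eu_char r (?\<chi> y))"
    by (rule T(1))
      (rule b_free g_GL g_fixed S_closed S_add S_smult S_in_gl_image S_decomp eig tchar_chars fin; assumption?)+
  have T2: "Eu r (tangent_space (card J) (card J') n x)
      (twist r (tangent_space (card J) (card J') n x) \<mu> (tangent_act J J' n x)) = (\<Prod>y\<in>?I. Eu_char r \<mu> + Eu_char r (?\<chi> y))" for \<mu>
    by (rule T(2))
      (rule b_free g_GL g_fixed S_closed S_add S_smult S_in_gl_image S_decomp eig tchar_chars fin; assumption?)+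
  show "Eu r (tangent_space (card J) (card J') n x) (tangent_act J J' n x) = tan_prod 1 0"
    unfolding T1 prod_tchar[symmetric] by simp
  show "psi_adj r J J' n x = tan_prod 1 (thvar r)"
    unfolding psi_adj_def Let_def T2 Eu_adj_char by (rule prod_tchar)
  have diag: "g t * h = h * mat_diag n (\<lambda>s. char_val r (fibre_char r (fst (p s)) (- int (snd (p s)))) t)"
    if t: "t \<in> torus r" for t
    unfolding g_diag[OF t] using lam_char[OF t] by (intro arg_cong[of _ _ "(*) h"]) (auto simp: mat_diag_def)
  have "Eu r (Cn n) (twist r (Cn n) (fund_char r f) (fibre_act J J' n x)) =
      (\<Prod>\<alpha>\<in>J. \<Prod>i<k \<alpha>. mvar r f - eps + (avar \<alpha> + of_int (- int i) * eps))" if "f \<in> {1..r}" for f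
  proof -
    have "Eu r (Cn n) (twist r (Cn n) (fund_char r f) (fibre_act J J' n x)) =
        (\<Prod>s<n. mvar r f - eps + Eu_char r (fibre_char r (fst (p s)) (- int (snd (p s)))))"
      unfolding Eu_fund_char[OF that, symmetric]
      by (rule fibre_Eu[OF b_closed x, where g = g]) (rule b_free g_GL g_fixed h diag; assumption?)+
    also have "\<dots> = (\<Prod>s<n. mvar r f - eps + (avar (fst (p s)) + of_int (- int (snd (p s))) * eps))"
      by (intro prod.cong refl arg_cong[of _ _ "(+) _"] Eu_fibre_char chain_mem(2)) simp
    finally show ?thesis using prod_enum[of "\<lambda>a. mvar r f - eps + (avar (fst a) + of_int (- int (snd a)) * eps)"] by simp
  qed
  note fund = this
  show "psi_fund r J J' n x = (\<Prod>f=1..r. \<Prod>\<alpha>\<in>J. \<Prod>i<k \<alpha>. mvar r f - eps + (avar \<alpha> + of_int (- int i) * eps))"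
    unfolding psi_fund_def by (rule prod.cong[OF refl]) (rule fund)
qed

lemma pos_Eu:
  assumes x: "repr x = dual b"
  shows "Eu r (tangent_space (card J') (card J) n x) (tangent_act J' J n x) = tan_prod (- 1) 0"
    and "psi_adj r J' J n x = tan_prod (- 1) (thvar r)"
    and "psi_fund r J' J n x = (\<Prod>f=1..r. \<Prod>\<alpha>\<in>J. \<Prod>i<k \<alpha>. mvar r f - eps + (avar \<alpha> + of_int (int i + 1) * eps))"
proof -
  let ?I = "{..<n} \<times> (J \<union> J')" and ?\<chi> = "\<lambda>x. tchar (- 1) (p (fst x)) (snd x)"
  let ?DS = "HS (card J') (card J) n"
  define S' where "S' c = dual (S c)" for c
  \<comment> \<open>The contragredient of the fibre action at the dual torus element; the uniqueness
    of the fibre action makes this the only candidate.\<close>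
  define g' where "g' t = transpose_mat (GL_inv n (g (dual_torus r t)))" for t
  have db: "dual b \<in> carrier ?DS" using b_closed by simp
  have free: "f = 1\<^sub>m n" if f: "f \<in> GL n" "GL_act n f (dual b) = dual b" for f
  proof -
    have "GL_act n (transpose_mat (GL_inv n f)) b = b"
      using dual_GL_act[OF f(1) db] f(2) by simp
    then have "transpose_mat (GL_inv n f) = 1\<^sub>m n" using b_free f(1) by simp
    then have "GL_inv n f = 1\<^sub>m n" by (metis transpose_one transpose_transpose)
    then show ?thesis using GL_inv_inv[OF f(1)] by simp
  qed
  have g'GL: "g' t \<in> GL n" if "t \<in> torus r" for t
    using g_GL[OF dual_torus_closed[OF that]] by (simp add: g'_def)
  have act: "GL_act n (g' t) (torus_act J' J t (dual y)) = dual (GL_act n (g (dual_torus r t)) (torus_act J J' (dual_torus r t) y))"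
    if t: "t \<in> torus r" and y: "y \<in> carrier M" for t y
    unfolding torus_act_dual[OF J' J t y] g'_def
    by (rule dual_GL_act[OF g_GL[OF dual_torus_closed[OF t]] torus_act_closed[OF y], symmetric])
  have fixed: "GL_act n (g' t) (torus_act J' J t (dual b)) = dual b" if t: "t \<in> torus r" for t
    unfolding act[OF t b_closed] g_fixed[OF dual_torus_closed[OF t]] ..
  have eig: "GL_act n (g' t) (torus_act J' J t (S' c)) = S' (\<lambda>x. char_val r (?\<chi> x) t * c x)"
    if t: "t \<in> torus r" for t c
    unfolding S'_def act[OF t S_closed] g_eigen[OF dual_torus_closed[OF t]]
    by (intro arg_cong[of _ _ dual] S_cong) (auto simp: slice_weight_dual_char[OF t])
  have S'_closed: "S' c \<in> carrier ?DS" for c using S_closed by (simp add: S'_def)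
  have S'_add: "S' (\<lambda>i. c i + d i) = S' c \<oplus>\<^bsub>?DS\<^esub> S' d" for c d
    unfolding S'_def S_add by (rule dual_add[OF S_closed S_closed])
  have S'_smult: "S' (\<lambda>i. a * c i) = a \<odot>\<^bsub>?DS\<^esub> S' c" for a c
    unfolding S'_def S_smult by (rule dual_smult)
  have S'_zero: "S' c \<in> gl_image n (dual b) \<longleftrightarrow> (\<forall>i\<in>?I. c i = 0)" for c
  proof -
    have "S' c \<in> gl_image n (dual b) \<longleftrightarrow> S c \<in> gl_image n b"
      unfolding S'_def dual_gl_image[OF b_closed, symmetric] by (metis dual_dual image_iff)
    then show ?thesis unfolding S_in_gl_image .
  qed
  have S'_decomp: "\<exists>v\<in>gl_image n (dual b). \<exists>c. u = v \<oplus>\<^bsub>?DS\<^esub> S' c" if u: "u \<in> carrier ?DS" for u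
  proof -
    have "dual u \<in> carrier M" using u by simp
    then obtain v c where v: "v \<in> gl_image n b" "dual u = v \<oplus>\<^bsub>M\<^esub> S c" using S_decomp by blast
    have "v \<in> carrier M" using v(1) gl_image_carrier[OF b_closed] by blast
    then have "dual (dual u) = dual v \<oplus>\<^bsub>?DS\<^esub> S' c" unfolding v(2) S'_def by (rule dual_add[OF _ S_closed])
    then have "u = dual v \<oplus>\<^bsub>?DS\<^esub> S' c" by simp
    moreover have "dual v \<in> gl_image n (dual b)" using v(1) dual_gl_image[OF b_closed] by blast
    ultimately show ?thesis by blast
  qed
  have fin: "finite ?I" using finJ finJ' by simp
  note T = tangent_Eu[OF db x, where g = g' and S = S' and I = ?I and \<chi> = ?\<chi> and r = r]
  have T1: "Eu r (tangent_space (card J') (card J) n x) (tangent_act J' J n x) = (\<Prod>y\<in>?I. Eu_char r (?\<chi> y))"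
    by (rule T(1))
      (rule free g'GL fixed S'_closed S'_add S'_smult S'_zero S'_decomp eig tchar_chars fin; assumption?)+
  have T2: "Eu r (tangent_space (card J') (card J) n x)
      (twist r (tangent_space (card J') (card J) n x) \<mu> (tangent_act J' J n x)) = (\<Prod>y\<in>?I. Eu_char r \<mu> + Eu_char r (?\<chi> y))" for \<mu>
    by (rule T(2))
      (rule free g'GL fixed S'_closed S'_add S'_smult S'_zero S'_decomp eig tchar_chars fin; assumption?)+
  show "Eu r (tangent_space (card J') (card J) n x) (tangent_act J' J n x) = tan_prod (- 1) 0"
    unfolding T1 prod_tchar[symmetric] by simp
  show "psi_adj r J' J n x = tan_prod (- 1) (thvar r)"
    unfolding psi_adj_def Let_def T2 Eu_adj_char by (rule prod_tchar)
  \<comment> \<open>The contragredient of \<open>h\<close> diagonalises \<open>g'\<close>, with the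
    inverse eigenvalues.\<close>
  define h' where "h' = transpose_mat (GL_inv n h)"
  have h': "h' \<in> GL n" using h by (simp add: h'_def)
  have diag: "g' t * h' = h' * mat_diag n (\<lambda>s. char_val r (fibre_char r (fst (p s)) (int (snd (p s)) + 1)) t)"
    if t: "t \<in> torus r" for t
  proof -
    let ?d = "mat_diag n (\<lambda>s. inverse (lam (dual_torus r t) s))"
    have d: "?d \<in> carrier_mat n n" by simp
    have "g' t * h' = transpose_mat (GL_inv n h * (h * ?d * GL_inv n h))"
      unfolding g'_def h'_def g_inv[OF dual_torus_closed[OF t]]
      by (rule transpose_mult[symmetric, OF h_carrier(2)]) (use h_carrier d in \<open>auto intro!: mult_carrier_mat\<close>)
    also have "GL_inv n h * (h * ?d * GL_inv n h) = GL_inv n h * (h * (?d * GL_inv n h))"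
      by (subst assoc_mult_mat[OF h_carrier(1) d h_carrier(2)]) simp
    also have "\<dots> = ?d * GL_inv n h" by (rule GL_cancel_left[OF h mult_carrier_mat[OF d h_carrier(2)]])
    also have "transpose_mat (?d * GL_inv n h) = h' * transpose_mat ?d"
      unfolding h'_def by (rule transpose_mult[OF d h_carrier(2)])
    also have "transpose_mat ?d = mat_diag n (\<lambda>s. char_val r (fibre_char r (fst (p s)) (int (snd (p s)) + 1)) t)"
      using lam_dual_char[OF t] by (intro eq_matI) (auto simp: mat_diag_def)
    finally show ?thesis .
  qed
  have "Eu r (Cn n) (twist r (Cn n) (fund_char r f) (fibre_act J' J n x)) =
      (\<Prod>\<alpha>\<in>J. \<Prod>i<k \<alpha>. mvar r f - eps + (avar \<alpha> + of_int (int i + 1) * eps))" if "f \<in> {1..r}" for f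
  proof -
    have "Eu r (Cn n) (twist r (Cn n) (fund_char r f) (fibre_act J' J n x)) =
        (\<Prod>s<n. mvar r f - eps + Eu_char r (fibre_char r (fst (p s)) (int (snd (p s)) + 1)))"
      unfolding Eu_fund_char[OF that, symmetric]
      by (rule fibre_Eu[OF db x, where g = g']) (rule free g'GL fixed h' diag; assumption?)+
    also have "\<dots> = (\<Prod>s<n. mvar r f - eps + (avar (fst (p s)) + of_int (int (snd (p s)) + 1) * eps))"
      by (intro prod.cong refl arg_cong[of _ _ "(+) _"] Eu_fibre_char chain_mem(2)) simp
    finally show ?thesis using prod_enum[of "\<lambda>a. mvar r f - eps + (avar (fst a) + of_int (int (snd a) + 1) * eps)"] by simp
  qed
  note fund = this
  show "psi_fund r J' J n x = (\<Prod>f=1..r. \<Prod>\<alpha>\<in>J. \<Prod>i<k \<alpha>. mvar r f - eps + (avar \<alpha> + of_int (int i + 1) * eps))"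
    unfolding psi_fund_def by (rule prod.cong[OF refl]) (rule fund)
qed

end


section \<open>Partition functions\<close>

lemma eps_nonzero: "eps \<noteq> 0"
proof -
  have "Poly_Mapping.single (Poly_Mapping.single q_ix 1) (1::rat) \<noteq> (0 :: (nat \<Rightarrow>\<^sub>0 nat) \<Rightarrow>\<^sub>0 rat)"
    by (metis lookup_single_eq lookup_zero zero_neq_one)
  then show ?thesis by (simp add: eps_def X_def Zero_fract_def eq_fract)
qed

text \<open>Pulling \<open>- e\<close> out of each factor leaves \<open>- x / e - K + i\<close>,
  which increases by 1 with \<open>i\<close>.\<close>

lemma prod_pochhammer_down:
  fixes e x :: "'a :: field"
  assumes "e \<noteq> 0"
  shows "(\<Prod>i<m. x + of_int (int K - int i) * e) = (- e) ^ m * pochhammer (- x / e - of_nat K) m"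
proof -
  have "(- e) ^ m * pochhammer (- x / e - of_nat K) m = (\<Prod>i<m. - e * (- x / e - of_nat K + of_nat i))"
    by (simp only: pochhammer_prod prod.distrib prod_constant card_lessThan atLeast0LessThan)
  also have "\<dots> = (\<Prod>i<m. x + of_int (int K - int i) * e)"
    using assms by (intro prod.cong) (auto simp: field_simps)
  finally show ?thesis ..
qed

text \<open>Read backwards, the multiples 1, ..., m of \<open>e\<close> form the descending
  progression that starts at \<open>m\<close>.\<close>

lemma prod_pochhammer_up:
  fixes e x :: "'a :: field"
  assumes "e \<noteq> 0"
  shows "(\<Prod>i<m. x + of_int (int i + 1) * e) = (- e) ^ m * pochhammer (- x / e - of_nat m) m"
proof -
  have "(\<Prod>i<m. x + of_int (int i + 1) * e) = (\<Prod>i<m. x + of_int (int (m - Suc i) + 1) * e)"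
    by (rule prod.nat_diff_reindex[symmetric])
  also have "\<dots> = (\<Prod>i<m. x + of_int (int m - int i) * e)"
    by (intro prod.cong refl) (simp add: of_nat_diff)
  finally show ?thesis unfolding prod_pochhammer_down[OF assms] .
qed

section \<open>Ratios of Euler classes\<close>

context fixed_pt
begin

text \<open>With \<open>off_poch\<close> this gives the denominators of the formulas at shift 0 and
  the adjoint numerators at shift \<open>thvar r\<close>; \<open>\<sigma>\<close> is 1 for negative
  and -1 for positive stability.\<close>

definition diag_poch :: "int \<Rightarrow> ratfun \<Rightarrow> ratfun" where
  "diag_poch \<sigma> \<theta> = (\<Prod>\<beta>\<in>J. \<Prod>\<alpha>\<in>J. pochhammer ((of_int \<sigma> * avar \<beta> - of_int \<sigma> * avar \<alpha> - \<theta>) / eps - of_nat (k \<beta>)) (k \<alpha>))"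

definition off_poch :: "int \<Rightarrow> ratfun \<Rightarrow> ratfun" where
  "off_poch \<sigma> \<theta> = (\<Prod>\<beta>\<in>J. \<Prod>\<alpha>\<in>J'. pochhammer ((of_int \<sigma> * avar \<beta> - of_int \<sigma> * avar \<alpha> - \<theta>) / eps - of_nat (k \<beta>)) (k \<beta>))"

lemma prod_eps_power: "(\<Prod>\<alpha>\<in>J. \<Prod>\<beta>\<in>A. c ^ k \<alpha>) = c ^ (card A * n)" for c :: ratfun
  by (simp add: n_def power_mult[symmetric] mult.commute power_sum[symmetric] sum_distrib_left[symmetric])

text \<open>Along a chain of length \<open>k \<alpha>\<close> the weights of a flavour \<beta> in
  \<open>J\<close> descend from \<open>k \<beta>\<close>, and those of a flavour in
  \<open>J'\<close> ascend from 1. Each of the \<open>r * n\<close> weights releases one factor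
  \<open>- eps\<close>.\<close>

lemma tan_prod_eq:
  assumes JJ': "J \<union> J' = {1..r}"
  shows "tan_prod \<sigma> \<theta> = (- eps) ^ (r * n) * (diag_poch \<sigma> \<theta> * off_poch \<sigma> \<theta>)"
proof -
  let ?a = "\<lambda>\<alpha>. of_int \<sigma> * avar \<alpha> :: ratfun"
  have "card J + card J' = r" using card_Un_disjoint[OF finJ finJ' disj] JJ' by simp
  then have pow: "(- eps) ^ (card J * n) * (- eps) ^ (card J' * n) = (- eps) ^ (r * n)"
    by (metis distrib_right power_add)
  have "tan_prod \<sigma> \<theta> = (\<Prod>\<alpha>\<in>J.
      (\<Prod>\<beta>\<in>J. \<Prod>i<k \<alpha>. (\<theta> + ?a \<alpha> - ?a \<beta>) + of_int (int (k \<beta>) - int i) * eps) *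
      (\<Prod>\<beta>\<in>J'. \<Prod>i<k \<alpha>. (\<theta> + ?a \<beta> - ?a \<alpha>) + of_int (int i + 1) * eps))"
    unfolding tan_prod_def prod.distrib
    by (subst prod.swap[of _ "{..<k _}" J], subst prod.swap[of _ "{..<k _}" J']) simp
  also have "\<dots> = (\<Prod>\<alpha>\<in>J.
      (\<Prod>\<beta>\<in>J. (- eps) ^ k \<alpha> * pochhammer ((?a \<beta> - ?a \<alpha> - \<theta>) / eps - of_nat (k \<beta>)) (k \<alpha>)) *
      (\<Prod>\<beta>\<in>J'. (- eps) ^ k \<alpha> * pochhammer ((?a \<alpha> - ?a \<beta> - \<theta>) / eps - of_nat (k \<alpha>)) (k \<alpha>)))"
    unfolding prod_pochhammer_down[OF eps_nonzero] prod_pochhammer_up[OF eps_nonzero] by (simp add: algebra_simps)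
  also have "\<dots> = (- eps) ^ (card J * n) * (\<Prod>\<alpha>\<in>J. \<Prod>\<beta>\<in>J. pochhammer ((?a \<beta> - ?a \<alpha> - \<theta>) / eps - of_nat (k \<beta>)) (k \<alpha>)) *
      ((- eps) ^ (card J' * n) * off_poch \<sigma> \<theta>)"
    unfolding prod.distrib prod_eps_power off_poch_def by simp
  \<comment> \<open>The outer index has so far been the flavour of the chain; exchanging the
    products gives the order of the final formula.\<close>
  also have "(\<Prod>\<alpha>\<in>J. \<Prod>\<beta>\<in>J. pochhammer ((?a \<beta> - ?a \<alpha> - \<theta>) / eps - of_nat (k \<beta>)) (k \<alpha>)) = diag_poch \<sigma> \<theta>"
    unfolding diag_poch_def by (rule prod.swap)
  finally show ?thesis unfolding pow[symmetric] by (simp add: mult_ac)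
qed

lemma adj_ratio:
  assumes "J \<union> J' = {1..r}"
  shows "tan_prod \<sigma> \<theta> / tan_prod \<sigma> 0 = diag_poch \<sigma> \<theta> / diag_poch \<sigma> 0 * (off_poch \<sigma> \<theta> / off_poch \<sigma> 0)"
  using eps_nonzero by (simp add: tan_prod_eq[OF assms])

text \<open>The power of \<open>eps\<close> from the fundamental matter meets the power of
  \<open>- eps\<close> from the tangent space, and only the sign survives.\<close>

lemma fund_ratio:
  assumes "J \<union> J' = {1..r}"
  shows "eps ^ (r * n) * F / tan_prod \<sigma> 0 = (- 1) ^ (r * n) * (F / (diag_poch \<sigma> 0 * off_poch \<sigma> 0))"
proof -
  have "(- eps) ^ (r * n) = (- 1) ^ (r * n) * eps ^ (r * n)" by (metis mult_minus1 power_mult_distrib)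
  moreover have "inverse ((- 1) ^ (r * n)) = ((- 1) ^ (r * n) :: ratfun)" by (simp add: power_inverse[symmetric])
  ultimately show ?thesis
    using eps_nonzero unfolding tan_prod_eq[OF assms] by (simp add: divide_inverse mult_ac)
qed

text \<open>The twist by the inverse of q shifts the weights to a + m - (i+1) eps, an ascending
  progression in steps of \<open>- eps\<close>; the sign in \<open>prod_pochhammer_up\<close> then
  disappears.\<close>

lemma neg_fund:
  "(\<Prod>f=1..r. \<Prod>\<alpha>\<in>J. \<Prod>i<k \<alpha>. mvar r f - eps + (avar \<alpha> + of_int (- int i) * eps)) =
    eps ^ (r * n) * (\<Prod>\<beta>\<in>J. \<Prod>f=1..r. pochhammer ((avar \<beta> + mvar r f) / eps - of_nat (k \<beta>)) (k \<beta>))"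
proof -
  have "(\<Prod>i<m. mvar r f - eps + (avar \<alpha> + of_int (- int i) * eps)) =
      eps ^ m * pochhammer ((avar \<alpha> + mvar r f) / eps - of_nat m) m" for f \<alpha> m
  proof -
    have "(\<Prod>i<m. mvar r f - eps + (avar \<alpha> + of_int (- int i) * eps)) =
        (\<Prod>i<m. (avar \<alpha> + mvar r f) + of_int (int i + 1) * (- eps))"
      by (intro prod.cong) (auto simp: algebra_simps)
    then show ?thesis
      using prod_pochhammer_up[of "- eps" "avar \<alpha> + mvar r f" m] eps_nonzero
      unfolding minus_divide_divide minus_minus by simp
  qed
  then show ?thesis
    unfolding prod.swap[of _ J "{1..r}"] by (simp only: prod.distrib prod_eps_power card_atLeastAtMost) simp
qed

text \<open>The twist by the inverse of q cancels the extra 1 in the dual weights, leaving a + m + i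
  eps. This is a descending progression from 0 in steps of \<open>- eps\<close>, hence
  \<open>K = 0\<close>.\<close>

lemma pos_fund:
  "(\<Prod>f=1..r. \<Prod>\<alpha>\<in>J. \<Prod>i<k \<alpha>. mvar r f - eps + (avar \<alpha> + of_int (int i + 1) * eps)) =
    eps ^ (r * n) * (\<Prod>\<beta>\<in>J. \<Prod>f=1..r. pochhammer ((avar \<beta> + mvar r f) / eps) (k \<beta>))"
proof -
  have "(\<Prod>i<m. mvar r f - eps + (avar \<alpha> + of_int (int i + 1) * eps)) =
      eps ^ m * pochhammer ((avar \<alpha> + mvar r f) / eps) m" for f \<alpha> m
  proof -
    have "(\<Prod>i<m. mvar r f - eps + (avar \<alpha> + of_int (int i + 1) * eps)) =
        (\<Prod>i<m. (avar \<alpha> + mvar r f) + of_int (int 0 - int i) * (- eps))"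
      by (intro prod.cong) (auto simp: algebra_simps)
    then show ?thesis
      using prod_pochhammer_down[of "- eps" "avar \<alpha> + mvar r f" 0 m] eps_nonzero
      unfolding minus_divide_divide minus_minus by simp
  qed
  then show ?thesis
    unfolding prod.swap[of _ J "{1..r}"] by (simp only: prod.distrib prod_eps_power card_atLeastAtMost) simp
qed

end

section \<open>Summation over the fixed points\<close>

context
  fixes r :: nat and J J' :: "nat set"
  assumes JJ': "J \<union> J' = {1..r}" and disj: "J \<inter> J' = {}"
begin

lemma flavours_subset: "J \<subseteq> {1..r}" "J' \<subseteq> {1..r}"
  using JJ' by auto

lemma fixed_pt_flavours:
  assumes "sum k J = n" and "h \<in> GL n"
  shows "fixed_pt J J' k r h"
proof -
  interpret chain_form J J' k
    using flavours_finite[OF flavours_subset disj] disj by unfold_locales auto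
  show ?thesis using flavours_subset assms by unfold_locales (auto simp: n_def)
qed

text \<open>The chosen representative is the standard form moved by an uncontrolled
  \<open>h\<close>, so the contribution is required for every \<open>h\<close>.\<close>

lemma loc_integral_neg:
  assumes "\<zeta> < 0"
    and val: "\<And>k h x. k \<in> families J n \<Longrightarrow> fixed_pt J J' k r h \<Longrightarrow> repr x = fixed_pt.b J J' k h \<Longrightarrow>
      \<psi> x / Eu r (tangent_space (card J) (card J') n x) (tangent_act J J' n x) = c k"
  shows "loc_integral r J J' \<zeta> n \<psi> = (\<Sum>k\<in>families J n. c k)"
proof -
  have "\<psi> x / Eu r (tangent_space (card J) (card J') n x) (tangent_act J J' n x) = c k"
    if k: "k \<in> families J n" and x: "x = GL_orbit n (std_form J J' k)" for k x
  proof -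
    have n: "sum k J = n" using k by (simp add: families_def)
    define y where "y = repr x"
    have "x \<noteq> {}" using GL_orbit_refl[OF std_form_closed[OF flavours_subset disj n]] x by auto
    then have "y \<in> x" unfolding y_def by (rule repr_mem)
    then have "y \<in> GL_orbit n (std_form J J' k)" using x by simp
    then obtain h where h: "h \<in> GL n" "y = GL_act n h (std_form J J' k)" unfolding GL_orbit_def by blast
    interpret fp: fixed_pt J J' k r h by (rule fixed_pt_flavours[OF n h(1)])
    have "fp.n = n" using n by (simp add: fp.n_def)
    then have "repr x = fp.b" using h(2) by (simp add: fp.b_def y_def)
    then show ?thesis by (rule val[OF k fp.fixed_pt_axioms])
  qed
  then show ?thesis
    unfolding loc_integral_def fixed_points_neg[OF flavours_subset disj assms(1)]
    by (subst sum.reindex[OF std_orbit_inj[OF flavours_subset disj]]) simp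
qed

lemma loc_integral_pos:
  assumes "\<zeta> > 0"
    and val: "\<And>k h x. k \<in> families J n \<Longrightarrow> fixed_pt J J' k r h \<Longrightarrow> repr x = dual (fixed_pt.b J J' k h) \<Longrightarrow>
      \<psi> x / Eu r (tangent_space (card J') (card J) n x) (tangent_act J' J n x) = c k"
  shows "loc_integral r J' J \<zeta> n \<psi> = (\<Sum>k\<in>families J n. c k)"
proof -
  have "\<psi> x / Eu r (tangent_space (card J') (card J) n x) (tangent_act J' J n x) = c k"
    if k: "k \<in> families J n" and x: "x = dual ` GL_orbit n (std_form J J' k)" for k x
  proof -
    have n: "sum k J = n" using k by (simp add: families_def)
    define y where "y = repr x"
    have "x \<noteq> {}" using GL_orbit_refl[OF std_form_closed[OF flavours_subset disj n]] x by auto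
    then have "y \<in> x" unfolding y_def by (rule repr_mem)
    then have "y \<in> dual ` GL_orbit n (std_form J J' k)" using x by simp
    then obtain h where h: "h \<in> GL n" "y = dual (GL_act n h (std_form J J' k))" unfolding GL_orbit_def by blast
    interpret fp: fixed_pt J J' k r h by (rule fixed_pt_flavours[OF n h(1)])
    have "fp.n = n" using n by (simp add: fp.n_def)
    then have "repr x = dual fp.b" using h(2) by (simp add: fp.b_def y_def)
    then show ?thesis by (rule val[OF k fp.fixed_pt_axioms])
  qed
  then show ?thesis
    unfolding loc_integral_def fixed_points_pos[OF flavours_subset disj assms(1)]
    by (subst sum.reindex[OF dual_orbit_inj[OF flavours_subset disj]]) simp
qed

lemma Z_fund_neg:
  assumes "\<zeta> < 0"
  shows "Z_fund r J J' \<zeta> = multi_series J (\<lambda>k. (-1) ^ (r * sum k J) *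
    (\<Prod>\<beta>\<in>J. (\<Prod>f=1..r. pochhammer ((avar \<beta> + mvar r f) / eps - of_nat (k \<beta>)) (k \<beta>)) /
      ((\<Prod>\<alpha>\<in>J. pochhammer ((- avar \<alpha> + avar \<beta>) / eps - of_nat (k \<beta>)) (k \<alpha>)) *
       (\<Prod>\<alpha>\<in>J'. pochhammer ((- avar \<alpha> + avar \<beta>) / eps - of_nat (k \<beta>)) (k \<beta>)))))"
    (is "_ = multi_series J ?c")
  unfolding Z_fund_def multi_series_def families_def[symmetric]
proof (intro arg_cong[of _ _ Abs_fps] ext loc_integral_neg[OF assms])
  fix n k h x assume k: "k \<in> families J n" and "fixed_pt J J' k r h" and x: "repr x = fixed_pt.b J J' k h"
  interpret fp: fixed_pt J J' k r h by fact
  have n: "fp.n = n" "sum k J = n" using k by (simp_all add: fp.n_def families_def)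
  show "psi_fund r J J' n x / Eu r (tangent_space (card J) (card J') n x) (tangent_act J J' n x) = ?c k"
    unfolding fp.neg_Eu[OF x, unfolded n(1)] fp.neg_fund fp.fund_ratio[OF JJ']
    unfolding n
    by (simp add: fp.diag_poch_def fp.off_poch_def prod_dividef prod.distrib)
qed

lemma Z_fund_pos:
  assumes "\<zeta> > 0"
  shows "Z_fund r J' J \<zeta> = multi_series J (\<lambda>k. (-1) ^ (r * sum k J) *
    (\<Prod>\<beta>\<in>J. (\<Prod>f=1..r. pochhammer ((avar \<beta> + mvar r f) / eps) (k \<beta>)) /
      ((\<Prod>\<alpha>\<in>J. pochhammer ((avar \<alpha> - avar \<beta>) / eps - of_nat (k \<beta>)) (k \<alpha>)) *
       (\<Prod>\<alpha>\<in>J'. pochhammer ((avar \<alpha> - avar \<beta>) / eps - of_nat (k \<beta>)) (k \<beta>)))))"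
    (is "_ = multi_series J ?c")
  unfolding Z_fund_def multi_series_def families_def[symmetric]
proof (intro arg_cong[of _ _ Abs_fps] ext loc_integral_pos[OF assms])
  fix n k h x assume k: "k \<in> families J n" and "fixed_pt J J' k r h" and x: "repr x = dual (fixed_pt.b J J' k h)"
  interpret fp: fixed_pt J J' k r h by fact
  have n: "fp.n = n" "sum k J = n" using k by (simp_all add: fp.n_def families_def)
  show "psi_fund r J' J n x / Eu r (tangent_space (card J') (card J) n x) (tangent_act J' J n x) = ?c k"
    unfolding fp.pos_Eu[OF x, unfolded n(1)] fp.pos_fund fp.fund_ratio[OF JJ']
    unfolding n
    by (simp add: fp.diag_poch_def fp.off_poch_def prod_dividef prod.distrib)
qed

lemma Z_adj_neg:
  assumes "\<zeta> < 0"
  shows "Z_adj r J J' \<zeta> = multi_series J (\<lambda>k.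
    (\<Prod>\<beta>\<in>J. \<Prod>\<alpha>\<in>J. pochhammer ((avar \<beta> - avar \<alpha> - thvar r) / eps - of_nat (k \<beta>)) (k \<alpha>) /
       pochhammer ((avar \<beta> - avar \<alpha>) / eps - of_nat (k \<beta>)) (k \<alpha>)) *
    (\<Prod>\<beta>\<in>J. \<Prod>\<alpha>\<in>J'. pochhammer ((avar \<beta> - avar \<alpha> - thvar r) / eps - of_nat (k \<beta>)) (k \<beta>) /
       pochhammer ((avar \<beta> - avar \<alpha>) / eps - of_nat (k \<beta>)) (k \<beta>)))"
    (is "_ = multi_series J ?c")
  unfolding Z_adj_def multi_series_def families_def[symmetric]
proof (intro arg_cong[of _ _ Abs_fps] ext loc_integral_neg[OF assms])
  fix n k h x assume k: "k \<in> families J n" and "fixed_pt J J' k r h" and x: "repr x = fixed_pt.b J J' k h"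
  interpret fp: fixed_pt J J' k r h by fact
  have n: "fp.n = n" using k by (simp add: fp.n_def families_def)
  show "psi_adj r J J' n x / Eu r (tangent_space (card J) (card J') n x) (tangent_act J J' n x) = ?c k"
    unfolding fp.neg_Eu[OF x, unfolded n] fp.adj_ratio[OF JJ']
    by (simp add: fp.diag_poch_def fp.off_poch_def prod_dividef)
qed

lemma Z_adj_pos:
  assumes "\<zeta> > 0"
  shows "Z_adj r J' J \<zeta> = multi_series J (\<lambda>k.
    (\<Prod>\<beta>\<in>J. \<Prod>\<alpha>\<in>J. pochhammer ((avar \<alpha> - avar \<beta> - thvar r) / eps - of_nat (k \<beta>)) (k \<alpha>) /
       pochhammer ((avar \<alpha> - avar \<beta>) / eps - of_nat (k \<beta>)) (k \<alpha>)) *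
    (\<Prod>\<beta>\<in>J. \<Prod>\<alpha>\<in>J'. pochhammer ((avar \<alpha> - avar \<beta> - thvar r) / eps - of_nat (k \<beta>)) (k \<beta>) /
       pochhammer ((avar \<alpha> - avar \<beta>) / eps - of_nat (k \<beta>)) (k \<beta>)))"
    (is "_ = multi_series J ?c")
  unfolding Z_adj_def multi_series_def families_def[symmetric]
proof (intro arg_cong[of _ _ Abs_fps] ext loc_integral_pos[OF assms])
  fix n k h x assume k: "k \<in> families J n" and "fixed_pt J J' k r h" and x: "repr x = dual (fixed_pt.b J J' k h)"
  interpret fp: fixed_pt J J' k r h by fact
  have n: "fp.n = n" using k by (simp add: fp.n_def families_def)
  show "psi_adj r J' J n x / Eu r (tangent_space (card J') (card J) n x) (tangent_act J' J n x) = ?c k"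
    unfolding fp.pos_Eu[OF x, unfolded n] fp.adj_ratio[OF JJ']
    by (simp add: fp.diag_poch_def fp.off_poch_def prod_dividef)
qed

end

theorem theorem2p2:
  fixes r :: nat and J0 J1 :: "nat set"
  assumes "r > 0" and "J0 \<union> J1 = {1..r}" and "J0 \<inter> J1 = {}"
  shows
    "(\<forall>\<zeta>>0. Z_fund r J0 J1 \<zeta> =
        multi_series J1 (\<lambda>k. (-1) ^ (r * sum k J1) *
          (\<Prod>\<beta>\<in>J1.
             (\<Prod>f=1..r. pochhammer ((avar \<beta> + mvar r f) / eps) (k \<beta>)) /
             ((\<Prod>\<alpha>\<in>J1. pochhammer ((avar \<alpha> - avar \<beta>) / eps - of_nat (k \<beta>)) (k \<alpha>)) *
              (\<Prod>\<alpha>\<in>J0. pochhammer ((avar \<alpha> - avar \<beta>) / eps - of_nat (k \<beta>)) (k \<beta>)))))) \<and>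
     (\<forall>\<zeta><0. Z_fund r J0 J1 \<zeta> =
        multi_series J0 (\<lambda>k. (-1) ^ (r * sum k J0) *
          (\<Prod>\<beta>\<in>J0.
             (\<Prod>f=1..r. pochhammer ((avar \<beta> + mvar r f) / eps - of_nat (k \<beta>)) (k \<beta>)) /
             ((\<Prod>\<alpha>\<in>J0. pochhammer ((- avar \<alpha> + avar \<beta>) / eps - of_nat (k \<beta>)) (k \<alpha>)) *
              (\<Prod>\<alpha>\<in>J1. pochhammer ((- avar \<alpha> + avar \<beta>) / eps - of_nat (k \<beta>)) (k \<beta>)))))) \<and>
     (\<forall>\<zeta>>0. Z_adj r J0 J1 \<zeta> =
        multi_series J1 (\<lambda>k.
          (\<Prod>\<beta>\<in>J1. \<Prod>\<alpha>\<in>J1.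
             pochhammer ((avar \<alpha> - avar \<beta> - thvar r) / eps - of_nat (k \<beta>)) (k \<alpha>) /
             pochhammer ((avar \<alpha> - avar \<beta>) / eps - of_nat (k \<beta>)) (k \<alpha>)) *
          (\<Prod>\<beta>\<in>J1. \<Prod>\<alpha>\<in>J0.
             pochhammer ((avar \<alpha> - avar \<beta> - thvar r) / eps - of_nat (k \<beta>)) (k \<beta>) /
             pochhammer ((avar \<alpha> - avar \<beta>) / eps - of_nat (k \<beta>)) (k \<beta>)))) \<and>
     (\<forall>\<zeta><0. Z_adj r J0 J1 \<zeta> =
        multi_series J0 (\<lambda>k.
          (\<Prod>\<beta>\<in>J0. \<Prod>\<alpha>\<in>J0.
             pochhammer ((avar \<beta> - avar \<alpha> - thvar r) / eps - of_nat (k \<beta>)) (k \<alpha>) /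
             pochhammer ((avar \<beta> - avar \<alpha>) / eps - of_nat (k \<beta>)) (k \<alpha>)) *
          (\<Prod>\<beta>\<in>J0. \<Prod>\<alpha>\<in>J1.
             pochhammer ((avar \<beta> - avar \<alpha> - thvar r) / eps - of_nat (k \<beta>)) (k \<beta>) /
             pochhammer ((avar \<beta> - avar \<alpha>) / eps - of_nat (k \<beta>)) (k \<beta>))))"
proof -
  \<comment> \<open>For positive \<zeta> the chains belong to the flavours in \<open>J1\<close>, so
    the partition enters with its two parts exchanged.\<close>
  have *: "J1 \<union> J0 = {1..r}" "J1 \<inter> J0 = {}" using assms by auto
  show ?thesis
    by (intro conjI allI impI)
       (rule Z_fund_pos[OF *] Z_fund_neg[OF assms(2,3)] Z_adj_pos[OF *] Z_adj_neg[OF assms(2,3)]; assumption)+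
qed

end
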